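(* Let $k$ be a field, $R=k[x_1,\ldots,x_r]$ a polynomial ring in $r\geqslant 1$ variables, and $I$ a proper monomial ideal of $R$. Let $$n_0(I):=\begin{cases}1 & \text{if } \ell(I)\leqslant 2,\\ \ell(I)(\ell(I)-1)\,d(I)^{\ell(I)-2} & \text{if } \ell(I)>2.\end{cases}$$ Then $\operatorname{Ass} R/\overline{I^n}=\operatorname{Ass} R/\overline{I^{n_0(I)}}$ for all integers $n\geqslant n_0(I)$.
   Context: Here $\overline{\mathfrak a}$ denotes the integral closure of an ideal $\mathfrak a$ of $R$, and $\operatorname{Ass}$ denotes the set of associated primes. $\ell(I)$ denotes the analytic spread of $I$, i.e. the Krull dimension of $\bigoplus_{n\geqslant 0} I^n/\mathfrak m I^n$, where $\mathfrak m=(x_1,\ldots,x_r)$. $G(I)$ denotes the minimal set of monomial generators of $I$, and $d(I):=\max\{\alpha_1+\cdots+\alpha_r \mid x_1^{\alpha_1}\cdots x_r^{\alpha_r}\in G(I)\}$ (for $I\neq 0$) is the maximal generating degree of $I$. *)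

theory Defs
  imports
    "HOL-Algebra.Algebraic_Closure_Type"
    "HOL-Algebra.Ideal_Product"
    "HOL-Algebra.QuotRing"
    "HOL-Algebra.Module"
    "HOL-Library.Poly_Mapping"
    "HOL-Library.Extended_Nat"
begin

section \<open>Commutative algebra over a ring record\<close>

text \<open>\<^const>\<open>ideals_set\<close> is the multiplicative monoid of ideals, whose unit is the whole ring;
  hence the zeroth power of every ideal (also of the zero ideal) is the whole ring.\<close>

definition ideal_pow :: "('a, 'b) ring_scheme \<Rightarrow> 'a set \<Rightarrow> nat \<Rightarrow> 'a set"
  where "ideal_pow R I n = I [^]\<^bsub>ideals_set R\<^esub> n"

definition integral_closure :: "('a, 'b) ring_scheme \<Rightarrow> 'a set \<Rightarrow> 'a set"
  where "integral_closure R I =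
    {x \<in> carrier R. \<exists>n\<ge>1. \<exists>a. (\<forall>i\<in>{1..n}. a i \<in> ideal_pow R I i) \<and>
       x [^]\<^bsub>R\<^esub> n \<oplus>\<^bsub>R\<^esub> (\<Oplus>\<^bsub>R\<^esub>i\<in>{1..n}. a i \<otimes>\<^bsub>R\<^esub> x [^]\<^bsub>R\<^esub> (n - i)) = \<zero>\<^bsub>R\<^esub>}"

definition quotient_module :: "('a, 'b) ring_scheme \<Rightarrow> 'a set \<Rightarrow> ('a, 'a set) module"
  where "quotient_module R J =
    \<lparr>carrier = carrier (R Quot J), monoid.mult = monoid.mult (R Quot J), one = one (R Quot J),
     zero = zero (R Quot J), add = add (R Quot J),
     module.smult = (\<lambda>a C. (J +>\<^bsub>R\<^esub> a) \<otimes>\<^bsub>R Quot J\<^esub> C)\<rparr>"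

definition associated_primes ::
    "('a, 'm) ring_scheme \<Rightarrow> ('a, 'b, 'd) module_scheme \<Rightarrow> 'a set set"
  where "associated_primes R M =
    {P. primeideal P R \<and>
        (\<exists>x\<in>carrier M. P = {a \<in> carrier R. a \<odot>\<^bsub>M\<^esub> x = \<zero>\<^bsub>M\<^esub>})}"

text \<open>The supremum of the empty set is 0 here, so the zero ring gets dimension 0.\<close>

definition krull_dim :: "('a, 'b) ring_scheme \<Rightarrow> enat"
  where "krull_dim R = Sup {enat n | n. \<exists>P :: nat \<Rightarrow> 'a set.
    (\<forall>i\<le>n. primeideal (P i) R) \<and> (\<forall>i<n. P i \<subset> P (Suc i))}"

text \<open>The ring \<open>\<Oplus>n\<ge>0. I^n / m I^n\<close>.  An element is a finitely supported family
  \<open>F\<close> whose component \<open>F n\<close> is a coset \<open>m I^n + a\<close> with \<open>a\<close> in \<open>I^n\<close>.  Since \<open>m I^n\<close> is an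
  ideal of the ring, \<open>I^n / m I^n\<close> lies in the quotient of the ring by \<open>m I^n\<close>, in which the
  convolution sum is taken.  The product of \<open>m I^i + a\<close> and \<open>m I^j + b\<close> is
  \<open>m I^(i+j) + a b\<close>; \<^const>\<open>rcoset_mult\<close> yields this also for factors that are cosets of
  different ideals.\<close>

definition fiber_ring :: "('a, 'b) ring_scheme \<Rightarrow> 'a set \<Rightarrow> 'a set \<Rightarrow> (nat \<Rightarrow> 'a set) ring"
  where "fiber_ring R m I =
    (let J = (\<lambda>n. m \<cdot>\<^bsub>R\<^esub> ideal_pow R I n) in
    \<lparr>carrier = {F. (\<forall>n. \<exists>a\<in>ideal_pow R I n. F n = J n +>\<^bsub>R\<^esub> a) \<and> finite {n. F n \<noteq> J n}},
     monoid.mult = (\<lambda>F G n. \<Oplus>\<^bsub>R Quot J n\<^esub>i\<in>{..n}. rcoset_mult R (J n) (F i) (G (n - i))),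
     one = (\<lambda>n. if n = 0 then J 0 +>\<^bsub>R\<^esub> \<one>\<^bsub>R\<^esub> else J n),
     zero = J,
     add = (\<lambda>F G n. F n \<oplus>\<^bsub>R Quot J n\<^esub> G n)\<rparr>)"


section \<open>Monomial ideals\<close>

text \<open>Exponent vectors are \<^typ>\<open>'v \<Rightarrow>\<^sub>0 nat\<close> for a finite type of variables, so
  \<^typ>\<open>('v \<Rightarrow>\<^sub>0 nat) \<Rightarrow>\<^sub>0 'k\<close>, with the convolution product, is the polynomial ring over
  \<^typ>\<open>'k\<close> in \<open>CARD('v)\<close> variables.\<close>

abbreviation mpoly_ring :: "(('v::finite \<Rightarrow>\<^sub>0 nat) \<Rightarrow>\<^sub>0 'k::field) ring"
  where "mpoly_ring \<equiv> ring_of_type_algebra"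

definition monomial :: "('v \<Rightarrow>\<^sub>0 nat) \<Rightarrow> ('v \<Rightarrow>\<^sub>0 nat) \<Rightarrow>\<^sub>0 'k::field"
  where "monomial a = Poly_Mapping.single a 1"

definition irrelevant_ideal :: "(('v::finite \<Rightarrow>\<^sub>0 nat) \<Rightarrow>\<^sub>0 'k::field) set"
  where "irrelevant_ideal =
    genideal mpoly_ring (range (\<lambda>v. monomial (Poly_Mapping.single v 1)))"

definition monomial_ideal :: "(('v::finite \<Rightarrow>\<^sub>0 nat) \<Rightarrow>\<^sub>0 'k::field) set \<Rightarrow> bool"
  where "monomial_ideal I \<longleftrightarrow> (\<exists>S \<subseteq> range monomial. I = genideal mpoly_ring S)"

definition min_monomial_gens ::
    "(('v::finite \<Rightarrow>\<^sub>0 nat) \<Rightarrow>\<^sub>0 'k::field) set \<Rightarrow> (('v \<Rightarrow>\<^sub>0 nat) \<Rightarrow>\<^sub>0 'k) set"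
  where "min_monomial_gens I =
    (THE G. G \<subseteq> range monomial \<and> genideal mpoly_ring G = I \<and>
            (\<forall>H. H \<subset> G \<longrightarrow> genideal mpoly_ring H \<noteq> I))"

text \<open>Only meaningful for nonzero monomial ideals, as the zero ideal has no generators.\<close>

definition max_gen_degree :: "(('v::finite \<Rightarrow>\<^sub>0 nat) \<Rightarrow>\<^sub>0 'k::field) set \<Rightarrow> nat"
  where "max_gen_degree I =
    Max {\<Sum>v\<in>UNIV. Poly_Mapping.lookup a v | a. monomial a \<in> min_monomial_gens I}"

text \<open>The Krull dimension of the fiber ring of an ideal of a polynomial ring is finite, so that
  \<^const>\<open>the_enat\<close> loses nothing.\<close>

definition analytic_spread :: "(('v::finite \<Rightarrow>\<^sub>0 nat) \<Rightarrow>\<^sub>0 'k::field) set \<Rightarrow> nat"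
  where "analytic_spread I = the_enat (krull_dim (fiber_ring mpoly_ring irrelevant_ideal I))"

definition n0 :: "(('v::finite \<Rightarrow>\<^sub>0 nat) \<Rightarrow>\<^sub>0 'k::field) set \<Rightarrow> nat"
  where "n0 I = (if analytic_spread I \<le> 2 then 1
    else analytic_spread I * (analytic_spread I - 1) * max_gen_degree I ^ (analytic_spread I - 2))"

end

theory Submission
  imports Defs "HOL-Analysis.Determinants" "Jordan_Normal_Form.Char_Poly"
begin

text \<open>
  Let \<open>E\<close> be the set of exponents of the monomials in \<open>I\<close>. The integral closure of \<open>I^n\<close> is
  the monomial ideal of the exponents \<open>a\<close> some multiple \<open>i a\<close> of which is an exponent of
  \<open>I^(n i)\<close>, that is, of the lattice points of \<open>n\<close> times the Newton polyhedron \<open>N\<close> of \<open>I\<close>. An associated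
  prime of it is generated by the variables in a set \<open>F\<close> for which there is a corner: an exponent \<open>b\<close> outside
  such that \<open>b + e_v\<close> is inside for \<open>v \<in> F\<close>, and \<open>b\<close> stays outside when the variables not in \<open>F\<close> are inverted.

  By Farkas' lemma such a corner yields a facet of the projection of \<open>N\<close> to the coordinates in \<open>F\<close> with strictly
  positive normal \<open>a\<close>, spanned by \<open>m = card F\<close> generators \<open>h_j\<close>. Conversely, let \<open>a_k\<close> be the least entry of \<open>a\<close>.
  Then \<open>\<Sum>j. m_j h_j - e_k\<close> with \<open>\<Sum>j. m_j = n\<close> lies just below the facet, and it is a corner as soon as all
  \<open>m_j\<close> exceed the coordinates of the unit vectors in the basis \<open>h_j\<close>, which by Cramer's rule are at most
  \<open>d^(m-2)\<close> after scaling. This is possible for \<open>n \<ge> 2 m d^(m-2)\<close>, hence for \<open>n \<ge> m (m - 1) d^(m-2)\<close> if \<open>m \<ge> 3\<close>;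
  the cases \<open>m \<le> 2\<close> are elementary. Finally \<open>m\<close> is at most the analytic spread: the facet lifts to a
  compact face of \<open>N\<close> of dimension at least \<open>m - 1\<close>, and a chain of faces of it gives a chain of \<open>m + 1\<close> monomial primes in
  the fiber ring.
\<close>

text \<open>The exponent \<open>m - 2\<close> is the delicate point: estimating a minor against a
  determinant known only to be a nonzero integer would give \<open>m - 1\<close>. A column of the
  matrix of the \<open>h_j\<close> has sum at most \<open>d\<close>, but also at most
  \<open>b / a_k\<close>, where \<open>b\<close> is the value of \<open>a\<close> on the facet, and
  the determinant is an integral multiple of \<open>b / a_k\<close>. Spending one column on the
  second bound cancels the determinant. The factor \<open>2 m\<close> arises because adding a unit
  vector to the corner and returning to the facet changes each \<open>m_j\<close> by two terms, each
  of size at most \<open>d^(m-2)\<close>. For \<open>m = 2\<close> this asks for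
  \<open>n \<ge> 4\<close>, while \<open>n0 I\<close> may be 1; hence the separate treatment of
  small \<open>F\<close>. The power is an additional coordinate \<open>None\<close>, so that a
  single cone, that of the Rees algebra, governs all powers; the facet found at one power then
  serves at every other, and one transfer of corners gives both inclusions. Rational scalars let
  Farkas' lemma return natural multiples. Of the analytic spread only a lower bound by
  \<open>m\<close> is needed, and its finiteness, since \<open>the_enat\<close> leaves infinity
  open.\<close>

no_notation Matrix.vec_index (infixl \<open>$\<close> 100)

section \<open>Cones and linear functionals\<close>

definition dotp :: "'a::comm_semiring_1 ^ 'n \<Rightarrow> 'a ^ 'n \<Rightarrow> 'a"
  where "dotp c x = (\<Sum>i\<in>UNIV. c $ i * x $ i)"

lemma dotp_add_right: "dotp c (x + y) = dotp c x + dotp c y"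
  by (simp add: dotp_def distrib_left sum.distrib)

lemma dotp_zero_right [simp]: "dotp c 0 = 0"
  by (simp add: dotp_def)

lemma dotp_scale_right: "dotp c (k *s x) = k * dotp c x"
  by (simp add: dotp_def sum_distrib_left mult_ac)

lemma dotp_scale_left: "dotp (k *s c) x = k * dotp c x"
  by (simp add: dotp_def sum_distrib_left mult_ac)

lemma dotp_diff_right: "dotp c (x - y) = dotp c x - dotp c y" for c :: "'a::comm_ring_1 ^ 'n"
  by (simp add: dotp_def right_diff_distrib sum_subtractf)

lemma dotp_diff_left: "dotp (c - d) x = dotp c x - dotp d x" for c :: "'a::comm_ring_1 ^ 'n"
  by (simp add: dotp_def left_diff_distrib sum_subtractf)

lemma dotp_sum_right: "dotp c (sum f A) = (\<Sum>x\<in>A. dotp c (f x))"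
  by (induction A rule: infinite_finite_induct) (simp_all add: dotp_add_right)

lemma dotp_sum_list: "dotp c (sum_list xs) = sum_list (map (dotp c) xs)"
  by (induction xs) (simp_all add: dotp_add_right)

fun in_cone :: "('a::linordered_field ^ 'n) list \<Rightarrow> 'a ^ 'n \<Rightarrow> bool" where
  "in_cone [] b \<longleftrightarrow> b = 0"
| "in_cone (x # xs) b \<longleftrightarrow> (\<exists>l\<ge>0. in_cone xs (b - l *s x))"

text \<open>Undoes the projection along \<open>w\<close> in the proof of Farkas' lemma: the
  multiples of \<open>w\<close> brought in by shearing collect into one nonnegative
  coefficient.\<close>

lemma in_cone_map_shear:
  assumes "in_cone (map (\<lambda>x. x + t x *s w) xs) y" "\<And>x. x \<in> set xs \<Longrightarrow> t x \<ge> 0"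
  shows "\<exists>l\<ge>0. in_cone xs (y - l *s w)"
  using assms
proof (induction xs arbitrary: y)
  case Nil
  then show ?case by (intro exI[of _ 0]) simp
next
  case (Cons x xs)
  then obtain l0 where l0: "l0 \<ge> 0" "in_cone (map (\<lambda>x. x + t x *s w) xs) (y - l0 *s (x + t x *s w))"
    by auto
  with Cons obtain l where l: "l \<ge> 0" "in_cone xs (y - l0 *s (x + t x *s w) - l *s w)"
    by force
  have "y - l0 *s (x + t x *s w) - l *s w = (y - (l + l0 * t x) *s w) - l0 *s x"
    by (simp add: Finite_Cartesian_Product.vec_eq_iff algebra_simps)
  with l l0 Cons.prems(2)[of x] show ?case
    by (intro exI[of _ "l + l0 * t x"]) auto
qed

text \<open>Induction on the number of generators: if the functional separating \<open>b\<close> from the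
  remaining generators is negative at \<open>w\<close>, project along \<open>w\<close> onto its kernel.\<close>

lemma farkas:
  fixes xs :: "('a::linordered_field ^ 'n) list"
  shows "in_cone xs b \<or> (\<exists>c. (\<forall>x\<in>set xs. dotp c x \<ge> 0) \<and> dotp c b < 0)"
proof (induction xs arbitrary: b rule: length_induct)
  case (1 xs)
  show ?case
  proof (cases xs)
    case Nil
    show ?thesis
    proof (cases "b = 0")
      case False
      then obtain i where i: "b $ i \<noteq> 0" by (auto simp: Finite_Cartesian_Product.vec_eq_iff)
      have "dotp b b > 0"
        unfolding dotp_def using i
        by (intro sum_pos2[where i = i]) (auto simp: zero_less_mult_iff neq_iff)
      then have "dotp (-1 *s b) b < 0"
        by (simp only: dotp_scale_left)
      with Nil show ?thesis by auto
    qed (use Nil in simp)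
  next
    case (Cons w ys)
    show ?thesis
    proof (cases "in_cone ys b")
      case True
      with Cons show ?thesis by (auto intro!: exI[of _ 0])
    next
      case False
      then obtain c where c: "\<forall>x\<in>set ys. dotp c x \<ge> 0" "dotp c b < 0"
        using 1[rule_format, of ys b] Cons by auto
      show ?thesis
      proof (cases "dotp c w \<ge> 0")
        case True
        with c Cons show ?thesis by auto
      next
        case False
        \<comment> \<open>\<open>x + s x *s w\<close> lies in the kernel of \<open>c\<close>. Since
          \<open>s b\<close> is negative, the coefficient \<open>l - s b\<close> of \<open>w\<close>
          found below is nonnegative.\<close>
        define s where "s x = - (dotp c x / dotp c w)" for x
        have s: "s x \<ge> 0" if "x \<in> set ys" for x
          using c False that by (auto simp: s_def divide_le_0_iff)
        have sb: "s b < 0"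
          using c False by (auto simp: s_def zero_less_divide_iff)
        have "in_cone (map (\<lambda>x. x + s x *s w) ys) (b + s b *s w) \<or>
          (\<exists>d. (\<forall>x\<in>set (map (\<lambda>x. x + s x *s w) ys). dotp d x \<ge> 0) \<and> dotp d (b + s b *s w) < 0)"
          using 1[rule_format, of "map (\<lambda>x. x + s x *s w) ys" "b + s b *s w"] Cons by simp
        then show ?thesis
        proof
          assume "in_cone (map (\<lambda>x. x + s x *s w) ys) (b + s b *s w)"
          from in_cone_map_shear[OF this s] obtain l
            where l: "l \<ge> 0" "in_cone ys (b + s b *s w - l *s w)" by blast
          have "b + s b *s w - l *s w = b - (l - s b) *s w"
            by (simp add: Finite_Cartesian_Product.vec_eq_iff algebra_simps)
          with l sb Cons show ?thesis by (auto intro!: exI[of _ "l - s b"])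
        next
          assume "\<exists>d. (\<forall>x\<in>set (map (\<lambda>x. x + s x *s w) ys). dotp d x \<ge> 0) \<and> dotp d (b + s b *s w) < 0"
          then obtain d where d: "\<forall>x\<in>set ys. dotp d (x + s x *s w) \<ge> 0" "dotp d (b + s b *s w) < 0"
            by auto
          \<comment> \<open>\<open>d'\<close> is \<open>d\<close> composed with the projection along
            \<open>w\<close>, hence zero at \<open>w\<close>.\<close>
          define d' where "d' = d - (dotp d w / dotp c w) *s c"
          have d': "dotp d' x = dotp d (x + s x *s w)" for x
            by (simp add: d'_def s_def dotp_diff_left dotp_scale_left dotp_add_right
                dotp_diff_right dotp_scale_right field_simps)
          have "s w = -1" using False by (simp add: s_def)
          then have "dotp d' w = 0" by (simp add: d' dotp_add_right dotp_scale_right)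
          with d Cons show ?thesis by (auto simp: d' intro!: exI[of _ d'])
        qed
      qed
    qed
  qed
qed

text \<open>Clears the denominators of the conic coefficients one generator at a time. This turns
  membership in the rational cone into membership of a multiple in the semigroup.\<close>

lemma in_cone_rat_multiple:
  fixes b :: "rat ^ 'n"
  assumes "in_cone xs b"
  shows "\<exists>i\<ge>1. \<exists>ms. set ms \<subseteq> set xs \<and> sum_list ms = of_nat i *s b"
  using assms
proof (induction xs arbitrary: b)
  case Nil
  then show ?case by (intro exI[of _ 1] exI[of _ "[]"] conjI) auto
next
  case (Cons x xs)
  then obtain l where l: "l \<ge> 0" "in_cone xs (b - l *s x)" by auto
  with Cons.IH obtain i ms where i: "i \<ge> 1" "set ms \<subseteq> set xs" "sum_list ms = of_nat i *s (b - l *s x)"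
    by blast
  obtain p q where pq: "l = of_int p / of_int q" "q > 0"
    by (metis quotient_of_denom_pos' quotient_of_div surj_pair snd_conv quotient_of_denom_pos)
  with l have p: "p \<ge> 0" by (simp add: zero_le_divide_iff)
  define p' q' where "p' = nat p" "q' = nat q"
  have l': "l = of_nat p' / of_nat q'" "q' \<ge> 1" using pq p by (auto simp: p'_q'_def)
  have rep: "sum_list (replicate n y) = of_nat n *s y" for n and y :: "rat ^ 'n"
    by (induction n) (auto simp: Finite_Cartesian_Product.vec_eq_iff algebra_simps)
  have rep': "sum_list (concat (replicate n ys)) = of_nat n *s sum_list ys" for n and ys :: "(rat ^ 'n) list"
    by (induction n) (auto simp: Finite_Cartesian_Product.vec_eq_iff algebra_simps)
  let ?ms = "concat (replicate q' ms) @ replicate (i * p') x"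
  have "sum_list ?ms = of_nat q' *s (of_nat i *s (b - l *s x)) + of_nat (i * p') *s x"
    by (simp add: rep rep' i)
  also have "\<dots> = of_nat (q' * i) *s b"
    using l' by (simp add: Finite_Cartesian_Product.vec_eq_iff field_simps)
  finally show ?case using i l'
    by (intro exI[of _ "q' * i"] conjI exI[of _ ?ms]) (auto split: if_splits)
qed

lemma separating_functional:
  fixes x :: "'a::field ^ 'n"
  assumes "x \<notin> vec.span S"
  shows "\<exists>c. (\<forall>s\<in>S. dotp c s = 0) \<and> dotp c x \<noteq> 0"
proof -
  obtain B where B: "B \<subseteq> S" "vec.independent B" "S \<subseteq> vec.span B"
    using vec.maximal_independent_subset by metis
  have xB: "x \<notin> vec.span B"
    using assms B(1) vec.span_mono by blast
  then have "vec.independent (insert x B)"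
    using B by (simp add: vec.independent_insertI)
  then obtain g where g: "Vector_Spaces.linear (*s) (*s) g"
    "\<forall>b\<in>insert x B. g b = (if b = x then 1 else (0 :: 'a ^ 'n))"
    using vec.linear_independent_extend[of "insert x B" "\<lambda>b. if b = x then 1 else 0"] by blast
  have dg: "dotp (matrix g $ i) v = g v $ i" for i v
    using matrix_works[OF g(1), of v] by (simp add: Finite_Cartesian_Product.vec_eq_iff matrix_vector_mult_def dotp_def)
  have "g b = 0" if "b \<in> B" for b
    using g(2) xB that vec.span_base by auto
  then have "g s = 0" if "s \<in> S" for s
    using vec.linear_eq_0_on_span[OF g(1)] B that by blast
  \<comment> \<open>\<open>g\<close> sends \<open>x\<close> to the all-ones vector, so every row of
    its matrix separates; \<open>undefined\<close> is just some row index.\<close>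
  with g(2) show ?thesis
    by (intro exI[of _ "matrix g $ undefined"]) (auto simp: dg)
qed

text \<open>Moves \<open>f\<close> within the dual cone, with its value at \<open>e\<close> fixed,
  until its zeros are as many as possible: while some element of \<Phi> lies outside the span of
  \<open>e\<close> and the zeros, a functional vanishing on these can be subtracted from
  \<open>f\<close> until a further element becomes a zero.\<close>

lemma tight_functional:
  fixes e :: "'a::linordered_field ^ 'n"
  assumes "finite \<Phi>" "\<forall>x\<in>\<Phi>. dotp f x \<ge> 0" "dotp f e \<noteq> 0"
  shows "\<exists>f'. (\<forall>x\<in>\<Phi>. dotp f' x \<ge> 0) \<and> dotp f' e = dotp f e \<and>
    \<Phi> \<subseteq> vec.span (insert e {x\<in>\<Phi>. dotp f' x = 0})"
  using assms(2,3)
proof (induction "card {x\<in>\<Phi>. dotp f x \<noteq> 0}" arbitrary: f rule: less_induct)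
  case less
  let ?Z = "{x\<in>\<Phi>. dotp f x = 0}"
  show ?case
  proof (cases "\<Phi> \<subseteq> vec.span (insert e ?Z)")
    case True
    with less show ?thesis by blast
  next
    case False
    then obtain x0 where x0: "x0 \<in> \<Phi>" "x0 \<notin> vec.span (insert e ?Z)" by blast
    from separating_functional[OF x0(2)] obtain c0
      where c0: "\<forall>s\<in>insert e ?Z. dotp c0 s = 0" "dotp c0 x0 \<noteq> 0" by blast
    define c where "c = sgn (dotp c0 x0) *s c0"
    have c: "\<forall>s\<in>insert e ?Z. dotp c s = 0" "dotp c x0 > 0"
      using c0 by (auto simp: c_def dotp_scale_left sgn_if)
    define A where "A = {x\<in>\<Phi>. dotp c x > 0}"
    have A: "finite A" "x0 \<in> A" using assms(1) x0 c by (auto simp: A_def)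
    \<comment> \<open>The largest step that keeps \<open>f - t *s c\<close> nonnegative on \<Phi>;
      an element attaining the minimum becomes the new zero.\<close>
    define t where "t = Min ((\<lambda>x. dotp f x / dotp c x) ` A)"
    have "t \<in> (\<lambda>x. dotp f x / dotp c x) ` A"
      unfolding t_def using A by (intro Min_in) auto
    then obtain v where v: "v \<in> A" "t = dotp f v / dotp c v" by blast
    have tle: "t \<le> dotp f x / dotp c x" if "x \<in> A" for x
      unfolding t_def using A that by (intro Min_le) auto
    have t0: "t \<ge> 0" using v less.prems by (auto simp: A_def)
    define f' where "f' = f - t *s c"
    have f': "dotp f' x = dotp f x - t * dotp c x" for x
      by (simp add: f'_def dotp_diff_left dotp_scale_left)
    have pos: "dotp f' x \<ge> 0" if "x \<in> \<Phi>" for x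
    proof (cases "dotp c x > 0")
      case True
      with that tle[of x] show ?thesis by (simp add: f' A_def field_simps)
    next
      case False
      then have "t * dotp c x \<le> 0" using t0 by (simp add: mult_nonneg_nonpos)
      with less.prems that show ?thesis by (simp add: f') (meson order_trans)
    qed
    have fe: "dotp f' e = dotp f e" using c by (simp add: f')
    have "v \<in> {x\<in>\<Phi>. dotp f x \<noteq> 0}" "v \<notin> {x\<in>\<Phi>. dotp f' x \<noteq> 0}"
      using v c by (auto simp: A_def f')
    moreover have "{x\<in>\<Phi>. dotp f' x \<noteq> 0} \<subseteq> {x\<in>\<Phi>. dotp f x \<noteq> 0}"
      using c by (auto simp: f')
    ultimately have "card {x\<in>\<Phi>. dotp f' x \<noteq> 0} < card {x\<in>\<Phi>. dotp f x \<noteq> 0}"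
      using assms(1) by (intro psubset_card_mono) auto
    from less.hyps[OF this] pos fe less.prems show ?thesis by auto
  qed
qed

section \<open>Types as commutative rings, and their ideals\<close>

type_synonym 'v exps = "'v \<Rightarrow>\<^sub>0 nat"

type_synonym ('v, 'k) mpoly = "('v \<Rightarrow>\<^sub>0 nat) \<Rightarrow>\<^sub>0 'k"

abbreviation single :: "'a \<Rightarrow> 'b::zero \<Rightarrow> 'a \<Rightarrow>\<^sub>0 'b"
  where "single \<equiv> Poly_Mapping.single"

abbreviation coeff :: "'a::zero poly \<Rightarrow> nat \<Rightarrow> 'a"
  where "coeff \<equiv> Polynomial.coeff"

abbreviation lookup :: "('a \<Rightarrow>\<^sub>0 'b::zero) \<Rightarrow> 'a \<Rightarrow> 'b"
  where "lookup \<equiv> Poly_Mapping.lookup"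

abbreviation keys :: "('a \<Rightarrow>\<^sub>0 'b::zero) \<Rightarrow> 'a set"
  where "keys \<equiv> Poly_Mapping.keys"

abbreviation type_ring :: "'a::comm_ring_1 ring"
  where "type_ring \<equiv> ring_of_type_algebra"

lemma type_ring_simps [simp]:
  "carrier (type_ring :: 'a::comm_ring_1 ring) = UNIV"
  "x \<otimes>\<^bsub>type_ring\<^esub> y = x * y" "x \<oplus>\<^bsub>type_ring\<^esub> y = x + y"
  "\<one>\<^bsub>type_ring\<^esub> = (1 :: 'a)" "\<zero>\<^bsub>type_ring\<^esub> = (0 :: 'a)"
  by (simp_all add: ring_of_type_algebra_def)

interpretation type_ring: cring "type_ring :: 'a::comm_ring_1 ring"
  by (rule cring_from_type_algebra)

lemma type_ring_minus [simp]: "\<ominus>\<^bsub>type_ring\<^esub> x = - (x :: 'a::comm_ring_1)"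
  by (rule type_ring.minus_equality) simp_all

lemma type_ring_pow [simp]: "x [^]\<^bsub>type_ring\<^esub> n = x ^ (n :: nat)" for x :: "'a::comm_ring_1"
  by (induction n) (simp_all add: mult.commute)

lemma type_ring_finsum [simp]: "finsum type_ring f A = sum f A" for f :: "'b \<Rightarrow> 'a::comm_ring_1"
  by (induction A rule: infinite_finite_induct) (simp_all add: type_ring.finsum_infinite)

lemma ideal_type_ringI:
  fixes I :: "'a::comm_ring_1 set"
  assumes "0 \<in> I" "\<And>a b. a \<in> I \<Longrightarrow> b \<in> I \<Longrightarrow> a + b \<in> I" "\<And>a r. a \<in> I \<Longrightarrow> r * a \<in> I"
  shows "ideal I type_ring"
proof (rule idealI)
  show "subgroup I (add_monoid type_ring)"
  proof (rule type_ring.add.subgroupI)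
    show "\<ominus>\<^bsub>type_ring\<^esub> a \<in> I" if "a \<in> I" for a
      using assms(3)[OF that, of "-1"] by simp
  qed (use assms in \<open>auto intro: assms(2)\<close>)
qed (use assms(3) in \<open>auto simp: mult.commute type_ring.ring_axioms\<close>)

lemma ideal_type_ringD:
  fixes I :: "'a::comm_ring_1 set"
  assumes "ideal I type_ring"
  shows "0 \<in> I" "a \<in> I \<Longrightarrow> b \<in> I \<Longrightarrow> a + b \<in> I" "a \<in> I \<Longrightarrow> r * a \<in> I" "a \<in> I \<Longrightarrow> a * r \<in> I"
    "a \<in> I \<Longrightarrow> - a \<in> I"
proof -
  interpret ideal I type_ring by fact
  show "0 \<in> I" "a \<in> I \<Longrightarrow> b \<in> I \<Longrightarrow> a + b \<in> I" "a \<in> I \<Longrightarrow> r * a \<in> I" "a \<in> I \<Longrightarrow> a * r \<in> I"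
    using additive_subgroup.zero_closed[OF is_additive_subgroup]
      additive_subgroup.a_closed[OF is_additive_subgroup] I_l_closed[of a r] I_r_closed[of a r] by simp_all
  show "a \<in> I \<Longrightarrow> - a \<in> I"
    using I_l_closed[of a "-1"] by simp
qed

lemma ideal_sum:
  fixes I :: "'a::comm_ring_1 set"
  assumes "ideal I type_ring" "\<And>x. x \<in> A \<Longrightarrow> f x \<in> I"
  shows "sum f A \<in> I"
  using assms(2) by (induction A rule: infinite_finite_induct) (auto intro: ideal_type_ringD[OF assms(1)])

section \<open>Polynomials with prescribed exponents\<close>

lemma poly_mapping_sum_single: "p = (\<Sum>a\<in>keys p. single a (lookup p a))"
  by (rule poly_mapping_eqI) (auto simp: lookup_sum lookup_single when_def in_keys_iff sum.delta)

lemma lookup_mult_keys: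
  fixes p q :: "'e::comm_monoid_add \<Rightarrow>\<^sub>0 'k::comm_semiring_1"
  shows "lookup (p * q) s = (\<Sum>a\<in>keys p. \<Sum>b\<in>keys q. (lookup p a * lookup q b when a + b = s))"
proof -
  have "p * q = (\<Sum>a\<in>keys p. single a (lookup p a)) * (\<Sum>b\<in>keys q. single b (lookup q b))"
    by (simp flip: poly_mapping_sum_single)
  then show ?thesis
    by (simp add: sum_product mult_single lookup_sum lookup_single)
qed

text \<open>Only one pair of terms contributes to this coefficient, so nothing can cancel. Together
  with suitably chosen extremal exponents this does the work of leading terms.\<close>

lemma lookup_mult_unique:
  fixes p q :: "'e::comm_monoid_add \<Rightarrow>\<^sub>0 'k::comm_semiring_1"
  assumes "\<And>a b. a \<in> keys p \<Longrightarrow> b \<in> keys q \<Longrightarrow> a + b = \<alpha> + \<beta> \<Longrightarrow> a = \<alpha> \<and> b = \<beta>"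
  shows "lookup (p * q) (\<alpha> + \<beta>) = lookup p \<alpha> * lookup q \<beta>"
proof -
  have *: "a + b = \<alpha> + \<beta> \<longleftrightarrow> a = \<alpha> \<and> b = \<beta>" if "a \<in> keys p" "b \<in> keys q" for a b
    using assms[OF that] by auto
  have "lookup (p * q) (\<alpha> + \<beta>) = (\<Sum>a\<in>keys p. \<Sum>b\<in>keys q. (lookup p a * lookup q b when (a = \<alpha> \<and> b = \<beta>)))"
    unfolding lookup_mult_keys using * by (intro sum.cong refl) (auto simp: when_def)
  also have "\<dots> = (\<Sum>a\<in>keys p. if a = \<alpha> then \<Sum>b\<in>keys q. (if b = \<beta> then lookup p \<alpha> * lookup q \<beta> else 0) else 0)"
    by (intro sum.cong refl) (auto simp: when_def intro!: sum.neutral sum.cong)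
  also have "\<dots> = lookup p \<alpha> * lookup q \<beta>"
    by (auto simp: sum.delta in_keys_iff)
  finally show ?thesis .
qed

lemma keys_mult_mem:
  assumes "c \<in> keys (p * q)"
  obtains a b where "a \<in> keys p" "b \<in> keys q" "c = a + b"
  using assms keys_mult by blast

text \<open>Squared Euclidean length. Its strict convexity singles out extremal exponents, in place
  of a monomial order.\<close>

definition exponent_norm :: "('v::finite) exps \<Rightarrow> nat"
  where "exponent_norm a = (\<Sum>v\<in>UNIV. lookup a v ^ 2)"

text \<open>A pair of exponents whose sum has maximal norm works, by the parallelogram identity.\<close>

lemma unique_sum_exponents:
  fixes A B :: "('v::finite) exps set"
  assumes "finite A" "finite B" "A \<noteq> {}" "B \<noteq> {}"
  obtains \<alpha> \<beta> where "\<alpha> \<in> A" "\<beta> \<in> B"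
    "\<And>a b. a \<in> A \<Longrightarrow> b \<in> B \<Longrightarrow> a + b = \<alpha> + \<beta> \<Longrightarrow> a = \<alpha> \<and> b = \<beta>"
proof -
  define M where "M = Max ((\<lambda>(a,b). exponent_norm (a + b)) ` (A \<times> B))"
  have "M \<in> (\<lambda>(a,b). exponent_norm (a + b)) ` (A \<times> B)"
    unfolding M_def using assms by (intro Max_in) auto
  then obtain \<alpha> \<beta> where ab: "\<alpha> \<in> A" "\<beta> \<in> B" "exponent_norm (\<alpha> + \<beta>) = M" by auto
  have le: "exponent_norm (a + b) \<le> M" if "a \<in> A" "b \<in> B" for a b
    unfolding M_def using assms that by (intro Max_ge) auto
  have "a = \<alpha> \<and> b = \<beta>" if "a \<in> A" "b \<in> B" "a + b = \<alpha> + \<beta>" for a b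
  proof -
    have s: "lookup a v + lookup b v = lookup \<alpha> v + lookup \<beta> v" for v
      using that(3) by (metis lookup_add)
    define \<delta> where "\<delta> v = int (lookup \<alpha> v) - int (lookup a v)" for v
    have "int (exponent_norm (\<alpha> + b)) + int (exponent_norm (a + \<beta>)) =
      (\<Sum>v\<in>UNIV. (int (lookup \<alpha> v) + int (lookup b v))\<^sup>2 + (int (lookup a v) + int (lookup \<beta> v))\<^sup>2)"
      by (simp add: exponent_norm_def lookup_add sum.distrib)
    also have "\<dots> = (\<Sum>v\<in>UNIV. 2 * (int (lookup \<alpha> v) + int (lookup \<beta> v))\<^sup>2 + 2 * (\<delta> v)\<^sup>2)"
    proof (intro sum.cong refl)
      fix v
      have b: "int (lookup b v) = int (lookup \<alpha> v) + int (lookup \<beta> v) - int (lookup a v)"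
        using s[of v] by linarith
      show "(int (lookup \<alpha> v) + int (lookup b v))\<^sup>2 + (int (lookup a v) + int (lookup \<beta> v))\<^sup>2 =
        2 * (int (lookup \<alpha> v) + int (lookup \<beta> v))\<^sup>2 + 2 * (\<delta> v)\<^sup>2"
        unfolding b \<delta>_def by (simp add: power2_eq_square algebra_simps)
    qed
    also have "\<dots> = 2 * int M + 2 * (\<Sum>v\<in>UNIV. (\<delta> v)\<^sup>2)"
      by (simp add: ab(3)[symmetric] exponent_norm_def lookup_add sum.distrib sum_distrib_left)
    finally have "(\<Sum>v\<in>UNIV. (\<delta> v)\<^sup>2) \<le> 0"
      using le[OF ab(1) that(2)] le[OF that(1) ab(2)] by linarith
    then have "\<delta> v = 0" for v
      using sum_nonneg_eq_0_iff[of UNIV "\<lambda>v. (\<delta> v)\<^sup>2"] sum_nonneg[of UNIV "\<lambda>v. (\<delta> v)\<^sup>2"]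
      by (auto simp: order_antisym)
    then have "a = \<alpha>"
      by (intro poly_mapping_eqI) (simp add: \<delta>_def)
    with that(3) show ?thesis by auto
  qed
  with ab that show ?thesis by blast
qed

text \<open>For up-closed \<open>A\<close> these are exactly the monomial ideals, so that ideal
  arithmetic becomes arithmetic of exponent sets.\<close>

definition poly_supp :: "'e set \<Rightarrow> ('e \<Rightarrow>\<^sub>0 'k::zero) set"
  where "poly_supp A = {p. keys p \<subseteq> A}"

lemma single_mem_poly_supp [simp]: "single a c \<in> poly_supp A \<longleftrightarrow> a \<in> A \<or> c = 0"
  by (auto simp: poly_supp_def)

lemma zero_mem_poly_supp [simp]: "0 \<in> poly_supp A"
  by (simp add: poly_supp_def)

lemma poly_supp_eq_iff: "(poly_supp A :: ('e \<Rightarrow>\<^sub>0 'k::zero_neq_one) set) = poly_supp B \<longleftrightarrow> A = B"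
proof
  assume *: "(poly_supp A :: ('e \<Rightarrow>\<^sub>0 'k) set) = poly_supp B"
  have "a \<in> A \<longleftrightarrow> a \<in> B" for a
  proof -
    have "single a (1::'k) \<in> poly_supp A \<longleftrightarrow> a \<in> A" "single a (1::'k) \<in> poly_supp B \<longleftrightarrow> a \<in> B"
      by simp_all
    with * show ?thesis by simp
  qed
  then show "A = B" by blast
qed simp

definition up_closed :: "'e::monoid_add set \<Rightarrow> bool"
  where "up_closed A \<longleftrightarrow> (\<forall>a\<in>A. \<forall>c. a + c \<in> A)"

lemma up_closedD: "up_closed A \<Longrightarrow> a \<in> A \<Longrightarrow> a + c \<in> A"
  by (simp add: up_closed_def)

lemma up_closed_sumset:
  fixes A :: "'e::comm_monoid_add set"
  assumes "up_closed A"
  shows "up_closed {a + b |a b. a \<in> A \<and> b \<in> B}"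
  unfolding up_closed_def
proof safe
  fix a b c assume "a \<in> A" "b \<in> B"
  with assms have "a + b + c = (a + c) + b" "a + c \<in> A" by (simp_all add: up_closed_def add_ac)
  with \<open>b \<in> B\<close> show "\<exists>a' b'. a + b + c = a' + b' \<and> a' \<in> A \<and> b' \<in> B" by blast
qed

lemma ideal_poly_supp:
  fixes A :: "'e::comm_monoid_add set"
  assumes "up_closed A"
  shows "ideal (poly_supp A :: ('e \<Rightarrow>\<^sub>0 'k::comm_ring_1) set) type_ring"
proof (rule ideal_type_ringI)
  fix p q :: "'e \<Rightarrow>\<^sub>0 'k"
  assume "p \<in> poly_supp A" "q \<in> poly_supp A"
  then show "p + q \<in> poly_supp A" using keys_add[of p q] by (auto simp: poly_supp_def)
next
  fix p q :: "'e \<Rightarrow>\<^sub>0 'k"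
  assume p: "p \<in> poly_supp A"
  have "c \<in> A" if c: "c \<in> keys (q * p)" for c
  proof -
    obtain a b where ab: "a \<in> keys q" "b \<in> keys p" "c = a + b"
      using keys_mult_mem[OF c] by metis
    have "b \<in> A" using ab(2) p by (auto simp: poly_supp_def)
    then have "b + a \<in> A" using assms by (simp add: up_closed_def)
    then show ?thesis by (simp add: ab(3) add.commute)
  qed
  then show "q * p \<in> poly_supp A" by (auto simp: poly_supp_def)
qed simp

lemma poly_mem_idealI:
  fixes I :: "('e::comm_monoid_add \<Rightarrow>\<^sub>0 'k::comm_ring_1) set"
  assumes "ideal I type_ring" "\<And>a. a \<in> keys p \<Longrightarrow> single a 1 \<in> I"
  shows "p \<in> I"
proof -
  have "single a (lookup p a) \<in> I" if "a \<in> keys p" for a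
    using ideal_type_ringD(3)[OF assms(1) assms(2)[OF that], of "single 0 (lookup p a)"]
    by (simp add: mult_single)
  then have "(\<Sum>a\<in>keys p. single a (lookup p a)) \<in> I"
    by (intro ideal_sum[OF assms(1)])
  then show ?thesis by (simp flip: poly_mapping_sum_single)
qed

lemma genideal_monomials:
  fixes T :: "('v::finite) exps set"
  shows "genideal mpoly_ring (monomial ` T) = (poly_supp {t + c |t c. t \<in> T} :: ('v, 'k::field) mpoly set)"
    (is "?L = poly_supp ?U")
proof
  have "ideal (poly_supp ?U :: ('v, 'k) mpoly set) type_ring"
    by (rule ideal_poly_supp) (force simp: up_closed_def add.assoc)
  moreover have "t \<in> ?U" if "t \<in> T" for t
    by (rule CollectI, rule exI[of _ t], rule exI[of _ 0]) (use that in simp)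
  ultimately show "?L \<subseteq> poly_supp ?U"
    by (intro type_ring.genideal_minimal) (auto simp: monomial_def)
next
  have id: "ideal ?L type_ring" by (rule type_ring.genideal_ideal) simp
  show "poly_supp ?U \<subseteq> ?L"
  proof
    fix p :: "('v, 'k) mpoly" assume p: "p \<in> poly_supp ?U"
    show "p \<in> ?L"
    proof (rule poly_mem_idealI[OF id])
      fix a assume "a \<in> keys p"
      with p obtain t c where t: "t \<in> T" "a = t + c" by (auto simp: poly_supp_def)
      have "monomial t \<in> ?L" using t type_ring.genideal_self[of "monomial ` T"] by auto
      then have "monomial t * single c 1 \<in> ?L" by (rule ideal_type_ringD[OF id])
      then show "single a 1 \<in> ?L" by (simp add: t monomial_def mult_single)
    qed
  qed
qed

lemma ideal_prod_poly_supp: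
  fixes A B :: "('v::finite) exps set"
  assumes A: "up_closed A" and B: "up_closed B"
  shows "ideal_prod type_ring (poly_supp A :: ('v, 'k::field) mpoly set) (poly_supp B) =
    poly_supp {a + b |a b. a \<in> A \<and> b \<in> B}" (is "?L = poly_supp ?U")
proof
  have U: "up_closed ?U" by (rule up_closed_sumset) fact
  then have iU: "ideal (poly_supp ?U :: ('v, 'k) mpoly set) type_ring" by (rule ideal_poly_supp)
  show "?L \<subseteq> poly_supp ?U"
  proof
    fix p assume "p \<in> ?L"
    then show "p \<in> poly_supp ?U"
    proof induction
      case (prod i j)
      then show ?case using keys_mult[of i j] by (fastforce simp: poly_supp_def)
    next
      case (sum s1 s2)
      then show ?case using ideal_type_ringD(2)[OF iU] by simp
    qed
  qed
next
  have id: "ideal ?L type_ring"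
    by (rule type_ring.ideal_prod_is_ideal; rule ideal_poly_supp; fact)
  show "poly_supp ?U \<subseteq> ?L"
  proof
    fix p :: "('v, 'k) mpoly" assume p: "p \<in> poly_supp ?U"
    show "p \<in> ?L"
    proof (rule poly_mem_idealI[OF id])
      fix c assume "c \<in> keys p"
      with p obtain a b where ab: "a \<in> A" "b \<in> B" "c = a + b" by (auto simp: poly_supp_def)
      have "single a 1 \<otimes>\<^bsub>type_ring\<^esub> single b 1 \<in> ?L"
        using ab by (intro ideal_prod.prod) auto
      then show "single c 1 \<in> ?L" by (simp add: ab mult_single)
    qed
  qed
qed

text \<open>The zeroth power is \<open>UNIV\<close> and not the singleton of 0, in accordance with
  the zeroth power of an ideal being the whole ring.\<close>

fun sumset_pow :: "'e::monoid_add set \<Rightarrow> nat \<Rightarrow> 'e set" where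
  "sumset_pow E 0 = UNIV"
| "sumset_pow E (Suc n) = {a + b |a b. a \<in> sumset_pow E n \<and> b \<in> E}"

lemma up_closed_sumset_pow: "up_closed E \<Longrightarrow> up_closed (sumset_pow E n)" for E :: "'e::comm_monoid_add set"
  by (induction n) (simp_all add: up_closed_sumset, simp add: up_closed_def)

lemma ideal_pow_poly_supp:
  fixes E :: "('v::finite) exps set"
  assumes "up_closed E"
  shows "ideal_pow type_ring (poly_supp E :: ('v, 'k::field) mpoly set) n = poly_supp (sumset_pow E n)"
proof (induction n)
  case 0
  show ?case by (auto simp: ideal_pow_def ideals_set_def poly_supp_def)
next
  case (Suc n)
  interpret M: comm_monoid "ideals_set (type_ring :: ('v, 'k) mpoly ring)"
    by (rule type_ring.ideals_set_is_comm_monoid)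
  show ?case using Suc
    by (simp add: ideal_pow_def ideals_set_def up_closed_sumset_pow[OF assms] ideal_prod_poly_supp assms)
qed

lemma irrelevant_ideal_eq: "(irrelevant_ideal :: ('v::finite, 'k::field) mpoly set) = poly_supp (- {0})"
proof -
  have "a \<in> {t + c |t c. t \<in> range (\<lambda>v. single v (1::nat))} \<longleftrightarrow> a \<noteq> 0" for a :: "'v exps"
  proof
    assume "a \<noteq> 0"
    then obtain v where v: "lookup a v \<noteq> 0" by (metis lookup_zero poly_mapping_eqI)
    have "a = single v 1 + (a - single v 1)"
      using v by (intro poly_mapping_eqI) (auto simp: lookup_add lookup_minus lookup_single when_def)
    then show "a \<in> {t + c |t c. t \<in> range (\<lambda>v. single v (1::nat))}" by blast
  next
    assume "a \<in> {t + c |t c. t \<in> range (\<lambda>v. single v (1::nat))}"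
    then obtain v c where "a = single v 1 + c" by auto
    then have "lookup a v \<noteq> 0" by (simp add: lookup_add)
    then show "a \<noteq> 0" by auto
  qed
  then have "{t + c |t c. t \<in> range (\<lambda>v. single v (1::nat))} = - {0 :: 'v exps}"
    by (auto simp only: Compl_iff singleton_iff)
  moreover have "range (\<lambda>v. monomial (single v 1)) = (monomial :: _ \<Rightarrow> ('v, 'k) mpoly) ` range (\<lambda>v. single v 1)"
    by (simp add: image_image)
  ultimately show ?thesis
    by (simp only: irrelevant_ideal_def genideal_monomials)
qed

section \<open>Associated primes of monomial ideals\<close>

lemma mem_coset_type_ring: "y \<in> J +>\<^bsub>type_ring\<^esub> x \<longleftrightarrow> (\<exists>j\<in>J. y = j + x)" for x :: "'a::comm_ring_1"
  by (auto simp: a_r_coset_def r_coset_def)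

lemma coset_eq_iff_type_ring:
  fixes x y :: "'a::comm_ring_1"
  assumes "ideal J type_ring"
  shows "J +>\<^bsub>type_ring\<^esub> x = J +>\<^bsub>type_ring\<^esub> y \<longleftrightarrow> x - y \<in> J"
proof
  note J = ideal_type_ringD[OF assms]
  assume eq: "J +>\<^bsub>type_ring\<^esub> x = J +>\<^bsub>type_ring\<^esub> y"
  have "x \<in> J +>\<^bsub>type_ring\<^esub> x" using J(1) by (auto simp: mem_coset_type_ring intro: bexI[of _ 0])
  then obtain j where "j \<in> J" "x = j + y" unfolding eq mem_coset_type_ring by blast
  then show "x - y \<in> J" by simp
next
  note J = ideal_type_ringD[OF assms]
  assume d: "x - y \<in> J"
  show "J +>\<^bsub>type_ring\<^esub> x = J +>\<^bsub>type_ring\<^esub> y"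
  proof (intro Set.set_eqI iffI)
    fix z assume "z \<in> J +>\<^bsub>type_ring\<^esub> x"
    then obtain j where j: "j \<in> J" "z = j + x" unfolding mem_coset_type_ring by blast
    with J(2)[OF j(1) d] show "z \<in> J +>\<^bsub>type_ring\<^esub> y"
      unfolding mem_coset_type_ring by (intro bexI[of _ "j + (x - y)"]) auto
  next
    fix z assume "z \<in> J +>\<^bsub>type_ring\<^esub> y"
    then obtain j where j: "j \<in> J" "z = j + y" unfolding mem_coset_type_ring by blast
    with J(2)[OF j(1) J(5)[OF d]] show "z \<in> J +>\<^bsub>type_ring\<^esub> x"
      unfolding mem_coset_type_ring by (intro bexI[of _ "j + (y - x)"]) auto
  qed
qed

lemma coset_zero_type_ring [simp]: "J +>\<^bsub>type_ring\<^esub> (0 :: 'a::comm_ring_1) = J"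
  by (auto simp: mem_coset_type_ring)

lemma associated_primes_type_ring:
  fixes J :: "'a::comm_ring_1 set"
  assumes "ideal J type_ring"
  shows "associated_primes type_ring (quotient_module type_ring J) =
    {P. primeideal P type_ring \<and> (\<exists>f. P = {a. a * f \<in> J})}"
proof -
  have smult: "a \<odot>\<^bsub>quotient_module type_ring J\<^esub> (J +>\<^bsub>type_ring\<^esub> f) = J +>\<^bsub>type_ring\<^esub> (a * f)" for a f
    using ideal.rcoset_mult_add[OF assms, of a f] by (simp add: quotient_module_def FactRing_def)
  have eq: "{a \<in> carrier type_ring. a \<odot>\<^bsub>quotient_module type_ring J\<^esub> (J +>\<^bsub>type_ring\<^esub> f) =
      \<zero>\<^bsub>quotient_module type_ring J\<^esub>} = {a. a * f \<in> J}" for f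
    unfolding smult using coset_eq_iff_type_ring[OF assms, of _ 0]
    by (simp add: quotient_module_def FactRing_def)
  have carr: "carrier (quotient_module type_ring J) = range (\<lambda>f. J +>\<^bsub>type_ring\<^esub> f)"
    by (auto simp: quotient_module_def FactRing_def A_RCOSETS_def')
  show ?thesis
    unfolding associated_primes_def carr using eq by auto
qed

definition var_ideal :: "'v set \<Rightarrow> ('v::finite, 'k::field) mpoly set"
  where "var_ideal F = poly_supp {\<gamma>. \<exists>v\<in>F. lookup \<gamma> v \<noteq> 0}"

definition corner :: "('v::finite) exps set \<Rightarrow> 'v set \<Rightarrow> 'v exps \<Rightarrow> bool"
  where "corner C F \<beta> \<longleftrightarrow> (\<forall>v\<in>F. \<beta> + single v 1 \<in> C) \<and>
    (\<forall>\<gamma>. (\<forall>v\<in>F. lookup \<gamma> v = 0) \<longrightarrow> \<beta> + \<gamma> \<notin> C)"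

lemma lookup_single_mult:
  fixes f :: "('v::finite, 'k::field) mpoly"
  shows "lookup (single a c * f) (a + b) = c * lookup f b"
  by (subst lookup_mult_unique) (auto split: if_splits)

lemma keys_single_mult:
  fixes f :: "('v::finite, 'k::field) mpoly"
  assumes "c \<noteq> 0"
  shows "keys (single a c * f) = (+) a ` keys f"
proof -
  have "keys (single a c * f) \<subseteq> (+) a ` keys f"
    using keys_mult[of "single a c" f] assms by auto
  moreover have "a + b \<in> keys (single a c * f)" if "b \<in> keys f" for b
    using that assms by (simp add: in_keys_iff lookup_single_mult)
  ultimately show ?thesis by blast
qed

text \<open>A monomial moves \<beta> into \<open>C\<close> exactly when it involves a variable of
  \<open>F\<close>. This is how a corner realises a given prime as associated.\<close>

lemma annihilator_of_corner:
  fixes C :: "('v::finite) exps set"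
  assumes C: "up_closed C" and \<beta>: "corner C F \<beta>"
  shows "{a. a * single \<beta> 1 \<in> poly_supp C} = (var_ideal F :: ('v, 'k::field) mpoly set)"
proof -
  have "\<beta> + \<gamma> \<in> C \<longleftrightarrow> (\<exists>v\<in>F. lookup \<gamma> v \<noteq> 0)" for \<gamma>
  proof
    assume "\<exists>v\<in>F. lookup \<gamma> v \<noteq> 0"
    then obtain v where v: "v \<in> F" "lookup \<gamma> v \<noteq> 0" by blast
    then have "\<gamma> = single v 1 + (\<gamma> - single v 1)"
      by (intro poly_mapping_eqI) (auto simp: lookup_add lookup_minus lookup_single when_def)
    moreover have "\<beta> + single v 1 + (\<gamma> - single v 1) \<in> C"
      using C \<beta> v by (simp add: corner_def up_closed_def)
    ultimately show "\<beta> + \<gamma> \<in> C" by (simp add: add.assoc)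
  qed (use \<beta> in \<open>auto simp: corner_def\<close>)
  then show ?thesis
    by (auto simp: mult.commute[of _ "single \<beta> 1"] poly_supp_def keys_single_mult var_ideal_def)
qed

lemma monomial_in_prime:
  fixes P :: "('v::finite, 'k::field) mpoly set"
  assumes "primeideal P type_ring" "single \<gamma> 1 \<in> P"
  shows "\<exists>v. lookup \<gamma> v \<noteq> 0 \<and> single (single v 1) 1 \<in> P"
  using assms(2)
proof (induction "\<Sum>v\<in>UNIV. lookup \<gamma> v" arbitrary: \<gamma> rule: less_induct)
  case less
  interpret primeideal P type_ring by fact
  have "1 \<notin> P" using one_imp_carrier I_notcarr by auto
  with less.prems have "\<gamma> \<noteq> 0" by (auto simp: single_one)
  then obtain v where v: "lookup \<gamma> v \<noteq> 0" by (metis lookup_zero poly_mapping_eqI)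
  define \<gamma>' where "\<gamma>' = \<gamma> - single v 1"
  have \<gamma>: "\<gamma> = single v 1 + \<gamma>'"
    using v by (intro poly_mapping_eqI) (auto simp: \<gamma>'_def lookup_add lookup_minus lookup_single when_def)
  have "single (single v 1) 1 * single \<gamma>' 1 \<in> P"
    using less.prems by (simp add: mult_single \<gamma>)
  then consider "single (single v 1) 1 \<in> P" | "single \<gamma>' 1 \<in> P"
    using I_prime by (metis UNIV_I type_ring_simps(1,2))
  then show ?case
  proof cases
    case 2
    have "(\<Sum>u\<in>UNIV. lookup \<gamma>' u) < (\<Sum>u\<in>UNIV. lookup \<gamma> u)"
      by (simp add: \<gamma> lookup_add sum.distrib lookup_single when_def)
    from less.hyps[OF this 2] show ?thesis by (auto simp: \<gamma> lookup_add)
  qed (use v in blast)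
qed

text \<open>\<open>F\<close> consists of the variables in \<open>P\<close>. The corner is a term of
  an \<open>f\<close> with annihilator \<open>P\<close>. If some element of \<open>P\<close> had
  terms free of the variables in \<open>F\<close>, a product without cancellation would allow
  \<open>f\<close> to be replaced by a multiple with fewer terms outside \<open>C\<close>.\<close>

lemma associated_prime_monomial:
  fixes C :: "('v::finite) exps set" and P :: "('v, 'k::field) mpoly set"
  assumes C: "up_closed C" and P: "primeideal P type_ring" and Pf: "\<exists>f. P = {a. a * f \<in> poly_supp C}"
  shows "\<exists>F \<beta>. corner C F \<beta> \<and> P = var_ideal F"
proof -
  interpret P: primeideal P type_ring by fact
  have idP: "ideal P type_ring" ..
  note Pi = ideal_type_ringD[OF idP]
  have idJ: "ideal (poly_supp C :: ('v, 'k) mpoly set) type_ring" by (rule ideal_poly_supp) fact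
  have prime: "p \<in> P \<or> q \<in> P" if "p * q \<in> P" for p q
    using P.I_prime[of p q] that by simp
  have "1 \<notin> P" using P.one_imp_carrier P.I_notcarr by auto
  from Pf obtain f where f: "P = {a. a * f \<in> poly_supp C}"
    and fmin: "\<And>f'. P = {a. a * f' \<in> poly_supp C} \<Longrightarrow> card (keys f - C) \<le> card (keys f' - C)"
    using ex_has_least_nat[of "\<lambda>f. P = {a. a * f \<in> poly_supp C}" _ "\<lambda>f. card (keys f - C)"] by blast
  define K where "K = keys f - C"
  define x where "x v = (single (single v 1) 1 :: ('v, 'k) mpoly)" for v :: 'v
  define F where "F = {v. x v \<in> P}"
  have finK: "finite K" by (simp add: K_def)
  have mono: "single \<gamma> 1 \<in> P \<longleftrightarrow> (\<forall>\<beta>\<in>K. \<gamma> + \<beta> \<in> C)" for \<gamma>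
  proof -
    have "single \<gamma> 1 \<in> P \<longleftrightarrow> (\<forall>\<beta>\<in>keys f. \<gamma> + \<beta> \<in> C)"
      by (auto simp: f poly_supp_def keys_single_mult)
    also have "\<dots> \<longleftrightarrow> (\<forall>\<beta>\<in>K. \<gamma> + \<beta> \<in> C)"
      using C by (auto simp: K_def up_closed_def add.commute)
    finally show ?thesis .
  qed
  have offF: "single \<gamma> 1 \<notin> P" if "\<forall>v\<in>F. lookup \<gamma> v = 0" for \<gamma>
    using monomial_in_prime[OF P, of \<gamma>] that by (auto simp: F_def x_def)
  \<comment> \<open>Otherwise the product of all the offending monomials, which involves no variable
    of \<open>F\<close>, would move all of \<open>K\<close> into \<open>C\<close> and so lie in
    \<open>P\<close>.\<close>
  obtain \<beta> where \<beta>: "\<beta> \<in> K" "\<And>\<gamma>. \<forall>v\<in>F. lookup \<gamma> v = 0 \<Longrightarrow> \<beta> + \<gamma> \<notin> C"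
  proof (rule ccontr)
    assume "\<not> thesis"
    with that have "\<forall>\<beta>\<in>K. \<exists>\<gamma>. (\<forall>v\<in>F. lookup \<gamma> v = 0) \<and> \<beta> + \<gamma> \<in> C" by blast
    then obtain g where g: "\<And>\<beta>. \<beta> \<in> K \<Longrightarrow> (\<forall>v\<in>F. lookup (g \<beta>) v = 0) \<and> \<beta> + g \<beta> \<in> C" by metis
    have "sum g K + \<beta> \<in> C" if b: "\<beta> \<in> K" for \<beta>
    proof -
      have "sum g K + \<beta> = (\<beta> + g \<beta>) + sum g (K - {\<beta>})"
        using finK b by (simp add: sum.remove add_ac)
      then show ?thesis using C g[OF b] by (simp add: up_closed_def)
    qed
    then have "single (sum g K) 1 \<in> P" by (simp add: mono)
    moreover have "\<forall>v\<in>F. lookup (sum g K) v = 0" using g by (simp add: lookup_sum)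
    ultimately show False using offF by blast
  qed
  have corner: "corner C F \<beta>"
    using \<beta> mono[of "single _ 1"]
    by (auto simp: corner_def F_def x_def add.commute)
  have sub: "var_ideal F \<subseteq> P"
  proof
    fix p assume p: "p \<in> (var_ideal F :: ('v, 'k) mpoly set)"
    show "p \<in> P"
    proof (rule poly_mem_idealI[OF idP])
      fix \<gamma> assume "\<gamma> \<in> keys p"
      with p obtain v where v: "v \<in> F" "lookup \<gamma> v \<noteq> 0" by (auto simp: var_ideal_def poly_supp_def)
      have "single (\<gamma> - single v 1) 1 * x v \<in> P"
        using v Pi(3) by (auto simp: F_def)
      moreover have "\<gamma> - single v 1 + single v 1 = \<gamma>"
        using v by (intro poly_mapping_eqI) (auto simp: lookup_add lookup_minus lookup_single when_def)
      ultimately show "single \<gamma> 1 \<in> P" by (simp add: x_def mult_single)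
    qed
  qed
  have "P \<subseteq> var_ideal F"
  proof
    fix g assume g: "g \<in> P"
    define A where "A = {\<gamma>\<in>keys g. \<forall>v\<in>F. lookup \<gamma> v = 0}"
    \<comment> \<open>The terms of \<open>g\<close> that involve no variable of \<open>F\<close>.
      The others lie in \<open>P\<close>, so \<open>g'\<close> does too, and it has to be shown that
      there are none.\<close>
    define g' where "g' = (\<Sum>a\<in>A. single a (lookup g a))"
    have finA: "finite A" by (simp add: A_def)
    have lg': "lookup g' a = (if a \<in> A then lookup g a else 0)" for a
      using finA by (simp add: g'_def lookup_sum lookup_single when_def sum.delta)
    have "lookup g a \<noteq> 0" if "a \<in> A" for a using that by (simp add: A_def in_keys_iff)
    then have kg': "keys g' = A" by (auto simp: in_keys_iff lg' split: if_splits)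
    have "g - g' \<in> var_ideal F"
      by (auto simp: var_ideal_def poly_supp_def in_keys_iff lookup_minus lg' A_def split: if_splits)
    then have "g - (g - g') \<in> P" using sub g Pi(2)[OF g Pi(5)] by fastforce
    then have g'P: "g' \<in> P" by simp
    have "A = {}"
    proof (rule ccontr)
      assume "A \<noteq> {}"
      from unique_sum_exponents[OF finA finK this] \<beta>(1) obtain \<alpha> \<beta>'
        where ab: "\<alpha> \<in> A" "\<beta>' \<in> K"
          "\<And>a b. a \<in> A \<Longrightarrow> b \<in> K \<Longrightarrow> a + b = \<alpha> + \<beta>' \<Longrightarrow> a = \<alpha> \<and> b = \<beta>'" by blast
      have abC: "\<alpha> + \<beta>' \<in> C"
      proof (rule ccontr)
        assume nC: "\<alpha> + \<beta>' \<notin> C"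
        have "lookup (g' * f) (\<alpha> + \<beta>') = lookup g' \<alpha> * lookup f \<beta>'"
        proof (rule lookup_mult_unique)
          fix a b assume a: "a \<in> keys g'" and b: "b \<in> keys f" and eq: "a + b = \<alpha> + \<beta>'"
          have "b \<notin> C" using nC C eq by (metis add.commute up_closed_def)
          with a b eq show "a = \<alpha> \<and> b = \<beta>'" by (intro ab) (auto simp: kg' K_def)
        qed
        also have "\<dots> \<noteq> 0" using ab by (auto simp: lg' A_def K_def in_keys_iff)
        finally have "\<alpha> + \<beta>' \<in> keys (g' * f)" by (simp add: in_keys_iff)
        with g'P nC show False by (auto simp: f poly_supp_def)
      qed
      \<comment> \<open>The annihilator stays \<open>P\<close> because the monomial of \<alpha> is
        outside the prime \<open>P\<close>, whereas the term \<beta>' has moved into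
        \<open>C\<close>; this contradicts the minimality of \<open>f\<close>.\<close>
      define f' where "f' = single \<alpha> 1 * f"
      have \<alpha>P: "single \<alpha> 1 \<notin> P" using ab by (intro offF) (simp add: A_def)
      have "a * f' \<in> poly_supp C \<longleftrightarrow> a \<in> P" for a
      proof -
        have "a * f' \<in> poly_supp C \<longleftrightarrow> a * single \<alpha> 1 \<in> P"
          by (simp add: f f'_def mult.assoc)
        also have "\<dots> \<longleftrightarrow> a \<in> P" using \<alpha>P prime Pi(4) by blast
        finally show ?thesis .
      qed
      then have "card (keys f - C) \<le> card (keys f' - C)" by (intro fmin) auto
      moreover have "keys f' - C \<subseteq> (+) \<alpha> ` (K - {\<beta>'})"
      proof
        fix c assume c: "c \<in> keys f' - C"
        then obtain b where b: "b \<in> keys f" "c = \<alpha> + b" by (auto simp: f'_def keys_single_mult)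
        have "b \<notin> C" using c b C by (metis DiffD2 add.commute up_closed_def)
        with b c abC show "c \<in> (+) \<alpha> ` (K - {\<beta>'})" by (auto simp: K_def)
      qed
      then have "card (keys f' - C) \<le> card (K - {\<beta>'})"
        using finK by (meson card_image_le card_mono finite_Diff finite_imageI le_trans)
      moreover have "card (K - {\<beta>'}) < card K" using ab finK by (meson card_Diff1_less)
      ultimately show False by (simp add: K_def)
    qed
    then show "g \<in> var_ideal F" by (auto simp: A_def var_ideal_def poly_supp_def)
  qed
  with sub corner show ?thesis by blast
qed

section \<open>The cone of a monomial ideal\<close>

definition exp_mult :: "nat \<Rightarrow> 'v exps \<Rightarrow> 'v exps"
  where "exp_mult i a = Poly_Mapping.map ((*) i) a"

lemma lookup_exp_mult [simp]: "lookup (exp_mult i a) v = i * lookup a v"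
  by (simp add: exp_mult_def Poly_Mapping.map.rep_eq when_def)

lemma exp_mult_1 [simp]: "exp_mult 1 a = a"
  by (rule poly_mapping_eqI) simp

lemma exp_mult_Suc: "exp_mult (Suc i) a = a + exp_mult i a"
  by (rule poly_mapping_eqI) (simp add: lookup_add)

lemma exp_mult_0 [simp]: "exp_mult 0 a = 0"
  by (rule poly_mapping_eqI) simp

definition power_saturation :: "'v exps set \<Rightarrow> nat \<Rightarrow> 'v exps set"
  where "power_saturation E n = {a. \<exists>i\<ge>1. exp_mult i a \<in> sumset_pow E (n * i)}"

lemma up_closed_power_saturation:
  assumes "up_closed E"
  shows "up_closed (power_saturation E n)"
  unfolding up_closed_def
proof safe
  fix a c assume "a \<in> power_saturation E n"
  then obtain i where i: "i \<ge> 1" "exp_mult i a \<in> sumset_pow E (n * i)"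
    by (auto simp: power_saturation_def)
  have "exp_mult i (a + c) = exp_mult i a + exp_mult i c"
    by (rule poly_mapping_eqI) (simp add: lookup_add algebra_simps)
  then have "exp_mult i (a + c) \<in> sumset_pow E (n * i)"
    using i up_closed_sumset_pow[OF assms] by (simp add: up_closed_def)
  with i show "a + c \<in> power_saturation E n" by (auto simp: power_saturation_def)
qed

definition up_hull :: "'v exps set \<Rightarrow> 'v exps set"
  where "up_hull G = {g + c |g c. g \<in> G}"

lemma up_closed_up_hull: "up_closed (up_hull G)"
  unfolding up_closed_def up_hull_def by (auto simp: add.assoc) (metis add.assoc)

lemma up_hull_superset: "g \<in> G \<Longrightarrow> g \<in> up_hull G"
  unfolding up_hull_def by (rule CollectI, rule exI[of _ g], rule exI[of _ 0]) simp

text \<open>The point of the cone over the Newton polyhedron that represents the exponent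
  \<open>a\<close> in the \<open>n\<close>-th power; \<open>None\<close> is the height.\<close>

definition evec :: "('v::finite) exps \<Rightarrow> nat \<Rightarrow> rat ^ 'v option"
  where "evec a n = (\<chi> i. case i of None \<Rightarrow> of_nat n | Some v \<Rightarrow> of_nat (lookup a v))"

text \<open>The exponents of the monomial generators of the Rees algebra: the generators of the
  ideal at height 1, the variables at height 0.\<close>

definition cone_gens :: "('v::finite) exps set \<Rightarrow> (rat ^ 'v option) set"
  where "cone_gens G = (\<lambda>g. evec g 1) ` G \<union> range (\<lambda>v. evec (single v 1) 0)"

lemma evec_nth [simp]: "evec a n $ None = of_nat n" "evec a n $ Some v = of_nat (lookup a v)"
  by (simp_all add: evec_def)

lemma vec_option_eqI:
  assumes "x $ None = y $ None" "\<And>v. x $ Some v = y $ Some v"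
  shows "x = y"
  unfolding Finite_Cartesian_Product.vec_eq_iff
proof
  show "x $ i = y $ i" for i using assms by (cases i) auto
qed

lemma evec_add: "evec (a + b) (m + n) = evec a m + evec b n"
  by (rule vec_option_eqI) (simp_all add: lookup_add)

lemma evec_mult: "evec (exp_mult i a) (i * n) = of_nat i *s evec a n"
  by (rule vec_option_eqI) simp_all

lemma evec_zero [simp]: "evec 0 0 = 0"
  by (rule vec_option_eqI) simp_all

lemma evec_inj: "evec a m = evec b n \<longleftrightarrow> a = b \<and> m = n"
proof
  assume *: "evec a m = evec b n"
  have "lookup a v = lookup b v" for v
    using arg_cong[OF *, of "\<lambda>x. x $ Some v"] by simp
  moreover have "m = n"
    using arg_cong[OF *, of "\<lambda>x. x $ None"] by simp
  ultimately show "a = b \<and> m = n" by (auto intro: poly_mapping_eqI)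
qed simp

lemma sum_UNIV_option: "(\<Sum>i\<in>(UNIV :: 'v::finite option set). f i) = f None + (\<Sum>v\<in>UNIV. f (Some v))"
  by (simp add: UNIV_option_conv sum.reindex)

lemma dotp_evec: "dotp c (evec a n) = c $ None * of_nat n + (\<Sum>v\<in>UNIV. c $ Some v * of_nat (lookup a v))"
  by (simp add: dotp_def sum_UNIV_option)

lemma dotp_evec_single: "dotp c (evec (single v (Suc 0)) 0) = c $ Some v"
  by (simp add: dotp_evec lookup_single when_def if_distrib[of of_nat] if_distrib[of "\<lambda>x. _ * x"] cong: if_cong)

lemma single_add_diff:
  assumes "lookup a v \<noteq> 0"
  shows "a = single v 1 + (a - single v (1::nat))"
  using assms by (intro poly_mapping_eqI) (auto simp: lookup_add lookup_minus lookup_single when_def)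

lemma exponent_induct [case_names zero add]:
  fixes a :: "('v::finite) exps"
  assumes "P 0" "\<And>a v. P a \<Longrightarrow> P (single v 1 + a)"
  shows "P a"
proof (induction "\<Sum>v\<in>UNIV. lookup a v" arbitrary: a rule: less_induct)
  case less
  show ?case
  proof (cases "a = 0")
    case False
    then obtain v where v: "lookup a v \<noteq> 0" by (metis lookup_zero poly_mapping_eqI)
    note a = single_add_diff[OF v]
    have "(\<Sum>u\<in>UNIV. lookup (a - single v 1) u) < (\<Sum>u\<in>UNIV. lookup a u)"
      by (subst (2) a) (simp add: lookup_add sum.distrib lookup_single when_def)
    from assms(2)[OF less(1)[OF this]] show ?thesis by (subst a)
  qed (use assms(1) in simp)
qed

lemma evec_0_eq_sum_list:
  "\<exists>ms. set ms \<subseteq> range (\<lambda>v. evec (single v 1) 0) \<and> sum_list ms = evec a 0"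
proof (induction a rule: exponent_induct)
  case zero
  show ?case by (intro exI[of _ "[]"]) simp
next
  case (add a v)
  then obtain ms where ms: "set ms \<subseteq> range (\<lambda>v. evec (single v 1) 0)" "sum_list ms = evec a 0"
    by blast
  have "evec (single v 1 + a) 0 = evec (single v 1) 0 + evec a 0"
    using evec_add[of "single v 1" a 0 0] by simp
  with ms show ?case
    by (intro exI[of _ "evec (single v 1) 0 # ms"]) auto
qed

lemma sum_list_cone_gens:
  assumes "set ms \<subseteq> cone_gens G"
  shows "\<exists>a n. sum_list ms = evec a n \<and> a \<in> sumset_pow (up_hull G) n"
  using assms
proof (induction ms)
  case Nil
  then show ?case by (intro exI[of _ 0]) simp
next
  case (Cons x ms)
  then obtain a n where a: "sum_list ms = evec a n" "a \<in> sumset_pow (up_hull G) n" by auto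
  from Cons.prems consider g where "g \<in> G" "x = evec g 1" | v where "x = evec (single v 1) 0"
    by (auto simp: cone_gens_def)
  then show ?case
  proof cases
    case 1
    then have "sum_list (x # ms) = evec (a + g) (Suc n)"
      using evec_add[of a g n 1] a by (simp add: add.commute)
    moreover have "a + g \<in> sumset_pow (up_hull G) (Suc n)"
      using a 1 up_hull_superset by auto
    ultimately show ?thesis by blast
  next
    case 2
    then have "sum_list (x # ms) = evec (a + single v 1) n"
      using evec_add[of a "single v 1" n 0] a by (simp add: add.commute)
    moreover have "a + single v 1 \<in> sumset_pow (up_hull G) n"
      by (intro up_closedD[OF up_closed_sumset_pow[OF up_closed_up_hull]] a)
    ultimately show ?thesis by blast
  qed
qed

text \<open>Exponents of the \<open>n\<close>-th power are the height \<open>n\<close> elements of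
  the semigroup generated by \<open>cone_gens G\<close>; consequently
  \<open>power_saturation\<close> passes to the saturation of this semigroup, where Farkas' lemma
  applies.\<close>

lemma sumset_pow_iff_sum_list:
  "a \<in> sumset_pow (up_hull G) n \<longleftrightarrow> (\<exists>ms. set ms \<subseteq> cone_gens G \<and> sum_list ms = evec a n)"
proof
  assume "a \<in> sumset_pow (up_hull G) n"
  then show "\<exists>ms. set ms \<subseteq> cone_gens G \<and> sum_list ms = evec a n"
  proof (induction n arbitrary: a)
    case 0
    show ?case using evec_0_eq_sum_list[of a] by (auto simp: cone_gens_def)
  next
    case (Suc n)
    then obtain b g c where *: "a = b + (g + c)" "b \<in> sumset_pow (up_hull G) n" "g \<in> G"
      by (auto simp: up_hull_def)
    from Suc.IH[OF *(2)] obtain ms where ms: "set ms \<subseteq> cone_gens G" "sum_list ms = evec b n" by blast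
    from evec_0_eq_sum_list[of c] obtain ms' where ms': "set ms' \<subseteq> cone_gens G" "sum_list ms' = evec c 0"
      by (auto simp: cone_gens_def)
    have "evec a (Suc n) = evec g 1 + evec b n + evec c 0"
      using evec_add[of g b 1 n] evec_add[of "g + b" c "Suc n" 0] * by (simp add: add_ac)
    with ms ms' *(3) show ?case
      by (intro exI[of _ "evec g 1 # ms @ ms'"]) (auto simp: cone_gens_def add_ac)
  qed
next
  assume "\<exists>ms. set ms \<subseteq> cone_gens G \<and> sum_list ms = evec a n"
  with sum_list_cone_gens show "a \<in> sumset_pow (up_hull G) n" by (metis evec_inj)
qed

lemma finite_cone_gens: "finite G \<Longrightarrow> finite (cone_gens G)"
  by (simp add: cone_gens_def)

lemma dotp_nonneg_power_saturation:
  assumes "a \<in> power_saturation (up_hull G) n" "\<forall>x\<in>cone_gens G. dotp c x \<ge> 0"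
  shows "dotp c (evec a n) \<ge> 0"
proof -
  from assms(1) obtain i where i: "i \<ge> 1" "exp_mult i a \<in> sumset_pow (up_hull G) (n * i)"
    by (auto simp: power_saturation_def)
  from i(2) obtain ms where ms: "set ms \<subseteq> cone_gens G" "sum_list ms = evec (exp_mult i a) (i * n)"
    unfolding sumset_pow_iff_sum_list by (auto simp: mult.commute)
  have "0 \<le> sum_list (map (dotp c) ms)"
    using ms(1) assms(2) by (intro sum_list_nonneg) auto
  also have "\<dots> = of_nat i * dotp c (evec a n)"
    using dotp_sum_list[of c ms] by (simp add: ms(2) evec_mult dotp_scale_right)
  finally show ?thesis using i(1) by (simp add: zero_le_mult_iff)
qed

text \<open>Inverting the variables outside \<open>F\<close> adjoins their negative unit vectors to
  the generators. A functional separating the point from the enlarged cone must vanish on these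
  variables.\<close>

lemma power_saturation_farkas:
  assumes "finite G" "\<And>\<gamma>. \<forall>v\<in>F. lookup \<gamma> v = 0 \<Longrightarrow> a + \<gamma> \<notin> power_saturation (up_hull G) n"
  shows "\<exists>c. (\<forall>x\<in>cone_gens G. dotp c x \<ge> 0) \<and> (\<forall>v. v \<notin> F \<longrightarrow> c $ Some v = 0) \<and> dotp c (evec a n) < 0"
proof -
  define N where "N = (\<lambda>v. - evec (single v 1) 0) ` (- F)"
  have "finite (cone_gens G \<union> N)" using finite_cone_gens[OF assms(1)] by (simp add: N_def)
  then obtain xs where xs: "set xs = cone_gens G \<union> N" using finite_list by blast
  have "\<not> in_cone xs (evec a n)"
  proof
    assume "in_cone xs (evec a n)"
    from in_cone_rat_multiple[OF this] obtain i ms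
      where ms: "i \<ge> 1" "set ms \<subseteq> set xs" "sum_list ms = of_nat i *s evec a n" by blast
    \<comment> \<open>The negative unit vectors are moved to the other side and recorded in
      \<gamma>.\<close>
    have "\<exists>ms' \<gamma>. set ms' \<subseteq> cone_gens G \<and> sum_list ms' = sum_list ms + evec \<gamma> 0 \<and> (\<forall>v\<in>F. lookup \<gamma> v = 0)"
      using ms(2)
    proof (induction ms)
      case Nil
      then show ?case by (intro exI[of _ "[]"] exI[of _ 0]) simp
    next
      case (Cons x ms)
      then obtain ms' \<gamma> where IH: "set ms' \<subseteq> cone_gens G" "sum_list ms' = sum_list ms + evec \<gamma> 0"
        "\<forall>v\<in>F. lookup \<gamma> v = 0" by auto
      from Cons.prems xs consider "x \<in> cone_gens G" | v where "v \<notin> F" "x = - evec (single v 1) 0"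
        by (auto simp: N_def)
      then show ?case
      proof cases
        case 1
        with IH show ?thesis by (intro exI[of _ "x # ms'"] exI[of _ \<gamma>]) (auto simp: add_ac)
      next
        case 2
        with IH show ?thesis
          using evec_add[of \<gamma> "single v 1" 0 0]
          by (intro exI[of _ ms'] exI[of _ "\<gamma> + single v 1"])
            (auto simp: lookup_add lookup_single when_def)
      qed
    qed
    then obtain ms' \<gamma> where ms': "set ms' \<subseteq> cone_gens G" "sum_list ms' = of_nat i *s evec a n + evec \<gamma> 0"
      "\<forall>v\<in>F. lookup \<gamma> v = 0" using ms(3) by auto
    have "sum_list ms' = evec (exp_mult i a + \<gamma>) (n * i)"
      using evec_add[of "exp_mult i a" \<gamma> "i * n" 0] by (simp add: ms'(2) evec_mult mult.commute)
    with ms'(1) have "exp_mult i a + \<gamma> \<in> sumset_pow (up_hull G) (n * i)"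
      unfolding sumset_pow_iff_sum_list by blast
    \<comment> \<open>One copy of \<gamma> is available, but \<open>i\<close> copies are needed for
      a multiple of \<open>a + \<gamma>\<close>; the missing \<open>i - 1\<close> are free, as the
      set is up-closed.\<close>
    then have "exp_mult i a + \<gamma> + exp_mult (i - 1) \<gamma> \<in> sumset_pow (up_hull G) (n * i)"
      by (rule up_closedD[OF up_closed_sumset_pow[OF up_closed_up_hull]])
    also have "exp_mult i a + \<gamma> + exp_mult (i - 1) \<gamma> = exp_mult i (a + \<gamma>)"
      using ms(1) by (cases i) (auto intro!: poly_mapping_eqI simp: lookup_add algebra_simps)
    finally have "a + \<gamma> \<in> power_saturation (up_hull G) n"
      using ms(1) by (auto simp: power_saturation_def)
    with assms(2) ms'(3) show False by blast
  qed
  with farkas[of xs "evec a n"] obtain c where c: "\<forall>x\<in>set xs. dotp c x \<ge> 0" "dotp c (evec a n) < 0" by blast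
  have "c $ Some v = 0" if "v \<notin> F" for v
  proof -
    let ?e = "evec (single v 1) 0"
    have "?e \<in> set xs" "- ?e \<in> set xs" using that by (auto simp: xs cone_gens_def N_def)
    then have "dotp c ?e \<ge> 0" "dotp c (0 - ?e) \<ge> 0" using c by auto
    then show ?thesis unfolding dotp_diff_right by (simp add: dotp_evec_single)
  qed
  with c xs show ?thesis by auto
qed

text \<open>The lattice points of the rational cone at height \<open>n\<close>. The hard direction
  is the preceding lemma for \<open>F = UNIV\<close>, where \<gamma> can only be 0.\<close>

lemma power_saturation_iff_dotp:
  assumes "finite G"
  shows "a \<in> power_saturation (up_hull G) n \<longleftrightarrow> (\<forall>c. (\<forall>x\<in>cone_gens G. dotp c x \<ge> 0) \<longrightarrow> dotp c (evec a n) \<ge> 0)"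
proof -
  have "a \<in> power_saturation (up_hull G) n" if "\<forall>c. (\<forall>x\<in>cone_gens G. dotp c x \<ge> 0) \<longrightarrow> dotp c (evec a n) \<ge> 0"
  proof (rule ccontr)
    assume n: "a \<notin> power_saturation (up_hull G) n"
    have "\<gamma> = 0" if "\<forall>v\<in>UNIV. lookup \<gamma> v = 0" for \<gamma> :: "'a exps"
      using that by (intro poly_mapping_eqI) simp
    with n have "a + \<gamma> \<notin> power_saturation (up_hull G) n" if "\<forall>v\<in>UNIV. lookup \<gamma> v = 0" for \<gamma>
      using that by fastforce
    from power_saturation_farkas[OF assms this] that show False by force
  qed
  with dotp_nonneg_power_saturation show ?thesis by blast
qed

text \<open>The separating functional from Farkas' lemma, made as tight as possible. It is positive
  on \<open>F\<close> because it is negative at \<beta> but nonnegative once a unit vector of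
  \<open>F\<close> is added, which puts the point into the saturation.\<close>

lemma corner_functional:
  assumes "finite G" "corner (power_saturation (up_hull G) n) F \<beta>"
  obtains c where "\<forall>x\<in>cone_gens G. dotp c x \<ge> 0" "\<And>v. v \<notin> F \<Longrightarrow> c $ Some v = 0"
    "\<And>v. v \<in> F \<Longrightarrow> c $ Some v > 0" "dotp c (evec \<beta> n) < 0"
    "cone_gens G \<subseteq> vec.span (insert (evec \<beta> n) {x\<in>cone_gens G. dotp c x = 0})"
proof -
  define N where "N = (\<lambda>v. - evec (single v 1) 0) ` (- F)"
  define \<Phi> where "\<Phi> = cone_gens G \<union> N"
  have fin: "finite \<Phi>" using finite_cone_gens[OF assms(1)] by (simp add: \<Phi>_def N_def)
  have minus: "dotp f (- x) = - dotp f x" for f x :: "rat ^ 'a option"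
    using dotp_diff_right[of f 0 x] by simp
  obtain f where f: "\<forall>x\<in>cone_gens G. dotp f x \<ge> 0" "\<forall>v. v \<notin> F \<longrightarrow> f $ Some v = 0" "dotp f (evec \<beta> n) < 0"
    using power_saturation_farkas[OF assms(1), of F \<beta> n] assms(2) by (auto simp: corner_def)
  have "\<forall>x\<in>\<Phi>. dotp f x \<ge> 0" using f by (auto simp: \<Phi>_def N_def minus dotp_evec_single)
  from tight_functional[OF fin this, of "evec \<beta> n"] f obtain c
    where c: "\<forall>x\<in>\<Phi>. dotp c x \<ge> 0" "dotp c (evec \<beta> n) < 0"
      "\<Phi> \<subseteq> vec.span (insert (evec \<beta> n) {x\<in>\<Phi>. dotp c x = 0})" by auto
  have c0: "c $ Some v = 0" if "v \<notin> F" for v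
  proof -
    let ?e = "evec (single v 1) 0"
    have "?e \<in> \<Phi>" "- ?e \<in> \<Phi>" using that by (auto simp: \<Phi>_def cone_gens_def N_def)
    then have "dotp c ?e \<ge> 0" "dotp c (- ?e) \<ge> 0" using c by auto
    then show ?thesis unfolding minus by (simp add: dotp_evec_single)
  qed
  have cpos: "c $ Some v > 0" if "v \<in> F" for v
  proof -
    have "0 \<le> dotp c (evec (\<beta> + single v 1) n)"
      using assms(2) that c by (intro dotp_nonneg_power_saturation) (auto simp: corner_def \<Phi>_def)
    also have "\<dots> = dotp c (evec \<beta> n) + c $ Some v"
      using evec_add[of \<beta> "single v 1" n 0]
      by (simp add: dotp_add_right dotp_evec_single)
    finally show ?thesis using c by linarith
  qed
  \<comment> \<open>The negative unit vectors in \<Phi> add nothing to the span, since their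
    positive counterparts are tight generators.\<close>
  let ?Z = "insert (evec \<beta> n) {x\<in>cone_gens G. dotp c x = 0}"
  have "insert (evec \<beta> n) {x\<in>\<Phi>. dotp c x = 0} \<subseteq> vec.span ?Z"
  proof
    fix x assume "x \<in> insert (evec \<beta> n) {x\<in>\<Phi>. dotp c x = 0}"
    then consider "x \<in> ?Z" | v where "v \<notin> F" "x = - evec (single v 1) 0"
      by (auto simp: \<Phi>_def N_def)
    then show "x \<in> vec.span ?Z"
    proof cases
      case 2
      then have "evec (single v 1) 0 \<in> ?Z"
        using c0 by (simp add: cone_gens_def dotp_evec_single)
      then show ?thesis unfolding 2(2) by (intro vec.span_neg vec.span_base)
    qed (rule vec.span_base)
  qed
  then have "vec.span (insert (evec \<beta> n) {x\<in>\<Phi>. dotp c x = 0}) \<subseteq> vec.span ?Z"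
    by (rule vec.span_minimal) simp
  with c(3) have "cone_gens G \<subseteq> vec.span ?Z" by (auto simp: \<Phi>_def)
  then show ?thesis by (intro that[of c] c0 cpos c) (use c in \<open>auto simp: \<Phi>_def\<close>)
qed

section \<open>A facet of the Newton polyhedron yields corners\<close>

text \<open>Expanding the product of column sums gives one summand for every function on the
  indices; the Leibniz formula uses only the permutations among them.\<close>

lemma abs_det_le_prod_column_sums:
  fixes A :: "'a::linordered_field ^ 'n ^ 'n"
  shows "\<bar>Determinants.det A\<bar> \<le> (\<Prod>j\<in>UNIV. \<Sum>i\<in>UNIV. \<bar>A $ i $ j\<bar>)"
proof -
  have "\<bar>Determinants.det A\<bar> = \<bar>Determinants.det (Finite_Cartesian_Product.transpose A)\<bar>" by simp
  also have "\<dots> \<le> (\<Sum>p | p permutes (UNIV :: 'n set). \<bar>of_int (sign p) * (\<Prod>j\<in>UNIV. A $ p j $ j)\<bar>)"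
    unfolding Determinants.det_def by (simp add: Finite_Cartesian_Product.transpose_def sum_abs)
  also have "\<dots> = (\<Sum>p | p permutes (UNIV :: 'n set). \<Prod>j\<in>UNIV. \<bar>A $ p j $ j\<bar>)"
    by (intro sum.cong refl) (simp add: abs_mult abs_prod sign_def)
  also have "\<dots> \<le> (\<Sum>p\<in>PiE UNIV (\<lambda>_. UNIV). \<Prod>j\<in>UNIV. \<bar>A $ p j $ j\<bar>)"
    by (rule sum_mono2) (auto intro: prod_nonneg)
  also have "\<dots> = (\<Prod>j\<in>UNIV. \<Sum>i\<in>UNIV. \<bar>A $ i $ j\<bar>)"
    by (subst prod_sum_PiE) auto
  finally show ?thesis .
qed

lemma det_in_Ints:
  fixes A :: "'a::field_char_0 ^ 'n ^ 'n"
  assumes "\<And>i j. A $ i $ j \<in> \<int>"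
  shows "Determinants.det A \<in> \<int>"
  unfolding Determinants.det_def by (intro Ints_sum Ints_mult Ints_prod assms) auto

text \<open>The matrix with columns \<open>h j\<close> and rows in \<open>F\<close>, completed by an
  identity block outside \<open>F\<close>. The completion keeps the index type while leaving the
  determinant and the relevant minors unchanged.\<close>

definition facet_matrix :: "'v::finite set \<Rightarrow> ('v \<Rightarrow> 'v exps) \<Rightarrow> rat ^ 'v ^ 'v"
  where "facet_matrix F h = (\<chi> i j. if j \<in> F then (if i \<in> F then of_nat (lookup (h j) i) else 0)
    else if i = j then 1 else 0)"

text \<open>\<open>a\<close> is the normal of a facet of the Newton polyhedron of \<open>up_hull G\<close>, projected to the
  coordinates in \<open>F\<close>, and the exponents \<open>h j\<close> span this facet.\<close>

definition facet :: "('v::finite) exps set \<Rightarrow> 'v set \<Rightarrow> (rat ^ 'v) \<Rightarrow> rat \<Rightarrow> ('v \<Rightarrow> 'v exps) \<Rightarrow> bool"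
  where "facet G F a b h \<longleftrightarrow> b > 0 \<and> (\<forall>v. v \<notin> F \<longrightarrow> a $ v = 0) \<and> (\<forall>v\<in>F. a $ v > 0) \<and>
    (\<forall>g\<in>G. (\<Sum>v\<in>UNIV. a $ v * of_nat (lookup g v)) \<ge> b) \<and>
    (\<forall>j\<in>F. h j \<in> G \<and> (\<Sum>v\<in>UNIV. a $ v * of_nat (lookup (h j) v)) = b) \<and>
    Determinants.det (facet_matrix F h) \<noteq> 0"

text \<open>The tight functional of the corner gives the normal \<open>a\<close> and the level
  \<open>b\<close>. Its maximal tightness means that the tight generators, restricted to
  \<open>F\<close>, span all of the coordinates in \<open>F\<close>, so the \<open>h j\<close> can
  be chosen among them as a basis.\<close>

lemma corner_imp_facet:
  fixes F :: "'v::finite set"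
  assumes "finite G" "G \<noteq> {}" "corner (power_saturation (up_hull G) n) F \<beta>"
  obtains a b h where "facet G F a b h"
proof -
  obtain c where c: "\<forall>x\<in>cone_gens G. dotp c x \<ge> 0" "\<And>v. v \<notin> F \<Longrightarrow> c $ Some v = 0"
    "\<And>v. v \<in> F \<Longrightarrow> c $ Some v > 0" "dotp c (evec \<beta> n) < 0"
    "cone_gens G \<subseteq> vec.span (insert (evec \<beta> n) {x\<in>cone_gens G. dotp c x = 0})"
    using corner_functional[OF assms(1,3)] by blast
  define a where "a = (\<chi> v. c $ Some v)"
  define b where "b = - c $ None"
  have cg: "dotp c (evec g 1) = (\<Sum>v\<in>UNIV. a $ v * of_nat (lookup g v)) - b" for g
    by (simp add: dotp_evec a_def b_def)
  have "c $ Some v \<ge> 0" for v using c(2,3)[of v] by (cases "v \<in> F") auto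
  then have "(\<Sum>v\<in>UNIV. c $ Some v * of_nat (lookup \<beta> v)) \<ge> 0" by (intro sum_nonneg) simp
  with c(4) have "c $ None * of_nat n < 0" unfolding dotp_evec by linarith
  then have b: "b > 0" by (auto simp: b_def mult_less_0_iff)
  define T where "T = {g\<in>G. dotp c (evec g 1) = 0}"
  define r where "r g = (\<chi> v. if v \<in> F then (of_nat (lookup g v) :: rat) else 0)" for g :: "'v exps"
  define Ax where "Ax = (\<lambda>v. axis v (1::rat)) ` (- F)"
  let ?W = "r ` T \<union> Ax"
  have "x \<in> vec.span ?W" for x
  proof (rule ccontr)
    assume "x \<notin> vec.span ?W"
    \<comment> \<open>A functional \<open>d\<close> vanishing on \<open>?W\<close> is extended by 0
      to the height and corrected by a multiple of \<open>c\<close> so as to vanish at \<beta> as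
      well. It then vanishes on all generators; as \<open>b\<close> is positive, the correction and
      \<open>d\<close> must both be zero.\<close>
    from separating_functional[OF this] obtain d where d: "\<forall>s\<in>?W. dotp d s = 0" "dotp d x \<noteq> 0" by blast
    define D where "D = (\<chi> i. case i of None \<Rightarrow> 0 | Some v \<Rightarrow> d $ v)"
    have dF: "d $ v = 0" if "v \<notin> F" for v
    proof -
      have "axis v 1 \<in> ?W" using that by (simp add: Ax_def)
      with d have "dotp d (axis v 1) = 0" by blast
      then show ?thesis by (simp add: dotp_def axis_def if_distrib[of "\<lambda>x. _ * x"] cong: if_cong)
    qed
    define \<mu> where "\<mu> = dotp D (evec \<beta> n) / dotp c (evec \<beta> n)"
    define D' where "D' = D - \<mu> *s c"
    have D': "dotp D' y = dotp D y - \<mu> * dotp c y" for y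
      by (simp add: D'_def dotp_diff_left dotp_scale_left)
    have "dotp D' y = 0" if "y \<in> insert (evec \<beta> n) {x\<in>cone_gens G. dotp c x = 0}" for y
    proof -
      from that consider "y = evec \<beta> n" | g where "g \<in> T" "y = evec g 1"
        | v where "y = evec (single v 1) 0" "c $ Some v = 0"
        by (auto simp: T_def cone_gens_def dotp_evec_single)
      then show ?thesis
      proof cases
        case 1
        then show ?thesis using c(4) by (simp add: D' \<mu>_def)
      next
        case 2
        have "dotp D (evec g 1) = dotp d (r g)"
          by (simp add: dotp_evec D_def r_def) (auto simp: dotp_def dF intro!: sum.cong)
        with 2 d show ?thesis by (simp add: D' T_def)
      next
        case 3
        then have "v \<notin> F" using c(3) by force
        with 3 show ?thesis by (simp add: D'_def dotp_evec_single D_def dF)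
      qed
    qed
    then have "insert (evec \<beta> n) {x\<in>cone_gens G. dotp c x = 0} \<subseteq> {y. dotp D' y = 0}" by blast
    moreover have "vec.subspace {y. dotp D' y = 0}"
      by (rule vec.subspaceI) (auto simp: dotp_add_right dotp_scale_right)
    ultimately have "vec.span (insert (evec \<beta> n) {x\<in>cone_gens G. dotp c x = 0}) \<subseteq> {y. dotp D' y = 0}"
      by (rule vec.span_minimal)
    with c(5) have gens0: "dotp D' y = 0" if "y \<in> cone_gens G" for y using that by blast
    have S0: "D' $ Some v = 0" for v
    proof -
      have "evec (single v 1) 0 \<in> cone_gens G" by (simp add: cone_gens_def)
      from gens0[OF this] show ?thesis by (simp add: dotp_evec_single)
    qed
    obtain g where "g \<in> G" using assms(2) by blast
    then have "evec g 1 \<in> cone_gens G" by (simp add: cone_gens_def)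
    from gens0[OF this] have "D' $ None = 0" by (simp add: dotp_evec S0)
    then have "\<mu> = 0" using b by (simp add: D'_def D_def b_def)
    then have "d $ v = 0" for v using S0[of v] by (simp add: D'_def D_def)
    with d(2) show False by (simp add: dotp_def)
  qed
  then have W: "vec.span ?W = UNIV" by blast
  have "Ax \<subseteq> cart_basis" by (auto simp: Ax_def cart_basis_def)
  then have "vec.independent Ax" using independent_cart_basis vec.independent_mono by blast
  \<comment> \<open>The basis is made to contain the unit vectors outside \<open>F\<close>, so that
    exactly \<open>card F\<close> of its members come from tight generators.\<close>
  then obtain B where B: "Ax \<subseteq> B" "B \<subseteq> ?W" "vec.independent B" "?W \<subseteq> vec.span B"
    using vec.maximal_independent_subset_extend[of Ax ?W] by (metis Un_upper2)
  have spanB: "vec.span B = UNIV"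
    using vec.span_minimal[OF B(4)] W by auto
  have finB: "finite B" using B(3) by (rule vec.finiteI_independent)
  have "card B = CARD('v)"
    using vec.dim_eq_card[of B UNIV] spanB B(3) by (simp add: vec.dim_UNIV card_cart_basis)
  moreover have "card Ax = card (- F)"
    unfolding Ax_def by (rule card_image) (auto simp: inj_on_def axis_eq_axis)
  ultimately have "card (B - Ax) = card F"
    using finB B(1) by (simp add: Compl_eq_Diff_UNIV card_Diff_subset finite_subset card_mono)
  then obtain \<sigma> where \<sigma>: "bij_betw \<sigma> F (B - Ax)"
    using finB finite_same_card_bij[of F "B - Ax"] by auto
  have "\<exists>g\<in>T. \<sigma> j = r g" if "j \<in> F" for j
    using bij_betwE[OF \<sigma>] that B(2) by blast
  then obtain h where h: "\<And>j. j \<in> F \<Longrightarrow> h j \<in> T \<and> \<sigma> j = r (h j)" by metis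
  have col: "column j (facet_matrix F h) = (if j \<in> F then \<sigma> j else axis j 1)" for j
    using h by (auto simp: facet_matrix_def column_def r_def axis_def Finite_Cartesian_Product.vec_eq_iff)
  have "columns (facet_matrix F h) = B"
  proof
    show "columns (facet_matrix F h) \<subseteq> B"
      using bij_betwE[OF \<sigma>] B(1) by (auto simp: columns_def col Ax_def)
    show "B \<subseteq> columns (facet_matrix F h)"
    proof
      fix x assume "x \<in> B"
      then have "x \<in> Ax \<or> x \<in> \<sigma> ` F" using bij_betw_imp_surj_on[OF \<sigma>] by blast
      then consider j where "j \<in> F" "x = \<sigma> j" | v where "v \<notin> F" "x = axis v 1"
        unfolding Ax_def by blast
      then show "x \<in> columns (facet_matrix F h)"
        by cases (auto simp: columns_def col)
    qed
  qed
  then have "Determinants.det (facet_matrix F h) \<noteq> 0"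
    unfolding invertible_det_nz[symmetric] invertible_right_inverse matrix_right_invertible_span_columns
    by (simp add: spanB)
  moreover have "(\<Sum>v\<in>UNIV. a $ v * of_nat (lookup g v)) \<ge> b" if "g \<in> G" for g
  proof -
    have "evec g 1 \<in> cone_gens G" using that by (simp add: cone_gens_def)
    with c(1) show ?thesis using cg[of g] by force
  qed
  ultimately have "facet G F a b h"
    using b c(2,3) h cg by (auto simp: facet_def a_def T_def)
  then show ?thesis by (rule that)
qed

text \<open>The corner is taken just below an integral point deep inside the cone over the simplex
  of the \<open>h j\<close>. Depth guarantees that after adding any \<open>e_i\<close> with
  \<open>i\<close> in \<open>F\<close> the point can be slid back onto this cone with nonnegative
  coefficients.\<close>

lemma facet_imp_corner:
  fixes F :: "'v::finite set"
  assumes G: "finite G" "\<And>g. g \<in> G \<Longrightarrow> (\<Sum>v\<in>UNIV. lookup g v) \<le> d"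
    and facet: "facet G F a b h" and F: "card F \<ge> 2" and n: "n \<ge> 2 * card F * d ^ (card F - 2)"
  shows "\<exists>\<beta>. corner (power_saturation (up_hull G) n) F \<beta>"
proof -
  let ?V = "facet_matrix F h" and ?m = "card F"
  define D where "D = Determinants.det ?V"
  define H where "H j v = (of_nat (lookup (h j) v) :: rat)" for j v
  have b: "b > 0" and a0: "\<And>v. v \<notin> F \<Longrightarrow> a $ v = 0" and apos: "\<And>v. v \<in> F \<Longrightarrow> a $ v > 0"
    and hG: "\<And>j. j \<in> F \<Longrightarrow> h j \<in> G" and D0: "D \<noteq> 0"
    and aG: "\<And>g. g \<in> G \<Longrightarrow> (\<Sum>v\<in>UNIV. a $ v * of_nat (lookup g v)) \<ge> b"
    using facet by (auto simp: facet_def D_def)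
  have sumF: "(\<Sum>v\<in>UNIV. a $ v * x v) = (\<Sum>v\<in>F. a $ v * x v)" for x
    by (rule sum.mono_neutral_right) (auto simp: a0)
  have ah: "(\<Sum>v\<in>F. a $ v * H j v) = b" if "j \<in> F" for j
    using facet that by (simp add: facet_def H_def flip: sumF)
  have finF: "finite F" by simp
  have "F \<noteq> {}" using F by auto
  \<comment> \<open>The least entry of \<open>a\<close> is needed so that subtracting
    \<open>e_k\<close> lowers the level by at most what any \<open>e_i\<close> restores.\<close>
  then obtain k where k: "k \<in> F" "\<And>i. i \<in> F \<Longrightarrow> a $ k \<le> a $ i"
    using Min_in[of "($) a ` F"] Min_le[of "($) a ` F"] finF by fastforce
  note ak = apos[OF k(1)]
  have Vnth: "?V $ i $ j = (if j \<in> F then (if i \<in> F then H j i else 0) else if i = j then 1 else 0)" for i j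
    by (simp add: facet_matrix_def H_def)
  define s where "s j = (\<Sum>i\<in>UNIV. \<bar>?V $ i $ j\<bar>)" for j
  have s_F: "s j = (\<Sum>i\<in>F. H j i)" if "j \<in> F" for j
  proof -
    have "s j = (\<Sum>i\<in>UNIV. if i \<in> F then H j i else 0)"
      unfolding s_def using that by (intro sum.cong) (auto simp: Vnth H_def)
    then show ?thesis by (simp add: sum.If_cases)
  qed
  have s_nF: "s j = 1" if "j \<notin> F" for j
    unfolding s_def using that by (simp add: Vnth if_distrib[of abs] cong: if_cong)
  have s_nonneg: "s j \<ge> 0" for j by (simp add: s_def sum_nonneg)
  have s_d: "s j \<le> of_nat d" if "j \<in> F" for j
  proof -
    have "s j \<le> (\<Sum>i\<in>UNIV. H j i)"
      unfolding s_F[OF that] by (rule sum_mono2) (auto simp: H_def)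
    also have "\<dots> = of_nat (\<Sum>i\<in>UNIV. lookup (h j) i)" by (simp add: H_def)
    also have "\<dots> \<le> of_nat d" using G(2)[OF hG[OF that]] by (simp only: of_nat_le_iff)
    finally show ?thesis .
  qed
  \<comment> \<open>The alternative column bound; it is the factor that will cancel against
    \<open>D_ge\<close>.\<close>
  have s_b: "s j \<le> b / a $ k" if "j \<in> F" for j
  proof -
    have "a $ k * s j = (\<Sum>i\<in>F. a $ k * H j i)" by (simp add: s_F that sum_distrib_left)
    also have "\<dots> \<le> (\<Sum>i\<in>F. a $ i * H j i)"
      by (intro sum_mono mult_right_mono k) (auto simp: H_def)
    finally show ?thesis using ah[OF that] ak by (simp add: field_simps)
  qed

  \<comment> \<open>Replacing row \<open>k\<close> by the combination of all rows with weights \<open>a\<close> makes it \<open>b\<close> times an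
    integral row.\<close>
  have D_ge: "\<bar>D\<bar> \<ge> b / a $ k"
  proof -
    define Ev where "Ev = (\<chi> j. if j \<in> F then (1::rat) else 0)"
    let ?E = "Determinants.det (\<chi> i. if i = k then Ev else Finite_Cartesian_Product.row i ?V)"
    have "(\<Sum>i\<in>UNIV. a $ i * ?V $ i $ j) = b * Ev $ j" for j
    proof (cases "j \<in> F")
      case True
      then have "(\<Sum>i\<in>UNIV. a $ i * ?V $ i $ j) = (\<Sum>i\<in>F. a $ i * H j i)"
        by (simp add: sumF Vnth)
      with True show ?thesis by (simp add: ah Ev_def)
    qed (auto simp: Ev_def Vnth a0 intro!: sum.neutral)
    then have rows: "(\<Sum>i\<in>UNIV. a $ i *s Finite_Cartesian_Product.row i ?V) = b *s Ev"
      by (simp add: Finite_Cartesian_Product.vec_eq_iff Finite_Cartesian_Product.row_def)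
    have "a $ k * D = b * ?E"
      using cramer_lemma_transpose[of k a ?V, unfolded rows] det_row_mul[of k b "\<lambda>_. Ev" "\<lambda>i. Finite_Cartesian_Product.row i ?V"]
      by (simp add: D_def)
    moreover have "?E \<in> \<int>"
      by (rule det_in_Ints) (auto simp: Ev_def Finite_Cartesian_Product.row_def Vnth H_def)
    moreover have "?E \<noteq> 0" using calculation(1) D0 ak by auto
    ultimately have "\<bar>?E\<bar> \<ge> 1" by (intro Ints_nonzero_abs_ge1)
    have "a $ k * \<bar>D\<bar> = b * \<bar>?E\<bar>"
      using \<open>a $ k * D = b * ?E\<close> ak b by (metis abs_mult abs_of_pos)
    with \<open>\<bar>?E\<bar> \<ge> 1\<close> b have "a $ k * \<bar>D\<bar> \<ge> b" by simp
    then show ?thesis using ak by (simp add: field_simps)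
  qed

  \<comment> \<open>\<open>L i\<close> is the \<open>i\<close>-th column of the inverse matrix, by
    Cramer's rule: the coordinates of \<open>e_i\<close> in the basis \<open>h j\<close>.\<close>
  define L where "L i = (\<chi> j. Determinants.det (\<chi> p q. if q = j then axis i 1 $ p else ?V $ p $ q) / D)" for i
  have VL: "?V *v L i = axis i 1" for i
    using cramer[of ?V "L i" "axis i 1"] D0 by (simp add: L_def D_def)
  have LF: "(\<Sum>j\<in>F. H j v * L i $ j) = (if v = i then 1 else 0)" if "v \<in> F" for v i
  proof -
    have "(if v = i then 1 else 0) = (\<Sum>j\<in>UNIV. ?V $ v $ j * L i $ j)"
      using arg_cong[OF VL[of i], of "\<lambda>x. x $ v"] by (simp add: matrix_vector_mult_def axis_def)
    also have "\<dots> = (\<Sum>j\<in>F. ?V $ v $ j * L i $ j)"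
      using that by (intro sum.mono_neutral_right) (auto simp: Vnth)
    finally show ?thesis using that by (simp add: Vnth)
  qed
  have Lsum: "(\<Sum>j\<in>F. L i $ j) = a $ i / b" if "i \<in> F" for i
  proof -
    have "b * (\<Sum>j\<in>F. L i $ j) = (\<Sum>j\<in>F. \<Sum>v\<in>F. a $ v * H j v * L i $ j)"
      by (simp add: sum_distrib_left ah flip: sum_distrib_right)
    also have "\<dots> = (\<Sum>v\<in>F. \<Sum>j\<in>F. a $ v * H j v * L i $ j)" by (rule sum.swap)
    also have "\<dots> = (\<Sum>v\<in>F. a $ v * (\<Sum>j\<in>F. H j v * L i $ j))"
      by (simp add: sum_distrib_left mult.assoc)
    also have "\<dots> = a $ i" using that by (simp add: LF if_distrib[of "\<lambda>x. _ * x"] cong: if_cong)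
    finally show ?thesis using b by (simp add: field_simps)
  qed

  define M where "M = d ^ (?m - 2)"
  have L_le: "\<bar>L i $ j\<bar> \<le> of_nat M" if ij: "i \<in> F" "j \<in> F" for i j
  proof -
    let ?A = "\<chi> p q. if q = j then axis i 1 $ p else ?V $ p $ q"
    have col: "(\<Sum>p\<in>UNIV. \<bar>?A $ p $ q\<bar>) = (if q = j then 1 else s q)" for q
      by (simp add: s_def axis_def if_distrib[of abs] cong: if_cong)
    have "card (F - {j}) = ?m - 1" using ij by simp
    then have "F - {j} \<noteq> {}" using F by (metis card.empty diff_is_0_eq not_less_eq_eq numeral_2_eq_2 One_nat_def)
    \<comment> \<open>The column \<open>q0\<close> receives the bound \<open>b / a $ k\<close>, the
      other \<open>?m - 2\<close> columns of \<open>F\<close> receive \<open>d\<close>; column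
      \<open>j\<close> and those outside \<open>F\<close> have sum 1.\<close>
    then obtain q0 where q0: "q0 \<in> F" "q0 \<noteq> j" by blast
    have "(\<Prod>q\<in>UNIV. if q = j then 1 else s q) = (\<Prod>q\<in>F - {j}. s q)"
      by (rule prod.mono_neutral_cong_right) (use s_nF in auto)
    also have "\<dots> = s q0 * (\<Prod>q\<in>F - {j} - {q0}. s q)" using q0 by (intro prod.remove) auto
    also have "\<dots> \<le> (b / a $ k) * (\<Prod>q\<in>F - {j} - {q0}. of_nat d)"
      by (intro mult_mono prod_mono conjI s_b s_d s_nonneg prod_nonneg q0) (use q0 b ak in auto)
    also have "\<dots> = (b / a $ k) * of_nat M" using ij q0 by (simp add: M_def card_Diff_singleton numeral_2_eq_2)
    finally have "\<bar>Determinants.det ?A\<bar> \<le> (b / a $ k) * of_nat M"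
      using abs_det_le_prod_column_sums[of ?A] unfolding col by linarith
    also have "\<dots> \<le> \<bar>D\<bar> * of_nat M" using D_ge by (intro mult_right_mono) auto
    finally show ?thesis using D0 by (simp add: L_def field_simps)
  qed

  \<comment> \<open>Some \<open>h j\<close> must involve \<open>k\<close>, for otherwise row
    \<open>k\<close> is zero. This keeps the natural subtraction of 1 in \<open>f\<close> from being
    truncated, and shows \<open>d \<ge> 1\<close>.\<close>
  obtain j1 where j1: "j1 \<in> F" "lookup (h j1) k \<ge> 1"
  proof (rule ccontr)
    assume "\<not> thesis"
    with that have "lookup (h j) k = 0" if "j \<in> F" for j using that by fastforce
    then have "Finite_Cartesian_Product.row k ?V = 0"
      using k(1) by (auto simp: Finite_Cartesian_Product.vec_eq_iff Finite_Cartesian_Product.row_def Vnth H_def)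
    then show False using det_zero_row(2) D0 by (auto simp: D_def)
  qed
  have "1 \<le> (\<Sum>v\<in>UNIV. lookup (h j1) v)"
    using j1(2) member_le_sum[of k UNIV "lookup (h j1)"] by simp
  then have "d \<ge> 1" using G(2)[OF hG[OF j1(1)]] by simp
  then have M: "M \<ge> 1" by (simp add: M_def)

  \<comment> \<open>Each coefficient is at least \<open>2 * M\<close>, to survive two corrections of
    size \<open>M\<close>; the surplus needed for total \<open>n\<close> is given to
    \<open>k\<close>, which here is an element of \<open>F\<close> used as column index.\<close>
  define m where "m j = (if j = k then n - 2 * M * (?m - 1) else 2 * M)" for j
  have n': "n \<ge> 2 * M * (?m - 1) + 2 * M"
  proof -
    have "2 * M * (?m - 1) + 2 * M = 2 * ?m * M" using F by (cases ?m) (auto simp: algebra_simps)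
    with n show ?thesis by (simp add: M_def mult.assoc)
  qed
  have m_ge: "m j \<ge> 2 * M" for j using n' by (auto simp: m_def)
  have m_sum: "(\<Sum>j\<in>F. m j) = n"
  proof -
    have "(\<Sum>j\<in>F. m j) = m k + (\<Sum>j\<in>F - {k}. m j)" using k by (intro sum.remove) auto
    also have "(\<Sum>j\<in>F - {k}. m j) = (\<Sum>j\<in>F - {k}. 2 * M)" by (intro sum.cong) (auto simp: m_def)
    also have "m k + \<dots> = n" using k n' by (simp add: m_def mult.commute)
    finally show ?thesis .
  qed
  \<comment> \<open>Outside \<open>F\<close> the coordinates only have to be large; this value
    dominates any combination of the \<open>h j\<close> with coefficients at most
    \<open>n\<close>.\<close>
  define f where "f v = (if v \<in> F then (\<Sum>j\<in>F. m j * lookup (h j) v) - (if v = k then 1 else 0)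
    else n * (\<Sum>j\<in>F. lookup (h j) v))" for v
  define \<beta> where "\<beta> = Abs_poly_mapping f"
  have lb: "lookup \<beta> v = f v" for v by (simp add: \<beta>_def)
  have "1 \<le> m j1 * lookup (h j1) k" using m_ge[of j1] M j1(2) by (simp add: Suc_le_eq)
  also have "\<dots> \<le> (\<Sum>j\<in>F. m j * lookup (h j) k)"
    by (rule member_le_sum[of j1]) (use j1 in auto)
  finally have pos: "1 \<le> (\<Sum>j\<in>F. m j * lookup (h j) k)" .
  have \<beta>F: "of_nat (lookup \<beta> v) = (\<Sum>j\<in>F. of_nat (m j) * H j v) - (if v = k then 1 else 0)" if "v \<in> F" for v
    using that pos by (simp add: lb f_def of_nat_diff H_def)
  have \<beta>nF: "of_nat (lookup \<beta> v) = (\<Sum>j\<in>F. of_nat n * H j v)" if "v \<notin> F" for v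
    using that by (simp add: lb f_def H_def sum_distrib_left)

  have "\<beta> + single i 1 \<in> power_saturation (up_hull G) n" if i: "i \<in> F" for i
    unfolding power_saturation_iff_dotp[OF G(1)]
  proof (intro allI impI)
    fix c assume c: "\<forall>x\<in>cone_gens G. 0 \<le> dotp c x"
    let ?\<alpha> = "\<beta> + single i 1"
    \<comment> \<open>Coordinates of the facet point reached from \<open>\<beta> + e_i\<close> by
      shortening \<open>e_i\<close> to \<open>(a $ k / a $ i) e_i\<close>. The levels of the two
      corrections agree, so the sum remains \<open>n\<close>.\<close>
    define \<mu> where "\<mu> j = of_nat (m j) - L k $ j + a $ k / a $ i * L i $ j" for j
    note ai = apos[OF i]
    have quot: "a $ k / a $ i \<le> 1" "a $ k / a $ i \<ge> 0" using k(2)[OF i] ai ak by simp_all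
    have \<mu>0: "\<mu> j \<ge> 0" if "j \<in> F" for j
    proof -
      have "\<bar>a $ k / a $ i * L i $ j\<bar> \<le> 1 * of_nat M"
        unfolding abs_mult by (intro mult_mono) (use quot L_le[OF i that] in auto)
      moreover have "of_nat (m j) \<ge> (of_nat (2 * M) :: rat)" using m_ge[of j] by (simp only: of_nat_le_iff)
      then have "of_nat (m j) \<ge> 2 * (of_nat M :: rat)" by simp
      ultimately show ?thesis using L_le[OF k(1) that] unfolding \<mu>_def by linarith
    qed
    have \<mu>sum: "(\<Sum>j\<in>F. \<mu> j) = of_nat n"
    proof -
      have "(\<Sum>j\<in>F. \<mu> j) = of_nat (\<Sum>j\<in>F. m j) - (\<Sum>j\<in>F. L k $ j) + a $ k / a $ i * (\<Sum>j\<in>F. L i $ j)"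
        by (simp add: \<mu>_def sum.distrib sum_subtractf sum_distrib_left)
      also have "\<dots> = of_nat n" using ai b by (simp add: m_sum Lsum k(1) i field_simps)
      finally show ?thesis .
    qed
    \<comment> \<open>The excess over that facet point. Within \<open>F\<close> it is
      \<open>1 - a $ k / a $ i\<close> at \<open>i\<close> and 0 elsewhere.\<close>
    define \<rho> where "\<rho> v = of_nat (lookup ?\<alpha> v) - (\<Sum>j\<in>F. \<mu> j * H j v)" for v
    have \<rho>0: "\<rho> v \<ge> 0" for v
    proof (cases "v \<in> F")
      case True
      have "(\<Sum>j\<in>F. \<mu> j * H j v) = (\<Sum>j\<in>F. of_nat (m j) * H j v) - (\<Sum>j\<in>F. H j v * L k $ j)
        + a $ k / a $ i * (\<Sum>j\<in>F. H j v * L i $ j)"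
        by (simp add: \<mu>_def sum.distrib sum_subtractf sum_distrib_left algebra_simps)
      then show ?thesis using True quot
        by (auto simp: \<rho>_def lookup_add \<beta>F LF lookup_single when_def)
    next
      case False
      have "\<mu> j \<le> of_nat n" if "j \<in> F" for j
        unfolding \<mu>sum[symmetric] using that \<mu>0 by (intro member_le_sum) auto
      then have "(\<Sum>j\<in>F. \<mu> j * H j v) \<le> (\<Sum>j\<in>F. of_nat n * H j v)"
        by (intro sum_mono mult_right_mono) (auto simp: H_def)
      then show ?thesis using False by (simp add: \<rho>_def lookup_add \<beta>nF add_increasing2)
    qed
    have "evec ?\<alpha> n = (\<Sum>j\<in>F. \<mu> j *s evec (h j) 1) + (\<Sum>v\<in>UNIV. \<rho> v *s evec (single v 1) 0)"
    proof (rule vec_option_eqI)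
      fix v
      have "(\<Sum>w\<in>UNIV. \<rho> w * of_nat (lookup (single w (Suc 0)) v)) = \<rho> v"
        by (simp add: lookup_single when_def if_distrib[of of_nat] if_distrib[of "\<lambda>x. _ * x"] cong: if_cong)
      then show "evec ?\<alpha> n $ Some v =
        ((\<Sum>j\<in>F. \<mu> j *s evec (h j) 1) + (\<Sum>v\<in>UNIV. \<rho> v *s evec (single v 1) 0)) $ Some v"
        by (simp add: \<rho>_def H_def)
    qed (simp add: \<mu>sum)
    then have "dotp c (evec ?\<alpha> n) = (\<Sum>j\<in>F. \<mu> j * dotp c (evec (h j) 1)) +
      (\<Sum>v\<in>UNIV. \<rho> v * dotp c (evec (single v 1) 0))"
      by (simp add: dotp_add_right dotp_sum_right dotp_scale_right)
    also have "\<dots> \<ge> 0"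
      using c hG by (intro add_nonneg_nonneg sum_nonneg mult_nonneg_nonneg \<mu>0 \<rho>0) (auto simp: cone_gens_def)
    finally show "0 \<le> dotp c (evec ?\<alpha> n)" .
  qed
  moreover have "\<beta> + \<gamma> \<notin> power_saturation (up_hull G) n" if \<gamma>: "\<forall>v\<in>F. lookup \<gamma> v = 0" for \<gamma>
  proof
    assume mem: "\<beta> + \<gamma> \<in> power_saturation (up_hull G) n"
    \<comment> \<open>The facet functional evaluates to \<open>- a $ k\<close> at \<beta>, and
      \<gamma> cannot change this, as \<open>a\<close> vanishes outside \<open>F\<close>.\<close>
    define c where "c = (\<chi> i. case i of None \<Rightarrow> - b | Some v \<Rightarrow> a $ v)"
    have dc: "dotp c (evec x l) = (\<Sum>v\<in>UNIV. a $ v * of_nat (lookup x v)) - b * of_nat l" for x l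
      by (simp add: dotp_evec c_def)
    have cS: "c $ Some v = a $ v" for v by (simp add: c_def)
    have "a $ v \<ge> 0" for v using a0[of v] apos[of v] by (cases "v \<in> F") auto
    then have "\<forall>x\<in>cone_gens G. 0 \<le> dotp c x"
      using aG by (auto simp: cone_gens_def dc dotp_evec_single cS intro!: sum_nonneg)
    from dotp_nonneg_power_saturation[OF mem this]
    have "b * of_nat n \<le> (\<Sum>v\<in>F. a $ v * of_nat (lookup \<beta> v))"
      using \<gamma> by (simp add: dc sumF lookup_add)
    also have "\<dots> = (\<Sum>v\<in>F. \<Sum>j\<in>F. a $ v * of_nat (m j) * H j v) - a $ k"
      using k(1) by (simp add: \<beta>F right_diff_distrib sum_subtractf sum_distrib_left mult.assoc
          if_distrib[of "\<lambda>x. _ * x"] cong: if_cong)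
    also have "(\<Sum>v\<in>F. \<Sum>j\<in>F. a $ v * of_nat (m j) * H j v) = (\<Sum>j\<in>F. \<Sum>v\<in>F. a $ v * of_nat (m j) * H j v)"
      by (rule sum.swap)
    also have "\<dots> = (\<Sum>j\<in>F. of_nat (m j) * (\<Sum>v\<in>F. a $ v * H j v))"
      by (simp add: sum_distrib_left mult_ac)
    also have "\<dots> = b * of_nat (\<Sum>j\<in>F. m j)" by (simp add: ah sum_distrib_left mult.commute)
    finally show False using ak by (simp add: m_sum)
  qed
  ultimately show ?thesis unfolding corner_def by blast
qed

section \<open>Integral closures of powers of monomial ideals\<close>

definition subring_set :: "'a::comm_ring_1 set \<Rightarrow> bool"
  where "subring_set S \<longleftrightarrow> 1 \<in> S \<and> (\<forall>a\<in>S. \<forall>b\<in>S. a + b \<in> S \<and> a * b \<in> S \<and> - a \<in> S)"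

lemma subring_setD:
  assumes "subring_set S"
  shows "1 \<in> S" "0 \<in> S" "a \<in> S \<Longrightarrow> b \<in> S \<Longrightarrow> a + b \<in> S" "a \<in> S \<Longrightarrow> b \<in> S \<Longrightarrow> a * b \<in> S"
    "a \<in> S \<Longrightarrow> - a \<in> S"
proof -
  show *: "1 \<in> S" "a \<in> S \<Longrightarrow> b \<in> S \<Longrightarrow> a + b \<in> S" "a \<in> S \<Longrightarrow> b \<in> S \<Longrightarrow> a * b \<in> S"
    "a \<in> S \<Longrightarrow> - a \<in> S" for a b
    using assms by (auto simp: subring_set_def)
  show "0 \<in> S" using *(2)[OF *(1) *(4)[OF *(1)]] by simp
qed

lemma subring_set_sum: "subring_set S \<Longrightarrow> (\<And>x. x \<in> A \<Longrightarrow> f x \<in> S) \<Longrightarrow> sum f A \<in> S"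
  by (induction A rule: infinite_finite_induct) (auto intro: subring_setD)

lemma subring_set_prod: "subring_set S \<Longrightarrow> (\<And>x. x \<in> A \<Longrightarrow> f x \<in> S) \<Longrightarrow> prod f A \<in> S"
  by (induction A rule: infinite_finite_induct) (auto intro: subring_setD)

lemma subring_set_poly:
  assumes "subring_set S"
  shows "subring_set {p :: 'a::comm_ring_1 poly. \<forall>i. coeff p i \<in> S}"
  unfolding subring_set_def
proof (intro conjI ballI)
  show "1 \<in> {p :: 'a poly. \<forall>i. coeff p i \<in> S}"
    using subring_setD(1,2)[OF assms] by (simp add: Polynomial.coeff_1 if_distrib)
  fix p q :: "'a poly"
  assume "p \<in> {p. \<forall>i. coeff p i \<in> S}" "q \<in> {p. \<forall>i. coeff p i \<in> S}"
  then show "p + q \<in> {p. \<forall>i. coeff p i \<in> S}" "p * q \<in> {p. \<forall>i. coeff p i \<in> S}"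
    "- p \<in> {p. \<forall>i. coeff p i \<in> S}"
    using subring_setD[OF assms] by (auto simp: coeff_mult intro!: subring_set_sum[OF assms])
qed

text \<open>The determinant trick: multiplication by \<open>x\<close> acts on the \<open>ms\<close>
  through \<open>A\<close>, so by the adjugate \<open>det (x - A)\<close> annihilates all
  \<open>ms\<close>, in particular the one equal to 1. The characteristic polynomial of
  \<open>A\<close> is therefore the monic equation.\<close>

lemma monic_poly_of_finite_span:
  fixes S :: "'a::comm_ring_1 set" and ms :: "nat \<Rightarrow> 'a"
  assumes S: "subring_set S" and one: "m < N" "ms m = 1"
    and A: "\<And>i j. i < N \<Longrightarrow> j < N \<Longrightarrow> A i j \<in> S"
    and x: "\<And>i. i < N \<Longrightarrow> x * ms i = (\<Sum>j<N. A i j * ms j)"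
  obtains p where "\<And>i. coeff p i \<in> S" "coeff p N = 1" "Polynomial.degree p = N" "poly p x = 0"
proof -
  define B where "B = mat N N (\<lambda>(i, j). A i j)"
  have B: "B \<in> carrier_mat N N" by (simp add: B_def)
  define p where "p = char_poly B"
  have cp: "char_poly_matrix B \<in> carrier_mat N N" using B by simp
  have cpn: "char_poly_matrix B $$ (i, j) = (if i = j then [:0, 1:] else 0) + [:- A i j:]" if "i < N" "j < N" for i j
    using that by (simp add: char_poly_matrix_def B_def)
  note SP = subring_set_poly[OF S]
  have "char_poly_matrix B $$ (i, j) \<in> {p. \<forall>i. coeff p i \<in> S}" if "i < N" "j < N" for i j
    using A[OF that] subring_setD[OF S] by (auto simp: cpn that coeff_pCons split: nat.split)
  then have "p \<in> {p. \<forall>i. coeff p i \<in> S}"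
    unfolding p_def char_poly_def Determinant.det_def'[OF cp]
  proof (intro subring_set_sum[OF SP] subring_setD(4)[OF SP] subring_set_prod[OF SP])
    fix \<pi> assume "\<pi> \<in> {\<pi>. \<pi> permutes {0..<N}}"
    show "signof \<pi> \<in> {p :: 'a poly. \<forall>i. coeff p i \<in> S}"
      using subring_setD(1)[OF SP] subring_setD(5)[OF SP subring_setD(1)[OF SP]]
      by (cases \<pi> rule: sign_cases) (simp_all only: of_int_1 of_int_minus)
  qed auto
  moreover have "Polynomial.degree p = N" "coeff p N = 1"
    using degree_monic_char_poly[OF B] by (auto simp: p_def)
  moreover have "poly p x = 0"
  proof -
    have h: "comm_ring_hom (\<lambda>q. poly q x)" by unfold_locales auto
    let ?C = "map_mat (\<lambda>q. poly q x) (char_poly_matrix B)"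
    have C: "?C \<in> carrier_mat N N" using cp by simp
    have detC: "Determinant.det ?C = poly p x" by (simp only: p_def char_poly_def comm_ring_hom.hom_det[OF h])
    define v where "v = Matrix.vec N ms"
    have v: "v \<in> carrier_vec N" by (simp add: v_def)
    have dims: "dim_row (char_poly_matrix B) = N" "dim_col (char_poly_matrix B) = N"
      using cp by auto
    have "?C *\<^sub>v v = 0\<^sub>v N"
    proof (rule eq_vecI)
      fix i assume i: "i < dim_vec (0\<^sub>v N :: 'a Matrix.vec)"
      have "vec_index (?C *\<^sub>v v) i = (\<Sum>j<N. poly (char_poly_matrix B $$ (i, j)) x * ms j)"
        using i by (simp add: v_def scalar_prod_def dims atLeast0LessThan)
      also have "\<dots> = (\<Sum>j<N. ((if i = j then x else 0) - A i j) * ms j)"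
        using i by (intro sum.cong refl) (simp add: cpn)
      also have "\<dots> = (\<Sum>j<N. (if i = j then x * ms j else 0)) - (\<Sum>j<N. A i j * ms j)"
        by (simp add: left_diff_distrib sum_subtractf if_distrib[of "\<lambda>q. q * _"] cong: if_cong)
      also have "\<dots> = 0" using i x[of i] by simp
      finally show "vec_index (?C *\<^sub>v v) i = vec_index (0\<^sub>v N) i" using i by simp
    qed (simp add: dims)
    moreover have "adj_mat ?C *\<^sub>v 0\<^sub>v N = 0\<^sub>v N"
      by (rule eq_vecI) (use adj_mat(1)[OF C] in \<open>auto simp: scalar_prod_def\<close>)
    ultimately have "adj_mat ?C *\<^sub>v (?C *\<^sub>v v) = 0\<^sub>v N" by simp
    then have "(adj_mat ?C * ?C) *\<^sub>v v = 0\<^sub>v N"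
      using assoc_mult_mat_vec[OF adj_mat(1)[OF C] C v] by simp
    then have "(poly p x \<cdot>\<^sub>m 1\<^sub>m N) *\<^sub>v v = 0\<^sub>v N"
      by (simp only: adj_mat(3)[OF C] detC)
    then have "vec_index ((poly p x \<cdot>\<^sub>m 1\<^sub>m N) *\<^sub>v v) m = 0" using one by simp
    moreover have "vec_index ((poly p x \<cdot>\<^sub>m 1\<^sub>m N) *\<^sub>v v) m = poly p x * ms m"
      using one(1) by (simp add: v_def)
    ultimately show ?thesis using one by simp
  qed
  ultimately show ?thesis using that by blast
qed


section \<open>The Rees algebra and integral equations for saturated exponents\<close>

lemma sumset_pow_add:
  fixes E :: "'e::comm_monoid_add set"
  assumes "up_closed E"
  shows "sumset_pow E (m + n) = {a + b |a b. a \<in> sumset_pow E m \<and> b \<in> sumset_pow E n}"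
proof (induction n)
  case 0
  have "a = a + 0" for a :: 'e by simp
  then show ?case using up_closedD[OF up_closed_sumset_pow[OF assms, of m]] by fastforce
next
  case (Suc n)
  have "sumset_pow E (m + Suc n) = {a + b + e |a b e. a \<in> sumset_pow E m \<and> b \<in> sumset_pow E n \<and> e \<in> E}"
    using Suc by auto
  also have "\<dots> = {a + b |a b. a \<in> sumset_pow E m \<and> b \<in> sumset_pow E (Suc n)}"
    by (force simp: add.assoc)
  finally show ?case .
qed

lemma sumset_pow_mult:
  fixes E :: "'e::comm_monoid_add set"
  assumes "up_closed E"
  shows "sumset_pow (sumset_pow E n) i = sumset_pow E (n * i)"
  by (induction i) (simp_all add: sumset_pow_add[OF assms, of "n * _" n, simplified add.commute] add.commute)

lemma exp_mult_mem_sumset_pow: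
  assumes "up_closed E" "a \<in> sumset_pow E n"
  shows "exp_mult k a \<in> sumset_pow E (k * n)"
proof (induction k)
  case (Suc k)
  have "a + exp_mult k a \<in> {a + b |a b. a \<in> sumset_pow E n \<and> b \<in> sumset_pow E (k * n)}"
    using assms(2) Suc by blast
  then show ?case by (simp add: exp_mult_Suc sumset_pow_add[OF assms(1)])
qed simp

text \<open>The Rees algebra inside the polynomials in one further variable \<open>t\<close> over
  the polynomial ring: the coefficient of \<open>t^i\<close> lies in the \<open>i\<close>-th power
  of the ideal.\<close>

definition rees_ring :: "'v exps set \<Rightarrow> ('v::finite, 'k::field) mpoly poly set"
  where "rees_ring E = {q. \<forall>i. coeff q i \<in> poly_supp (sumset_pow E i)}"

lemma poly_supp_sumset_mult:
  fixes p q :: "('v::finite, 'k::field) mpoly"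
  assumes "up_closed E" "p \<in> poly_supp (sumset_pow E m)" "q \<in> poly_supp (sumset_pow E n)"
  shows "p * q \<in> poly_supp (sumset_pow E (m + n))"
  using assms(2,3) keys_mult[of p q] unfolding poly_supp_def sumset_pow_add[OF assms(1)] by blast

lemma subring_set_rees_ring:
  assumes "up_closed E"
  shows "subring_set (rees_ring E :: ('v::finite, 'k::field) mpoly poly set)"
  unfolding subring_set_def
proof (intro conjI ballI)
  note id = ideal_poly_supp[OF up_closed_sumset_pow[OF assms]]
  show "1 \<in> (rees_ring E :: ('v, 'k) mpoly poly set)"
    by (simp add: rees_ring_def Polynomial.coeff_1) (simp add: poly_supp_def)
  fix p q :: "('v, 'k) mpoly poly"
  assume pq: "p \<in> rees_ring E" "q \<in> rees_ring E"
  then show "p + q \<in> rees_ring E" "- p \<in> rees_ring E"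
    by (auto simp: rees_ring_def intro!: ideal_type_ringD(2,5)[OF id])
  have "coeff p i * coeff q (n - i) \<in> poly_supp (sumset_pow E n)" if "i \<le> n" for i n
    using poly_supp_sumset_mult[OF assms, of "coeff p i" i "coeff q (n - i)" "n - i"] pq that
    by (simp add: rees_ring_def)
  then show "p * q \<in> rees_ring E"
    by (auto simp: rees_ring_def coeff_mult intro!: ideal_sum[OF id])
qed

text \<open>All terms of \<open>p\<close> are treated at once. For a common \<open>i\<close>, the
  \<open>i\<close>-th power of each monomial of \<open>p\<close> times \<open>t\<close> lies in the
  Rees algebra, so the products of these with all exponents below \<open>i\<close> span a module
  stable under \<open>p t\<close>. The determinant trick yields a monic equation of
  \<open>p t\<close>, and its part of top degree in \<open>t\<close> is an integral equation for
  \<open>p\<close>.\<close>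

lemma integral_over_monomial_ideal:
  fixes p :: "('v::finite, 'k::field) mpoly"
  assumes E: "up_closed E" and p: "p \<in> poly_supp (power_saturation E 1)"
  shows "p \<in> integral_closure type_ring (poly_supp E)"
proof -
  define K where "K = keys p"
  have finK: "finite K" by (simp add: K_def)
  have "\<forall>a\<in>K. \<exists>i\<ge>1. exp_mult i a \<in> sumset_pow E i"
    using p by (auto simp: poly_supp_def power_saturation_def K_def)
  then obtain ia where ia: "\<And>a. a \<in> K \<Longrightarrow> ia a \<ge> 1 \<and> exp_mult (ia a) a \<in> sumset_pow E (ia a)" by metis
  define i where "i = (\<Prod>a\<in>K. ia a)"
  have i: "i \<ge> 1" unfolding i_def using ia by (intro prod_ge_1) auto
  have Ki: "exp_mult i a \<in> sumset_pow E i" if a: "a \<in> K" for a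
  proof -
    have *: "i = (\<Prod>b\<in>K - {a}. ia b) * ia a" using finK a by (simp add: i_def prod.remove mult.commute)
    have "exp_mult (k * l) a = exp_mult k (exp_mult l a)" for k l
      by (rule poly_mapping_eqI) simp
    then show ?thesis
      unfolding * using exp_mult_mem_sumset_pow[OF E] ia[OF a] by simp
  qed
  define Xs where "Xs = PiE K (\<lambda>_. {..<i})"
  have finXs: "finite Xs" using finK by (simp add: Xs_def finite_PiE)
  define mon where "mon e = Polynomial.monom (single (\<Sum>a\<in>K. exp_mult (e a) a) (1::'k)) (\<Sum>a\<in>K. e a)"
    for e :: "'v exps \<Rightarrow> nat"
  define x where "x = Polynomial.monom p 1"
  \<comment> \<open>Multiplying by the monomial of \<open>a\<close> times \<open>t\<close> raises
    the exponent of \<open>a\<close>, or resets it to 0 at the price of the coefficient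
    \<open>cf a e\<close> in the Rees algebra.\<close>
  define nxt where "nxt a e = e(a := if Suc (e a) < i then Suc (e a) else 0)" for a and e :: "'v exps \<Rightarrow> nat"
  define cf where "cf a e = (if Suc (e a) < i then Polynomial.monom (single 0 (lookup p a)) 0
    else Polynomial.monom (single (exp_mult i a) (lookup p a)) i)" for a and e :: "'v exps \<Rightarrow> nat"
  \<comment> \<open>A sum, as different \<open>a\<close> may lead to the same \<open>e'\<close>, for
    instance when \<open>i = 1\<close>.\<close>
  define A where "A e e' = (\<Sum>a\<in>K. if e' = nxt a e then cf a e else 0)" for e e'
  have nxtXs: "nxt a e \<in> Xs" if "e \<in> Xs" "a \<in> K" for a e
    using that i by (auto simp: Xs_def nxt_def PiE_def extensional_def Pi_def)
  have step: "Polynomial.monom (single a (lookup p a)) 1 * mon e = cf a e * mon (nxt a e)"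
    if e: "e \<in> Xs" and a: "a \<in> K" for a e
  proof -
    have sum: "(\<Sum>b\<in>K. exp_mult (f b) b) = exp_mult (f a) a + (\<Sum>b\<in>K - {a}. exp_mult (f b) b)"
      "(\<Sum>b\<in>K. f b) = f a + (\<Sum>b\<in>K - {a}. f b)" for f
      using finK a by (simp_all add: sum.remove)
    have rest: "(\<Sum>b\<in>K - {a}. exp_mult (nxt a e b) b) = (\<Sum>b\<in>K - {a}. exp_mult (e b) b)"
      "(\<Sum>b\<in>K - {a}. nxt a e b) = (\<Sum>b\<in>K - {a}. e b)"
      by (auto intro!: sum.cong simp: nxt_def)
    have ea: "e a < i" using e a by (auto simp: Xs_def)
    show ?thesis
    proof (cases "Suc (e a) < i")
      case True
      then show ?thesis unfolding mon_def sum[of e] sum[of "nxt a e"] rest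
        by (simp add: cf_def nxt_def mult_monom mult_single exp_mult_Suc add_ac)
    next
      case False
      then have "i = Suc (e a)" using ea by simp
      with False show ?thesis unfolding mon_def sum[of e] sum[of "nxt a e"] rest
        by (simp add: cf_def nxt_def mult_monom mult_single exp_mult_Suc add_ac)
    qed
  qed
  have xmon: "x * mon e = (\<Sum>e'\<in>Xs. A e e' * mon e')" if e: "e \<in> Xs" for e
  proof -
    have "x = (\<Sum>a\<in>K. Polynomial.monom (single a (lookup p a)) 1)"
      unfolding x_def K_def by (subst poly_mapping_sum_single[of p]) (simp add: monom_sum)
    then have "x * mon e = (\<Sum>a\<in>K. cf a e * mon (nxt a e))"
      using step[OF e] by (simp add: sum_distrib_right)
    also have "\<dots> = (\<Sum>a\<in>K. \<Sum>e'\<in>Xs. (if e' = nxt a e then cf a e else 0) * mon e')"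
      using finXs nxtXs[OF e] by (intro sum.cong refl) (simp add: if_distrib[of "\<lambda>y. y * _"] cong: if_cong)
    also have "\<dots> = (\<Sum>e'\<in>Xs. A e e' * mon e')"
      unfolding A_def by (subst sum.swap) (simp add: sum_distrib_right)
    finally show ?thesis .
  qed
  note S = subring_set_rees_ring[OF E, where 'k = 'k]
  have cfS: "cf a e \<in> rees_ring E" if "a \<in> K" for a e
    using Ki[OF that] by (auto simp: cf_def rees_ring_def Polynomial.coeff_monom)
  then have AS: "A e e' \<in> rees_ring E" for e e'
    unfolding A_def using subring_setD(2)[OF S] by (intro subring_set_sum[OF S]) auto
  define N where "N = card Xs"
  obtain h where h: "bij_betw h {..<N} Xs"
    using ex_bij_betw_nat_finite[OF finXs] by (auto simp: N_def atLeast0LessThan)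
  define z where "z = (\<lambda>a\<in>K. 0::nat)"
  have "z \<in> Xs" using i by (auto simp: z_def Xs_def)
  then obtain m where m: "m < N" "h m = z" using h by (auto simp: bij_betw_def)
  have "mon z = 1" by (simp add: mon_def z_def)
  then have one: "mon (h m) = 1" by (simp add: m)
  obtain P where P: "\<And>j. coeff P j \<in> rees_ring E" "coeff P N = 1"
    "Polynomial.degree P = N" "poly P x = 0"
  proof (rule monic_poly_of_finite_span[OF S m(1), of "\<lambda>j. mon (h j)" "\<lambda>j l. A (h j) (h l)" x])
    fix j assume "j < N"
    then have "h j \<in> Xs" using h by (auto simp: bij_betw_def)
    then show "x * mon (h j) = (\<Sum>l<N. A (h j) (h l) * mon (h l))"
      using xmon sum.reindex_bij_betw[OF h, of "\<lambda>e'. A (h j) e' * mon e'"] by simp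
  qed (use one AS in auto)
  have xpow: "x ^ j = Polynomial.monom (p ^ j) j" for j
    by (simp add: x_def monom_power)
  have cm: "coeff (q * Polynomial.monom r j) N = r * coeff q (N - j)" if "j \<le> N"
    for q :: "('v, 'k) mpoly poly" and r j
    by (subst mult.commute) (use that in \<open>simp add: coeff_monom_mult\<close>)
  \<comment> \<open>Only the coefficient of \<open>t^N\<close> is kept: it pairs
    \<open>p ^ j\<close> with the coefficient of \<open>t^(N - j)\<close> of an element of the Rees
    algebra, which lies in the right power of the ideal.\<close>
  have "0 = coeff (poly P x) N" using P(4) by simp
  also have "\<dots> = (\<Sum>j\<le>N. coeff (coeff P j * Polynomial.monom (p ^ j) j) N)"
    by (simp add: poly_altdef P(3) xpow Polynomial.coeff_sum)
  also have "\<dots> = (\<Sum>j\<le>N. coeff (coeff P j) (N - j) * p ^ j)"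
    by (intro sum.cong refl) (subst cm, simp, rule mult.commute)
  also have "\<dots> = p ^ N + (\<Sum>j<N. coeff (coeff P j) (N - j) * p ^ j)"
    by (simp add: P(2) flip: lessThan_Suc_atMost)
  also have "(\<Sum>j<N. coeff (coeff P j) (N - j) * p ^ j) =
    (\<Sum>j\<in>{1..N}. coeff (coeff P (N - j)) j * p ^ (N - j))"
    by (rule sum.reindex_bij_witness[of _ "\<lambda>j. N - j" "\<lambda>j. N - j"]) auto
  finally have "p ^ N + (\<Sum>j\<in>{1..N}. coeff (coeff P (N - j)) j * p ^ (N - j)) = 0"
    by simp
  moreover have "coeff (coeff P (N - j)) j \<in> poly_supp (sumset_pow E j)" for j
    using P(1)[of "N - j"] by (simp add: rees_ring_def)
  ultimately have *: "(\<forall>j\<in>{1..N}. coeff (coeff P (N - j)) j \<in> ideal_pow type_ring (poly_supp E) j) \<and>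
      p [^]\<^bsub>type_ring\<^esub> N \<oplus>\<^bsub>type_ring\<^esub>
        (\<Oplus>\<^bsub>type_ring\<^esub>j\<in>{1..N}. coeff (coeff P (N - j)) j \<otimes>\<^bsub>type_ring\<^esub> p [^]\<^bsub>type_ring\<^esub> (N - j))
      = \<zero>\<^bsub>type_ring\<^esub>"
    by (simp add: ideal_pow_poly_supp[OF E])
  have "N \<ge> 1" using m(1) by simp
  show ?thesis
    unfolding integral_closure_def
    by (intro CollectI conjI exI[of _ N] exI[of _ "\<lambda>j. coeff (coeff P (N - j)) j"])
      (use * \<open>N \<ge> 1\<close> in auto)
qed


section \<open>Exponents that survive in powers, and the integral closure\<close>

lemma mem_poly_supp_iff: "p \<in> poly_supp A \<longleftrightarrow> keys p \<subseteq> A"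
  by (simp add: poly_supp_def)

definition exp_inner :: "('v::finite) exps \<Rightarrow> 'v exps \<Rightarrow> nat"
  where "exp_inner a b = (\<Sum>v\<in>UNIV. lookup a v * lookup b v)"

lemma exp_inner_add_right: "exp_inner a (b + c) = exp_inner a b + exp_inner a c"
  by (simp add: exp_inner_def lookup_add distrib_left sum.distrib)

lemma exp_inner_le_norm:
  assumes "exponent_norm b \<le> exponent_norm a"
  shows "exp_inner a b \<le> exp_inner a a" "exp_inner a b = exp_inner a a \<Longrightarrow> b = a"
proof -
  have dist: "(\<Sum>v\<in>UNIV. (int (lookup a v) - int (lookup b v))\<^sup>2) =
    int (exponent_norm a) + int (exponent_norm b) - 2 * int (exp_inner a b)"
    by (simp add: exponent_norm_def exp_inner_def power2_diff sum.distrib sum_subtractf sum_distrib_left mult_ac)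
  have nonneg: "(\<Sum>v\<in>UNIV. (int (lookup a v) - int (lookup b v))\<^sup>2) \<ge> 0" by (rule sum_nonneg) simp
  have norm: "exp_inner a a = exponent_norm a"
    by (simp add: exponent_norm_def exp_inner_def power2_eq_square)
  show "exp_inner a b \<le> exp_inner a a" using dist nonneg norm assms by linarith
  assume "exp_inner a b = exp_inner a a"
  with dist nonneg norm assms have "(\<Sum>v\<in>UNIV. (int (lookup a v) - int (lookup b v))\<^sup>2) = 0" by linarith
  then have "(int (lookup a v) - int (lookup b v))\<^sup>2 = 0" for v
    by (subst (asm) sum_nonneg_eq_0_iff) auto
  then show "b = a" by (intro poly_mapping_eqI) simp
qed

text \<open>Among the exponents of \<open>p\<close> of minimal weight, one of maximal norm is a vertex, so that its
  multiples do not cancel in the powers of \<open>p\<close>.\<close>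

lemma lookup_power_vertex:
  fixes p :: "('v::finite, 'k::field) mpoly" and w :: "'v exps \<Rightarrow> 'a::linordered_field"
  assumes w: "\<And>a b. w (a + b) = w a + w b" and \<beta>: "\<beta> \<in> keys p"
    and wmin: "\<And>a. a \<in> keys p \<Longrightarrow> w \<beta> \<le> w a"
    and nmax: "\<And>a. a \<in> keys p \<Longrightarrow> w a = w \<beta> \<Longrightarrow> exponent_norm a \<le> exponent_norm \<beta>"
  shows "lookup (p ^ N) (exp_mult N \<beta>) = lookup p \<beta> ^ N" "z \<in> keys (p ^ N) \<Longrightarrow> of_nat N * w \<beta> \<le> w z"
proof -
  have w0: "w 0 = 0" using w[of 0 0] by simp
  have wN: "w (exp_mult N \<beta>) = of_nat N * w \<beta>" for N
    by (induction N) (simp_all add: w0 exp_mult_Suc w distrib_right)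
  have gN: "exp_inner \<beta> (exp_mult N \<beta>) = N * exp_inner \<beta> \<beta>" for N
    by (simp add: exp_inner_def sum_distrib_left mult_ac)
  \<comment> \<open>The induction also needs that, among the terms of least weight in
    \<open>p ^ N\<close>, \<open>exp_inner \<beta>\<close> is maximal only at the
    \<open>N\<close>-th multiple of \<beta>.\<close>
  have "lookup (p ^ N) (exp_mult N \<beta>) = lookup p \<beta> ^ N \<and> (\<forall>z\<in>keys (p ^ N). of_nat N * w \<beta> \<le> w z \<and>
    (w z = of_nat N * w \<beta> \<longrightarrow> exp_inner \<beta> z \<le> N * exp_inner \<beta> \<beta> \<and>
      (exp_inner \<beta> z = N * exp_inner \<beta> \<beta> \<longrightarrow> z = exp_mult N \<beta>)))"
  proof (induction N)
    case 0
    then show ?case by (auto simp: w0 exp_inner_def)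
  next
    case (Suc N)
    have key: "of_nat (Suc N) * w \<beta> \<le> w (a + b) \<and>
      (w (a + b) = of_nat (Suc N) * w \<beta> \<longrightarrow> exp_inner \<beta> (a + b) \<le> Suc N * exp_inner \<beta> \<beta> \<and>
      (exp_inner \<beta> (a + b) = Suc N * exp_inner \<beta> \<beta> \<longrightarrow> a = \<beta> \<and> b = exp_mult N \<beta>))"
      if a: "a \<in> keys p" and b: "b \<in> keys (p ^ N)" for a b
    proof -
      have 1: "w \<beta> \<le> w a" "of_nat N * w \<beta> \<le> w b" using wmin[OF a] Suc b by auto
      then have "of_nat (Suc N) * w \<beta> \<le> w (a + b)" by (simp add: w distrib_right)
      moreover have "exp_inner \<beta> (a + b) \<le> Suc N * exp_inner \<beta> \<beta> \<and>
        (exp_inner \<beta> (a + b) = Suc N * exp_inner \<beta> \<beta> \<longrightarrow> a = \<beta> \<and> b = exp_mult N \<beta>)"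
        if eq: "w (a + b) = of_nat (Suc N) * w \<beta>"
      proof -
        have 2: "w a = w \<beta>" "w b = of_nat N * w \<beta>" using 1 eq by (simp_all add: w distrib_right)
        then have "exp_inner \<beta> b \<le> N * exp_inner \<beta> \<beta>"
          "exp_inner \<beta> b = N * exp_inner \<beta> \<beta> \<longrightarrow> b = exp_mult N \<beta>" using Suc b by auto
        moreover have "exp_inner \<beta> a \<le> exp_inner \<beta> \<beta>" "exp_inner \<beta> a = exp_inner \<beta> \<beta> \<longrightarrow> a = \<beta>"
          using exp_inner_le_norm[OF nmax[OF a 2(1)]] by auto
        ultimately show ?thesis by (auto simp: exp_inner_add_right)
      qed
      ultimately show ?thesis by blast
    qed
    have "lookup (p ^ Suc N) (exp_mult (Suc N) \<beta>) = lookup p \<beta> * lookup (p ^ N) (exp_mult N \<beta>)"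
      unfolding power_Suc exp_mult_Suc
    proof (rule lookup_mult_unique)
      fix a b assume ab: "a \<in> keys p" "b \<in> keys (p ^ N)" "a + b = \<beta> + exp_mult N \<beta>"
      have "w (a + b) = of_nat (Suc N) * w \<beta>" using ab(3) by (simp add: w wN distrib_right)
      moreover have "exp_inner \<beta> (a + b) = Suc N * exp_inner \<beta> \<beta>"
        using ab(3) by (simp add: exp_inner_add_right gN)
      ultimately show "a = \<beta> \<and> b = exp_mult N \<beta>" using key[OF ab(1,2)] by blast
    qed
    moreover have "of_nat (Suc N) * w \<beta> \<le> w z \<and>
      (w z = of_nat (Suc N) * w \<beta> \<longrightarrow> exp_inner \<beta> z \<le> Suc N * exp_inner \<beta> \<beta> \<and>
      (exp_inner \<beta> z = Suc N * exp_inner \<beta> \<beta> \<longrightarrow> z = exp_mult (Suc N) \<beta>))" if z: "z \<in> keys (p ^ Suc N)" for z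
    proof -
      obtain a b where "a \<in> keys p" "b \<in> keys (p ^ N)" "z = a + b"
        using keys_mult_mem[of z p "p ^ N"] z unfolding power_Suc by metis
      with key[of a b] show ?thesis by (simp add: exp_mult_Suc)
    qed
    ultimately show ?case using Suc by simp
  qed
  then show "lookup (p ^ N) (exp_mult N \<beta>) = lookup p \<beta> ^ N" "z \<in> keys (p ^ N) \<Longrightarrow> of_nat N * w \<beta> \<le> w z"
    by auto
qed

text \<open>For the inclusion from left to right, a functional separating an exponent of
  \<open>p\<close> from the cone serves as weight. At \<open>N\<close> times a vertex of least
  weight, \<open>p ^ N\<close> has a nonzero coefficient that no other summand of the integral
  equation can cancel.\<close>

lemma integral_closure_ideal_pow:
  fixes G :: "('v::finite) exps set"
  assumes G: "finite G"
  shows "integral_closure type_ring (ideal_pow type_ring (poly_supp (up_hull G) :: ('v, 'k::field) mpoly set) n) =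
    poly_supp (power_saturation (up_hull G) n)"
proof (intro subset_antisym subsetI)
  note up = up_closed_up_hull[of G]
  have E: "up_closed (sumset_pow (up_hull G) n)" by (rule up_closed_sumset_pow[OF up])
  have sat: "power_saturation (sumset_pow (up_hull G) n) 1 = power_saturation (up_hull G) n"
    by (simp add: power_saturation_def sumset_pow_mult[OF up])
  {
    fix p :: "('v, 'k) mpoly" assume "p \<in> poly_supp (power_saturation (up_hull G) n)"
    then show "p \<in> integral_closure type_ring (ideal_pow type_ring (poly_supp (up_hull G)) n)"
      using integral_over_monomial_ideal[OF E, of p] by (simp add: sat[simplified] ideal_pow_poly_supp[OF up])
  next
    fix p :: "('v, 'k) mpoly" assume "p \<in> integral_closure type_ring (ideal_pow type_ring (poly_supp (up_hull G)) n)"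
    then obtain N a where N: "N \<ge> 1" and aJ: "\<forall>i\<in>{1..N}. keys (a i) \<subseteq> sumset_pow (up_hull G) (n * i)"
      and eq: "p ^ N + (\<Sum>i\<in>{1..N}. a i * p ^ (N - i)) = 0"
      by (auto simp: integral_closure_def ideal_pow_poly_supp[OF up] ideal_pow_poly_supp[OF E]
          sumset_pow_mult[OF up] mem_poly_supp_iff)
    show "p \<in> poly_supp (power_saturation (up_hull G) n)"
    proof (rule ccontr)
      assume "p \<notin> poly_supp (power_saturation (up_hull G) n)"
      then obtain \<alpha> where \<alpha>: "\<alpha> \<in> keys p" "\<alpha> \<notin> power_saturation (up_hull G) n" by (auto simp: poly_supp_def)
      then obtain c where c: "\<forall>x\<in>cone_gens G. dotp c x \<ge> 0" "dotp c (evec \<alpha> n) < 0"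
        unfolding power_saturation_iff_dotp[OF G] by force
      define w where "w x = dotp c (evec x 0)" for x
      have w: "w (x + y) = w x + w y" for x y
        using evec_add[of x y 0 0] by (simp add: w_def dotp_add_right)
      have we: "dotp c (evec x m) = w x + c $ None * of_nat m" for x m by (simp add: w_def dotp_evec)
      define \<mu> where "\<mu> = Min (w ` keys p)"
      have \<mu>le: "\<mu> \<le> w x" if "x \<in> keys p" for x using that by (simp add: \<mu>_def)
      have "\<mu> \<in> w ` keys p" unfolding \<mu>_def using \<alpha>(1) by (intro Min_in) auto
      then have ne: "{x\<in>keys p. w x = \<mu>} \<noteq> {}" by auto
      define nm where "nm = Max (exponent_norm ` {x\<in>keys p. w x = \<mu>})"
      have "nm \<in> exponent_norm ` {x\<in>keys p. w x = \<mu>}" unfolding nm_def using ne by (intro Max_in) auto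
      then obtain \<beta> where \<beta>: "\<beta> \<in> keys p" "w \<beta> = \<mu>" "exponent_norm \<beta> = nm" by auto
      have nmle: "exponent_norm x \<le> exponent_norm \<beta>" if "x \<in> keys p" "w x = w \<beta>" for x
        unfolding \<beta>(3) nm_def using that \<beta>(2) by (intro Max_ge) auto
      have wmin: "w \<beta> \<le> w x" if "x \<in> keys p" for x using \<mu>le[OF that] \<beta>(2) by simp
      have vert1: "lookup (p ^ M) (exp_mult M \<beta>) = lookup p \<beta> ^ M" for M
        by (rule lookup_power_vertex(1)[of w]) (use w \<beta>(1) wmin nmle in auto)
      have vert2: "of_nat M * w \<beta> \<le> w z" if "z \<in> keys (p ^ M)" for z M
        by (rule lookup_power_vertex(2)[of w \<beta> p z M]) (use w \<beta>(1) wmin nmle that in auto)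
      have w0: "w 0 = 0" using w[of 0 0] by simp
      have wN: "w (exp_mult N \<beta>) = of_nat N * w \<beta>" for N
        by (induction N) (simp_all add: w0 exp_mult_Suc w distrib_right)
      \<comment> \<open>A term of \<open>a i\<close> weighs at least
        \<open>- c $ None * of_nat (n * i)\<close>, which is more than
        \<open>of_nat i * w \<beta>\<close>; so every term of this product is heavier than
        \<open>N\<close> times \<beta>.\<close>
      have "lookup (a i * p ^ (N - i)) (exp_mult N \<beta>) = 0" if i: "i \<in> {1..N}" for i
      proof (rule ccontr)
        assume "lookup (a i * p ^ (N - i)) (exp_mult N \<beta>) \<noteq> 0"
        then have "exp_mult N \<beta> \<in> keys (a i * p ^ (N - i))" by (simp add: in_keys_iff)
        then obtain y z where yz: "y \<in> keys (a i)" "z \<in> keys (p ^ (N - i))" "exp_mult N \<beta> = y + z"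
          using keys_mult_mem by metis
        have "y \<in> sumset_pow (up_hull G) (n * i)" using aJ i yz(1) by blast
        then obtain ms where ms: "set ms \<subseteq> cone_gens G" "sum_list ms = evec y (n * i)"
          unfolding sumset_pow_iff_sum_list by blast
        have "0 \<le> sum_list (map (dotp c) ms)" using ms(1) c(1) by (intro sum_list_nonneg) auto
        then have "0 \<le> w y + c $ None * of_nat (n * i)" using dotp_sum_list[of c ms] by (simp add: ms(2) we)
        moreover have "of_nat (N - i) * w \<beta> \<le> w z" by (rule vert2[OF yz(2)])
        moreover have "of_nat N * w \<beta> = w y + w z" using wN[of N] yz(3) w by simp
        moreover have "of_nat (N - i) = (of_nat N - of_nat i :: rat)" using i by (simp add: of_nat_diff)
        ultimately have "0 \<le> of_nat i * (w \<beta> + c $ None * of_nat n)" by (simp add: algebra_simps)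
        moreover have "w \<beta> + c $ None * of_nat n < 0" using wmin[OF \<alpha>(1)] c(2) by (simp add: we)
        ultimately show False using i by (simp add: zero_le_mult_iff)
      qed
      moreover have "lookup (p ^ N + (\<Sum>i\<in>{1..N}. a i * p ^ (N - i))) (exp_mult N \<beta>) = 0"
        unfolding eq by simp
      ultimately have "lookup (p ^ N) (exp_mult N \<beta>) = 0" by (simp add: lookup_add lookup_sum)
      then show False using vert1 \<beta>(1) by (simp add: in_keys_iff)
    qed
  }
qed

section \<open>Corners in at most two variables\<close>

lemma sumset_pow_weight:
  assumes "\<And>g. g \<in> G \<Longrightarrow> t \<le> exp_inner u g" "a \<in> sumset_pow (up_hull G) n"
  shows "n * t \<le> exp_inner u a"
  using assms(2)
proof (induction n arbitrary: a)
  case (Suc n)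
  then obtain b g c where *: "a = b + (g + c)" "b \<in> sumset_pow (up_hull G) n" "g \<in> G"
    by (auto simp: up_hull_def)
  with Suc.IH[of b] assms(1)[of g] show ?case by (simp add: exp_inner_add_right)
qed simp

lemma power_saturation_weight:
  assumes "\<And>g. g \<in> G \<Longrightarrow> t \<le> exp_inner u g" "a \<in> power_saturation (up_hull G) n"
  shows "n * t \<le> exp_inner u a"
proof -
  from assms(2) obtain i where i: "i \<ge> 1" "exp_mult i a \<in> sumset_pow (up_hull G) (n * i)"
    by (auto simp: power_saturation_def)
  have "i * (n * t) \<le> exp_inner u (exp_mult i a)"
    using sumset_pow_weight[OF assms(1) i(2)] by (simp add: mult_ac)
  also have "\<dots> = i * exp_inner u a" by (simp add: exp_inner_def sum_distrib_left mult_ac)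
  finally show ?thesis using i(1) by simp
qed

lemma exp_inner_single: "exp_inner (single v 1) a = lookup a v"
proof -
  have "exp_inner (single v 1) a = (\<Sum>w\<in>UNIV. if v = w then lookup a w else 0)"
    unfolding exp_inner_def by (intro sum.cong refl) (simp add: lookup_single when_def)
  then show ?thesis by simp
qed

lemma exp_inner_add_left: "exp_inner (a + b) c = exp_inner a c + exp_inner b c"
  by (simp add: exp_inner_def lookup_add distrib_right sum.distrib)

lemma exp_mult_mem_power_saturation:
  assumes "g \<in> G"
  shows "exp_mult n g \<in> power_saturation (up_hull G) n"
proof -
  have "g \<in> sumset_pow (up_hull G) 1"
    using up_hull_superset[OF assms] by simp (metis add.left_neutral)
  from exp_mult_mem_sumset_pow[OF up_closed_up_hull this, of n] show ?thesis
    unfolding power_saturation_def by (intro CollectI exI[of _ 1]) (simp add: exp_mult_1[simplified])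
qed

lemma power_saturation_empty:
  assumes "n \<ge> 1"
  shows "power_saturation {} n = {}"
proof -
  have "sumset_pow {} m = ({} :: ('a exps) set)" if "m \<ge> 1" for m using that by (cases m) auto
  with assms show ?thesis by (auto simp: power_saturation_def)
qed

text \<open>After the variables outside \<open>F\<close> are inverted, one looks for a corner of an
  up-closed set in at most two dimensions. In dimension two its staircase has an inner corner unless
  it is a single quadrant, and that alternative does not depend on the power.\<close>

lemma corner_low:
  fixes F :: "'v::finite set"
  assumes corner: "corner (power_saturation (up_hull G) n) F \<beta>" and F: "card F \<le> 2"
    and n: "n \<ge> 1" and n': "n' \<ge> 1"
  shows "\<exists>\<beta>. corner (power_saturation (up_hull G) n') F \<beta>"
proof (cases "G = {}")
  case True
  then have "up_hull G = {}" by (auto simp: up_hull_def)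
  with corner n n' show ?thesis by (auto simp: corner_def power_saturation_empty)
next
  case False
  let ?C = "power_saturation (up_hull G)"
  have upC: "up_closed (?C m)" for m by (rule up_closed_power_saturation[OF up_closed_up_hull])
  define off where "off \<gamma> \<longleftrightarrow> (\<forall>v\<in>F. lookup \<gamma> v = 0)" for \<gamma> :: "'v exps"
  have off_add: "off (\<gamma> + \<delta>) \<longleftrightarrow> off \<gamma> \<and> off \<delta>" for \<gamma> \<delta> by (auto simp: off_def lookup_add)
  \<comment> \<open>Membership after inverting the variables outside \<open>F\<close>; by
    \<open>P_mono\<close> it depends only on the coordinates in \<open>F\<close>.\<close>
  define P where "P m x \<longleftrightarrow> (\<exists>\<gamma>. off \<gamma> \<and> x + \<gamma> \<in> ?C m)" for m x
  have P_mono: "P m y" if "P m x" "\<And>v. v \<in> F \<Longrightarrow> lookup x v \<le> lookup y v" for m x y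
  proof -
    from that(1) obtain \<gamma> where \<gamma>: "off \<gamma>" "x + \<gamma> \<in> ?C m" by (auto simp: P_def)
    define \<delta> where "\<delta> = Abs_poly_mapping (\<lambda>v. if v \<in> F then 0 else lookup x v)"
    define \<epsilon> where "\<epsilon> = Abs_poly_mapping (\<lambda>v. if v \<in> F then lookup y v - lookup x v else lookup y v)"
    have "y + (\<gamma> + \<delta>) = x + \<gamma> + \<epsilon>"
      using that(2) by (intro poly_mapping_eqI) (auto simp: lookup_add \<delta>_def \<epsilon>_def)
    then have "y + (\<gamma> + \<delta>) \<in> ?C m" using up_closedD[OF upC \<gamma>(2), of \<epsilon>] by simp
    moreover have "off (\<gamma> + \<delta>)" using \<gamma>(1) by (simp add: off_add) (simp add: off_def \<delta>_def)
    ultimately show ?thesis by (auto simp: P_def)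
  qed
  have P_gen: "P m (exp_mult m g)" if "g \<in> G" for m g
    using exp_mult_mem_power_saturation[OF that, of m]
    unfolding P_def by (intro exI[of _ 0]) (simp add: off_def)
  have P_le: "P m x" if "g \<in> G" "\<And>v. v \<in> F \<Longrightarrow> m * lookup g v \<le> lookup x v" for m g x
    by (rule P_mono[OF P_gen[OF that(1)]]) (use that(2) in simp)
  have P_weight: "m * t \<le> exp_inner u x"
    if "P m x" "\<And>g. g \<in> G \<Longrightarrow> t \<le> exp_inner u g" "\<And>v. v \<notin> F \<Longrightarrow> lookup u v = 0" for m t u x
  proof -
    from that(1) obtain \<gamma> where \<gamma>: "off \<gamma>" "x + \<gamma> \<in> ?C m" by (auto simp: P_def)
    have "lookup u v * lookup \<gamma> v = 0" for v using \<gamma>(1) that(3) by (cases "v \<in> F") (auto simp: off_def)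
    then have "exp_inner u \<gamma> = 0" by (simp add: exp_inner_def)
    with power_saturation_weight[OF that(2) \<gamma>(2)] show ?thesis by (simp add: exp_inner_add_right)
  qed
  \<comment> \<open>The supplements needed for the different \<open>v\<close> are added up, so that
    one exponent serves all of \<open>F\<close>.\<close>
  have cornerI: "\<exists>\<beta>. corner (?C m) F \<beta>"
    if "\<not> P m x" "\<And>v. v \<in> F \<Longrightarrow> P m (x + single v 1)" for m x
  proof -
    from that(2) have "\<forall>v\<in>F. \<exists>\<gamma>. off \<gamma> \<and> x + single v 1 + \<gamma> \<in> ?C m" by (auto simp: P_def)
    then obtain \<gamma> where \<gamma>: "\<And>v. v \<in> F \<Longrightarrow> off (\<gamma> v) \<and> x + single v 1 + \<gamma> v \<in> ?C m" by metis
    have off: "off (sum \<gamma> F)" using \<gamma> by (auto simp: off_def lookup_sum)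
    have "x + sum \<gamma> F + single v 1 \<in> ?C m" if v: "v \<in> F" for v
    proof -
      have "x + sum \<gamma> F + single v 1 = x + single v 1 + \<gamma> v + sum \<gamma> (F - {v})"
        using v by (simp add: sum.remove[of F v] add_ac)
      then show ?thesis using up_closedD[OF upC] \<gamma>[OF v] by simp
    qed
    moreover have "x + sum \<gamma> F + \<delta> \<notin> ?C m" if "off \<delta>" for \<delta>
      using \<open>\<not> P m x\<close> off that by (auto simp: P_def add.assoc off_add)
    ultimately show ?thesis unfolding corner_def off_def by blast
  qed
  have Pn: "\<not> P n \<beta>" "\<And>v. v \<in> F \<Longrightarrow> P n (\<beta> + single v 1)"
  proof -
    show "\<not> P n \<beta>" using corner by (auto simp: P_def corner_def off_def)
    show "P n (\<beta> + single v 1)" if "v \<in> F" for v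
      using corner that unfolding P_def by (intro exI[of _ 0]) (simp add: corner_def off_def)
  qed
  define \<mu> where "\<mu> v = (LEAST m. \<exists>g\<in>G. lookup g v = m)" for v
  have \<mu>ex: "\<exists>g\<in>G. lookup g v = \<mu> v" for v
    unfolding \<mu>_def by (rule LeastI_ex) (use False in blast)
  have \<mu>le: "\<mu> v \<le> lookup g v" if "g \<in> G" for g v
    unfolding \<mu>_def by (rule Least_le) (use that in blast)
  have P\<mu>: "m * \<mu> v \<le> lookup x v" if "P m x" "v \<in> F" for m x v
    using P_weight[OF that(1), of "\<mu> v" "single v 1"] that(2) \<mu>le
    by (simp add: exp_inner_single[simplified] lookup_single when_def) (metis (full_types) that(2))
  consider "F = {}" | p where "F = {p}" | p q where "p \<noteq> q" "F = {p, q}"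
  proof -
    have "card F = 0 \<or> card F = 1 \<or> card F = 2" using F by linarith
    then show ?thesis using that by (auto simp: card_1_singleton_iff card_2_iff)
  qed
  then show ?thesis
  proof cases
    case 1
    obtain g where "g \<in> G" using False by blast
    from P_le[OF this, of n \<beta>] Pn(1) 1 show ?thesis by simp
  next
    case (2 p)
    \<comment> \<open>With one variable the corner sits just below \<open>n' * \<mu> p\<close>; the
      given corner excludes \<open>\<mu> p = 0\<close>.\<close>
    obtain g where g: "g \<in> G" "lookup g p = \<mu> p" using \<mu>ex by blast
    have "\<mu> p \<noteq> 0"
    proof
      assume "\<mu> p = 0"
      then have "P n \<beta>" by (intro P_le[OF g(1)]) (use g(2) 2 in auto)
      with Pn(1) show False ..
    qed
    then have "n' * \<mu> p > 0" using n' by simp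
    then have "\<not> n' * \<mu> p \<le> lookup (single p (n' * \<mu> p - 1)) p"
      unfolding lookup_single_eq by linarith
    then have "\<not> P n' (single p (n' * \<mu> p - 1))" using P\<mu> 2 by blast
    moreover have "P n' (single p (n' * \<mu> p - 1) + single v 1)" if "v \<in> F" for v
      by (rule P_le[OF g(1)]) (use that 2 g(2) in \<open>auto simp: lookup_add\<close>)
    ultimately show ?thesis by (rule cornerI)
  next
    case (3 p q)
    define mk where "mk x y = single p x + single q y" for x y :: nat
    have mk: "lookup (mk x y) p = x" "lookup (mk x y) q = y" for x y
      using 3 by (auto simp: mk_def lookup_add lookup_single)
    \<comment> \<open>A generator attaining both minima would put \<beta> itself into the set,
      because the two neighbours of \<beta> already force the coordinates of \<beta> above
      \<open>n\<close> times the minima.\<close>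
    have nosimul: "\<mu> p + \<mu> q + 1 \<le> lookup g p + lookup g q" if g: "g \<in> G" for g
    proof (rule ccontr)
      assume "\<not> ?thesis"
      then have eq: "lookup g p = \<mu> p" "lookup g q = \<mu> q" using \<mu>le[OF g, of p] \<mu>le[OF g, of q] by auto
      have "n * \<mu> p \<le> lookup \<beta> p" using P\<mu>[OF Pn(2)[of q], of p] 3 by (auto simp: lookup_add lookup_single)
      moreover have "n * \<mu> q \<le> lookup \<beta> q" using P\<mu>[OF Pn(2)[of p], of q] 3 by (auto simp: lookup_add lookup_single)
      ultimately have "P n \<beta>" using 3 eq by (intro P_le[OF g]) auto
      with Pn(1) show False ..
    qed
    have Pmk: "P n' (mk x' y')" if "P n' (mk x y)" "x \<le> x'" "y \<le> y'" for x y x' y'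
      by (rule P_mono[OF that(1)]) (use 3 that mk in auto)
    have P0: "\<not> P n' (mk (n' * \<mu> p) (n' * \<mu> q))"
    proof
      assume P: "P n' (mk (n' * \<mu> p) (n' * \<mu> q))"
      let ?u = "single p 1 + single q 1 :: 'v exps"
      have u: "exp_inner ?u x = lookup x p + lookup x q" for x
        by (simp only: exp_inner_add_left exp_inner_single)
      have "n' * (\<mu> p + \<mu> q + 1) \<le> exp_inner ?u (mk (n' * \<mu> p) (n' * \<mu> q))"
      proof (rule P_weight[OF P])
        show "\<mu> p + \<mu> q + 1 \<le> exp_inner ?u g" if "g \<in> G" for g
          unfolding u by (rule nosimul[OF that])
        show "lookup ?u v = 0" if "v \<notin> F" for v
          using that 3 by (auto simp: lookup_add lookup_single when_def)
      qed
      then have "n' * (\<mu> p + \<mu> q + 1) \<le> n' * \<mu> p + n' * \<mu> q" unfolding u mk .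
      with n' show False by (simp add: algebra_simps)
    qed
    obtain g1 where g1: "g1 \<in> G" "lookup g1 p = \<mu> p" using \<mu>ex by blast
    obtain g2 where g2: "g2 \<in> G" "lookup g2 q = \<mu> q" using \<mu>ex by blast
    have ex1: "P n' (mk (n' * \<mu> p) (n' * lookup g1 q))"
      by (rule P_le[OF g1(1)]) (use 3 g1 mk in auto)
    \<comment> \<open>The first column that meets the set is entered at height \<open>y1\<close>,
      which is above the lowest row. One row below, the set starts only at some \<open>x1\<close>
      further right, and \<open>(x1 - 1, y1 - 1)\<close> is the inner corner.\<close>
    define y1 where "y1 = (LEAST y. P n' (mk (n' * \<mu> p) y))"
    have y1: "P n' (mk (n' * \<mu> p) y1)" unfolding y1_def by (rule LeastI) (rule ex1)
    have y1min: "\<not> P n' (mk (n' * \<mu> p) y)" if "y < y1" for y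
      using not_less_Least that unfolding y1_def by blast
    have "n' * \<mu> q \<le> y1" using P\<mu>[OF y1, of q] 3 mk by simp
    moreover have "y1 \<noteq> n' * \<mu> q" using P0 y1 by metis
    ultimately have y1gt: "n' * \<mu> q < y1" by simp
    have "P n' (mk (n' * lookup g2 p) (y1 - 1))"
      by (rule P_le[OF g2(1)]) (use 3 g2 mk y1gt in auto)
    define x1 where "x1 = (LEAST x. P n' (mk x (y1 - 1)))"
    have x1: "P n' (mk x1 (y1 - 1))" unfolding x1_def by (rule LeastI) fact
    have x1min: "\<not> P n' (mk x (y1 - 1))" if "x < x1" for x
      using not_less_Least that unfolding x1_def by blast
    have x1gt: "n' * \<mu> p < x1"
    proof (rule ccontr)
      assume "\<not> ?thesis"
      then have "P n' (mk (n' * \<mu> p) (y1 - 1))" by (intro Pmk[OF x1]) auto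
      with y1min y1gt show False by simp
    qed
    show ?thesis
    proof (rule cornerI)
      show "\<not> P n' (mk (x1 - 1) (y1 - 1))" using x1gt by (intro x1min) simp
      have p: "mk (x1 - 1) (y1 - 1) + single p 1 = mk x1 (y1 - 1)"
        using x1gt 3 by (intro poly_mapping_eqI) (auto simp: mk_def lookup_add lookup_single when_def)
      have q: "mk (x1 - 1) (y1 - 1) + single q 1 = mk (x1 - 1) y1"
        using y1gt 3 by (intro poly_mapping_eqI) (auto simp: mk_def lookup_add lookup_single when_def)
      have "P n' (mk (x1 - 1) y1)" using x1gt by (intro Pmk[OF y1]) auto
      then show "P n' (mk (x1 - 1) (y1 - 1) + single v 1)" if "v \<in> F" for v
        using that 3(2) x1 p q by auto
    qed
  qed
qed

section \<open>Minimal generators\<close>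

lemma incseq_subseq_nat:
  fixes s :: "nat \<Rightarrow> nat"
  shows "\<exists>r. strict_mono r \<and> incseq (s \<circ> r)"
proof -
  obtain r where r: "strict_mono r" "monoseq (\<lambda>n. s (r n))"
    using seq_monosub[of s] by blast
  show ?thesis
  proof (cases "incseq (\<lambda>n. s (r n))")
    case True
    with r show ?thesis by (auto simp: o_def)
  next
    case False
    then have dec: "decseq (\<lambda>n. s (r n))"
      using r(2) by (auto simp: monoseq_iff)
    define m where "m = (LEAST m. \<exists>n. s (r n) = m)"
    obtain N where N: "s (r N) = m" unfolding m_def using LeastI_ex[of "\<lambda>m. \<exists>n. s (r n) = m"] by blast
    have "m \<le> s (r n)" for n unfolding m_def by (rule Least_le) blast
    with dec N have "s (r (N + n)) = m" for n
      by (metis decseqD le_add1 le_antisym)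
    then have "incseq (s \<circ> (\<lambda>n. r (N + n)))" by (simp add: incseq_def)
    moreover have "strict_mono (\<lambda>n. r (N + n))" using r(1) by (simp add: strict_mono_def)
    ultimately show ?thesis by blast
  qed
qed

text \<open>Dickson's lemma for sequences; the subsequence is refined one variable at a
  time.\<close>

lemma incseq_subseq_exponents:
  fixes f :: "nat \<Rightarrow> 'v exps"
  assumes "finite V"
  shows "\<exists>r. strict_mono r \<and> (\<forall>v\<in>V. incseq (\<lambda>n. lookup (f (r n)) v))"
  using assms
proof induction
  case empty
  show ?case by (rule exI[of _ id]) (simp add: strict_mono_def)
next
  case (insert v V)
  then obtain r where r: "strict_mono r" "\<forall>v\<in>V. incseq (\<lambda>n. lookup (f (r n)) v)" by blast
  obtain r' where r': "strict_mono r'" "incseq ((\<lambda>n. lookup (f (r n)) v) \<circ> r')"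
    using incseq_subseq_nat by blast
  have "strict_mono (r \<circ> r')" using r(1) r'(1) by (simp add: strict_mono_o)
  moreover have "incseq (\<lambda>n. lookup (f ((r \<circ> r') n)) w)" if "w \<in> V" for w
    using r(2) that r'(1) by (auto simp: incseq_def strict_mono_less_eq)
  ultimately show ?case using r'(2) by (intro exI[of _ "r \<circ> r'"]) (auto simp: o_def)
qed

definition min_exps :: "'v exps set \<Rightarrow> 'v exps set"
  where "min_exps E = {g\<in>E. \<forall>h\<in>E. (\<forall>v. lookup h v \<le> lookup g v) \<longrightarrow> h = g}"

lemma finite_min_exps: "finite (min_exps E)" for E :: "('v::finite) exps set"
proof (rule ccontr)
  assume "infinite (min_exps E)"
  then obtain f :: "nat \<Rightarrow> 'v exps" where f: "inj f" "range f \<subseteq> min_exps E"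
    using infinite_countable_subset by blast
  obtain r where r: "strict_mono r" "\<forall>v\<in>UNIV. incseq (\<lambda>n. lookup (f (r n)) v)"
    using incseq_subseq_exponents[of UNIV f] by auto
  have "\<forall>v. lookup (f (r 0)) v \<le> lookup (f (r 1)) v"
    using r(2) by (auto simp: incseq_def)
  moreover have "f (r 0) \<in> min_exps E" "f (r 1) \<in> min_exps E" using f(2) by auto
  ultimately have "f (r 0) = f (r 1)" by (simp add: min_exps_def)
  then have "r 0 = r 1" using f(1) by (simp add: inj_eq)
  then show False using r(1) by (metis strict_mono_eq zero_neq_one)
qed

lemma up_hull_min_exps:
  fixes E :: "('v::finite) exps set"
  assumes "up_closed E"
  shows "up_hull (min_exps E) = E"
proof
  show "up_hull (min_exps E) \<subseteq> E"
    using assms by (auto simp: up_hull_def min_exps_def up_closed_def)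
  have "\<exists>g\<in>min_exps E. \<exists>c. a = g + c" if "a \<in> E" for a
    using that
  proof (induction "\<Sum>v\<in>UNIV. lookup a v" arbitrary: a rule: less_induct)
    case less
    show ?case
    proof (cases "a \<in> min_exps E")
      case True
      then show ?thesis by (intro bexI[of _ a] exI[of _ 0]) auto
    next
      case False
      with less.prems obtain h where h: "h \<in> E" "\<forall>v. lookup h v \<le> lookup a v" "h \<noteq> a"
        by (auto simp: min_exps_def)
      then obtain v where "lookup h v < lookup a v"
        by (metis le_neq_implies_less poly_mapping_eqI)
      then have "(\<Sum>v\<in>UNIV. lookup h v) < (\<Sum>v\<in>UNIV. lookup a v)"
        using h(2) by (intro sum_strict_mono_ex1) auto
      from less.hyps[OF this h(1)] obtain g c where g: "g \<in> min_exps E" "h = g + c" by blast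
      have "a = h + (a - h)" using h(2) by (intro poly_mapping_eqI) (simp add: lookup_add lookup_minus)
      then have "a = g + (c + (a - h))" using g(2) by (metis add.assoc)
      with g(1) show ?thesis by blast
    qed
  qed
  then show "E \<subseteq> up_hull (min_exps E)" by (auto simp: up_hull_def)
qed

lemma inj_monomial: "inj (monomial :: _ \<Rightarrow> ('v, 'k::field) mpoly)"
proof (rule injI)
  fix a b :: "'v exps"
  assume "(monomial a :: ('v, 'k) mpoly) = monomial b"
  then have "keys (monomial a :: ('v, 'k) mpoly) = keys (monomial b :: ('v, 'k) mpoly)" by simp
  then show "a = b" by (simp add: monomial_def)
qed

lemma genideal_monomials_up_hull:
  "genideal mpoly_ring (monomial ` T) = (poly_supp (up_hull T) :: ('v::finite, 'k::field) mpoly set)"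
  by (simp add: genideal_monomials up_hull_def)

lemma min_exps_subset_gens:
  assumes "up_hull T = E"
  shows "min_exps E \<subseteq> T"
proof
  fix g assume g: "g \<in> min_exps E"
  then have "g \<in> up_hull T" using assms by (simp add: min_exps_def)
  then obtain t c where t: "t \<in> T" "g = t + c" unfolding up_hull_def by blast
  then have "t \<in> E" using up_hull_superset[OF t(1)] assms by simp
  moreover have "\<forall>v. lookup t v \<le> lookup g v" by (simp add: t(2) lookup_add)
  ultimately have "t = g" using g by (simp add: min_exps_def)
  with t(1) show "g \<in> T" by simp
qed

text \<open>Every generating set of monomials contains all minimal exponents, so they form the only
  irredundant one and \<open>THE\<close> is well defined.\<close>

lemma min_monomial_gens_poly_supp:
  fixes E :: "('v::finite) exps set"
  assumes E: "up_closed E"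
  shows "min_monomial_gens (poly_supp E :: ('v, 'k::field) mpoly set) = monomial ` min_exps E"
  unfolding min_monomial_gens_def
proof (rule the_equality)
  let ?G = "monomial ` min_exps E :: ('v, 'k) mpoly set"
  have gen: "genideal mpoly_ring ?G = poly_supp E"
    by (simp add: genideal_monomials_up_hull up_hull_min_exps[OF E])
  have sub: "?G \<subseteq> H" if H: "H \<subseteq> range monomial" "genideal mpoly_ring H = (poly_supp E :: ('v, 'k) mpoly set)" for H
  proof -
    obtain T where T: "H = monomial ` T" using H(1) by (auto simp: subset_image_iff)
    then have "up_hull T = E" using H(2) by (simp add: genideal_monomials_up_hull poly_supp_eq_iff)
    then show ?thesis using min_exps_subset_gens T by blast
  qed
  show "?G \<subseteq> range monomial \<and> genideal mpoly_ring ?G = poly_supp E \<and>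
    (\<forall>H. H \<subset> ?G \<longrightarrow> genideal mpoly_ring H \<noteq> poly_supp E)"
  proof (intro conjI allI impI gen)
    fix H assume H: "H \<subset> ?G"
    then have "H \<subseteq> range monomial" by blast
    with sub[of H] H show "genideal mpoly_ring H \<noteq> poly_supp E" by blast
  qed blast
  fix H :: "('v, 'k) mpoly set"
  assume H: "H \<subseteq> range monomial \<and> genideal mpoly_ring H = poly_supp E \<and>
    (\<forall>H'. H' \<subset> H \<longrightarrow> genideal mpoly_ring H' \<noteq> poly_supp E)"
  then have "?G \<subseteq> H" using sub by blast
  with H gen show "H = ?G" by blast
qed

lemma degree_le_max_gen_degree:
  fixes E :: "('v::finite) exps set"
  assumes "up_closed E" "g \<in> min_exps E"
  shows "(\<Sum>v\<in>UNIV. lookup g v) \<le> max_gen_degree (poly_supp E :: ('v, 'k::field) mpoly set)"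
proof -
  have "{\<Sum>v\<in>UNIV. lookup a v |a. (monomial a :: ('v, 'k) mpoly) \<in> min_monomial_gens (poly_supp E)} =
    (\<lambda>a. \<Sum>v\<in>UNIV. lookup a v) ` min_exps E"
    by (auto simp: min_monomial_gens_poly_supp[OF assms(1)] inj_image_mem_iff[OF inj_monomial])
  then show ?thesis
    unfolding max_gen_degree_def using finite_min_exps[of E] assms(2) by simp
qed

lemma monomial_ideal_eq_poly_supp:
  fixes I :: "('v::finite, 'k::field) mpoly set"
  assumes "monomial_ideal I"
  obtains E where "up_closed E" "I = poly_supp E"
proof -
  from assms obtain S where S: "S \<subseteq> range monomial" "I = genideal mpoly_ring S"
    by (auto simp: monomial_ideal_def)
  then obtain T where "S = monomial ` T" by (auto simp: subset_image_iff)
  with S have "I = poly_supp (up_hull T)" by (simp add: genideal_monomials_up_hull)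
  with up_closed_up_hull that show ?thesis by blast
qed

section \<open>Chains of faces\<close>

text \<open>A face is encoded by the generators on it, and by the semigroup property that a sum of
  its members has no decomposition using other generators. This is the form in which faces yield
  primes.\<close>

definition face :: "('v::finite) exps set \<Rightarrow> (rat ^ 'v option) set \<Rightarrow> bool"
  where "face G \<Psi> \<longleftrightarrow> \<Psi> \<subseteq> cone_gens G \<and> (\<forall>ms ns. set ms \<subseteq> cone_gens G \<longrightarrow> set ns \<subseteq> \<Psi> \<longrightarrow>
    sum_list ms = sum_list ns \<longrightarrow> set ms \<subseteq> \<Psi>)"

lemma faceD:
  assumes "face G \<Psi>"
  shows "\<Psi> \<subseteq> cone_gens G"
    "set ms \<subseteq> cone_gens G \<Longrightarrow> set ns \<subseteq> \<Psi> \<Longrightarrow> sum_list ms = sum_list ns \<Longrightarrow> set ms \<subseteq> \<Psi>"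
  using assms by (auto simp: face_def)

lemma face_cone_gens: "face G (cone_gens G)"
  by (simp add: face_def)

lemma face_zeros:
  assumes "face G \<Psi>" "\<And>x. x \<in> \<Psi> \<Longrightarrow> dotp f x \<ge> 0"
  shows "face G {x\<in>\<Psi>. dotp f x = 0}"
  unfolding face_def
proof (intro conjI allI impI)
  show "{x\<in>\<Psi>. dotp f x = 0} \<subseteq> cone_gens G" using faceD(1)[OF assms(1)] by blast
  fix ms ns
  assume ms: "set ms \<subseteq> cone_gens G" and ns: "set ns \<subseteq> {x\<in>\<Psi>. dotp f x = 0}" and eq: "sum_list ms = sum_list ns"
  have sub: "set ms \<subseteq> \<Psi>" using faceD(2)[OF assms(1) ms _ eq] ns by blast
  have "sum_list (map (dotp f) ms) = sum_list (map (dotp f) ns)"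
    using eq by (simp flip: dotp_sum_list)
  also have "\<dots> = 0" using ns by (induction ns) auto
  finally have "\<forall>y\<in>set (map (dotp f) ms). y = 0"
    using sub assms(2) by (subst (asm) sum_list_nonneg_eq_0_iff) auto
  with sub show "set ms \<subseteq> {x\<in>\<Psi>. dotp f x = 0}" by auto
qed

text \<open>Since the cone is pointed, some functional is positive on \<open>x\<close> and nonnegative on the whole
  face; one with a maximal zero set cuts out a face of codimension one.\<close>

lemma face_avoiding:
  assumes "finite G" "face G \<Psi>" "x \<in> \<Psi>"
  shows "\<exists>\<Psi>'. face G \<Psi>' \<and> \<Psi>' \<subseteq> \<Psi> \<and> x \<notin> \<Psi>' \<and> vec.dim \<Psi> \<le> vec.dim \<Psi>' + 1"
proof -
  define h :: "rat ^ 'a option" where "h = (\<chi> i. 1)"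
  have fin: "finite \<Psi>" using faceD(1)[OF assms(2)] finite_cone_gens[OF assms(1)] finite_subset by blast
  have hpos: "dotp h y > 0" if "y \<in> cone_gens G" for y
  proof -
    from that consider g where "y = evec g 1" | v where "y = evec (single v 1) 0"
      by (auto simp: cone_gens_def)
    then show ?thesis
    proof cases
      case 1
      then show ?thesis by (simp add: dotp_evec h_def add_pos_nonneg sum_nonneg)
    next
      case 2
      then show ?thesis by (simp add: dotp_evec_single) (simp add: h_def)
    qed
  qed
  have "\<forall>y\<in>\<Psi>. dotp h y \<ge> 0" "dotp h x \<noteq> 0"
    using hpos faceD(1)[OF assms(2)] assms(3) by (auto intro: less_imp_le) (metis less_irrefl subsetD)
  from tight_functional[OF fin this] obtain f
    where f: "\<forall>y\<in>\<Psi>. dotp f y \<ge> 0" "dotp f x = dotp h x"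
      "\<Psi> \<subseteq> vec.span (insert x {y\<in>\<Psi>. dotp f y = 0})" by blast
  let ?Z = "{y\<in>\<Psi>. dotp f y = 0}"
  have "vec.dim \<Psi> \<le> vec.dim (insert x ?Z)"
    using vec.dim_subset[OF f(3)] by simp
  also have "\<dots> \<le> vec.dim ?Z + 1" by (simp add: vec.dim_insert)
  finally have "vec.dim \<Psi> \<le> vec.dim ?Z + 1" .
  moreover have "face G ?Z" using f(1) by (intro face_zeros[OF assms(2)]) blast
  moreover have "x \<notin> ?Z" using f(2) \<open>dotp h x \<noteq> 0\<close> by simp
  ultimately show ?thesis by (intro exI[of _ ?Z]) auto
qed

lemma face_avoiding_set:
  assumes "finite G" "finite J" "face G \<Psi>"
  shows "\<exists>\<Psi>'. face G \<Psi>' \<and> \<Psi>' \<subseteq> \<Psi> \<and> \<Psi>' \<inter> J = {} \<and> vec.dim \<Psi> \<le> vec.dim \<Psi>' + card J"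
  using assms(2)
proof induction
  case empty
  then show ?case using assms(3) by auto
next
  case (insert x J)
  then obtain \<Psi>' where \<Psi>': "face G \<Psi>'" "\<Psi>' \<subseteq> \<Psi>" "\<Psi>' \<inter> J = {}" "vec.dim \<Psi> \<le> vec.dim \<Psi>' + card J" by blast
  show ?case
  proof (cases "x \<in> \<Psi>'")
    case False
    with \<Psi>' insert.hyps show ?thesis by (intro exI[of _ \<Psi>']) auto
  next
    case True
    from face_avoiding[OF assms(1) \<Psi>'(1) this] obtain \<Psi>''
      where "face G \<Psi>''" "\<Psi>'' \<subseteq> \<Psi>'" "x \<notin> \<Psi>''" "vec.dim \<Psi>' \<le> vec.dim \<Psi>'' + 1" by blast
    with \<Psi>' insert.hyps show ?thesis by (intro exI[of _ \<Psi>'']) auto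
  qed
qed

lemma face_chain:
  assumes "finite G" "face G \<Psi>" "m \<le> vec.dim \<Psi>"
  shows "\<exists>ch. (\<forall>i\<le>m. face G (ch i) \<and> ch i \<subseteq> \<Psi>) \<and> (\<forall>i<m. ch (Suc i) \<subset> ch i)"
  using assms(2,3)
proof (induction m arbitrary: \<Psi>)
  case 0
  then show ?case by (intro exI[of _ "\<lambda>_. \<Psi>"]) simp
next
  case (Suc m)
  then have "\<Psi> \<noteq> {}" by auto
  then obtain x where x: "x \<in> \<Psi>" by blast
  from face_avoiding[OF assms(1) Suc.prems(1) x] obtain \<Psi>'
    where \<Psi>': "face G \<Psi>'" "\<Psi>' \<subseteq> \<Psi>" "x \<notin> \<Psi>'" "vec.dim \<Psi> \<le> vec.dim \<Psi>' + 1" by blast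
  from Suc.IH[OF \<Psi>'(1)] \<Psi>'(4) Suc.prems(2) obtain ch
    where ch: "\<forall>i\<le>m. face G (ch i) \<and> ch i \<subseteq> \<Psi>'" "\<forall>i<m. ch (Suc i) \<subset> ch i" by auto
  define ch' where "ch' i = (case i of 0 \<Rightarrow> \<Psi> | Suc i \<Rightarrow> ch i)" for i
  have "face G (ch' i) \<and> ch' i \<subseteq> \<Psi>" if "i \<le> Suc m" for i
    using that ch(1) Suc.prems(1) \<Psi>'(2) by (auto simp: ch'_def split: nat.split)
  moreover have "ch' (Suc i) \<subset> ch' i" if "i < Suc m" for i
  proof (cases i)
    case 0
    have "ch 0 \<subseteq> \<Psi>'" using ch(1) by simp
    with 0 x \<Psi>' show ?thesis by (auto simp: ch'_def)
  next
    case (Suc j)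
    with that ch(2) show ?thesis by (simp add: ch'_def)
  qed
  ultimately show ?case by blast
qed

lemma dim_cone_gens:
  fixes G :: "('v::finite) exps set"
  assumes "G \<noteq> {}"
  shows "vec.dim (cone_gens G) = CARD('v) + 1"
proof -
  have "x \<in> vec.span (cone_gens G)" for x
  proof (rule ccontr)
    assume "x \<notin> vec.span (cone_gens G)"
    from separating_functional[OF this] obtain d
      where d: "\<forall>s\<in>cone_gens G. dotp d s = 0" "dotp d x \<noteq> 0" by blast
    have S: "d $ Some v = 0" for v
    proof -
      have "evec (single v 1) 0 \<in> cone_gens G" by (simp add: cone_gens_def)
      with d(1) have "dotp d (evec (single v 1) 0) = 0" by blast
      then show ?thesis by (simp add: dotp_evec_single)
    qed
    obtain g where "g \<in> G" using assms by blast
    then have "evec g 1 \<in> cone_gens G" by (simp add: cone_gens_def)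
    with d(1) have "dotp d (evec g 1) = 0" by blast
    then have "d $ None = 0" by (simp add: dotp_evec S)
    with S have "d = 0" by (intro vec_option_eqI) auto
    with d(2) show False by (simp add: dotp_def)
  qed
  then have "vec.span (cone_gens G) = UNIV" by blast
  then have "vec.dim (cone_gens G) = vec.dim (UNIV :: (rat ^ 'v option) set)"
    by (metis vec.dim_span)
  then show ?thesis by (simp add: vec.dim_UNIV card_cart_basis)
qed

text \<open>The face of tight generators has linear dimension at least \<open>CARD('v)\<close>,
  since \<beta> supplies the only missing direction. Avoiding the unit vectors outside
  \<open>F\<close> costs at most one dimension each; those in \<open>F\<close> are not tight. A face
  without unit vectors and of dimension at least \<open>card F\<close> remains.\<close>

lemma corner_imp_face_chain:
  fixes F :: "'v::finite set"
  assumes G: "finite G" "G \<noteq> {}" and corner: "corner (power_saturation (up_hull G) n) F \<beta>"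
  obtains ch where "\<And>i. i \<le> card F \<Longrightarrow> face G (ch i)"
    "\<And>i v. i \<le> card F \<Longrightarrow> evec (single v 1) 0 \<notin> ch i"
    "\<And>i. i < card F \<Longrightarrow> ch (Suc i) \<subset> ch i"
proof -
  obtain c where c: "\<forall>x\<in>cone_gens G. dotp c x \<ge> 0" "\<And>v. v \<notin> F \<Longrightarrow> c $ Some v = 0"
    "\<And>v. v \<in> F \<Longrightarrow> c $ Some v > 0" "dotp c (evec \<beta> n) < 0"
    "cone_gens G \<subseteq> vec.span (insert (evec \<beta> n) {x\<in>cone_gens G. dotp c x = 0})"
    using corner_functional[OF G(1) corner] by blast
  let ?\<Psi> = "{x\<in>cone_gens G. dotp c x = 0}"
  have face: "face G ?\<Psi>" using c(1) by (intro face_zeros[OF face_cone_gens]) blast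
  have "CARD('v) + 1 \<le> vec.dim (insert (evec \<beta> n) ?\<Psi>)"
    using vec.dim_subset[OF c(5)] by (simp add: dim_cone_gens[OF G(2)])
  also have "\<dots> \<le> vec.dim ?\<Psi> + 1" by (simp add: vec.dim_insert)
  finally have dim: "CARD('v) \<le> vec.dim ?\<Psi>" by simp
  define J where "J = (\<lambda>v. evec (single v 1) 0) ` (- F)"
  have J: "finite J" "card J + card F \<le> CARD('v)"
  proof -
    show "finite J" by (simp add: J_def)
    have "card J \<le> card (- F)" unfolding J_def by (rule card_image_le) simp
    moreover have "card (- F) + card F = CARD('v)"
      by (metis Compl_partition2 card_Un_disjoint disjoint_iff ComplD finite)
    ultimately show "card J + card F \<le> CARD('v)" by simp
  qed
  from face_avoiding_set[OF G(1) J(1) face] obtain \<Psi>'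
    where \<Psi>': "face G \<Psi>'" "\<Psi>' \<subseteq> ?\<Psi>" "\<Psi>' \<inter> J = {}" "vec.dim ?\<Psi> \<le> vec.dim \<Psi>' + card J" by blast
  have no: "evec (single v 1) 0 \<notin> \<Psi>'" for v
  proof (cases "v \<in> F")
    case True
    then have "dotp c (evec (single v 1) 0) \<noteq> 0" using c(3)[of v] by (simp add: dotp_evec_single)
    with \<Psi>'(2) show ?thesis by blast
  next
    case False
    with \<Psi>'(3) show ?thesis by (auto simp: J_def)
  qed
  have "card F \<le> vec.dim \<Psi>'" using dim J(2) \<Psi>'(4) by linarith
  from face_chain[OF G(1) \<Psi>'(1) this] obtain ch
    where "\<forall>i\<le>card F. face G (ch i) \<and> ch i \<subseteq> \<Psi>'" "\<forall>i<card F. ch (Suc i) \<subset> ch i" by blast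
  with no that[of ch] show ?thesis by blast
qed

section \<open>Chains of primes in subalgebras of polynomial rings\<close>

text \<open>Gaussian elimination: the equation at \<open>b\<close> is solved for the unknown at
  \<open>e0\<close>, which then disappears from the others.\<close>

lemma homogeneous_system_nontrivial:
  fixes L :: "'e \<Rightarrow> 'b \<Rightarrow> 'k::field"
  assumes "finite B" "finite A" "card B < card A"
  shows "\<exists>\<kappa>. (\<exists>e\<in>A. \<kappa> e \<noteq> 0) \<and> (\<forall>b\<in>B. (\<Sum>e\<in>A. \<kappa> e * L e b) = 0)"
  using assms
proof (induction B arbitrary: A L)
  case empty
  then have "A \<noteq> {}" by auto
  then show ?case by (intro exI[of _ "\<lambda>_. 1"]) auto
next
  case (insert b B)
  show ?case
  proof (cases "\<forall>e\<in>A. L e b = 0")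
    case True
    from insert.IH[of A L] insert.prems insert.hyps obtain \<kappa>
      where "\<exists>e\<in>A. \<kappa> e \<noteq> 0" "\<forall>b\<in>B. (\<Sum>e\<in>A. \<kappa> e * L e b) = 0" by auto
    with True show ?thesis by (intro exI[of _ \<kappa>]) auto
  next
    case False
    then obtain e0 where e0: "e0 \<in> A" "L e0 b \<noteq> 0" by blast
    define L' where "L' e b' = L e b' - L e b / L e0 b * L e0 b'" for e b'
    have "card B < card (A - {e0})" using insert.prems insert.hyps e0 by auto
    from insert.IH[OF _ this, of L'] insert.prems obtain \<kappa>
      where \<kappa>: "\<exists>e\<in>A - {e0}. \<kappa> e \<noteq> 0" "\<forall>b\<in>B. (\<Sum>e\<in>A - {e0}. \<kappa> e * L' e b) = 0" by auto
    define s where "s = - (\<Sum>e\<in>A - {e0}. \<kappa> e * L e b) / L e0 b"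
    define \<kappa>' where "\<kappa>' = \<kappa>(e0 := s)"
    have split: "(\<Sum>e\<in>A. \<kappa>' e * L e b') = s * L e0 b' + (\<Sum>e\<in>A - {e0}. \<kappa> e * L e b')" for b'
      using e0(1) insert.prems(1) by (simp add: sum.remove[of A e0] \<kappa>'_def)
    have "(\<Sum>e\<in>A. \<kappa>' e * L e b') = 0" if b': "b' \<in> insert b B" for b'
    proof (cases "b' = b")
      case True
      then show ?thesis using e0(2) by (simp add: split s_def)
    next
      case False
      with \<kappa>(2) b' have "(\<Sum>e\<in>A - {e0}. \<kappa> e * L' e b') = 0" by blast
      moreover have "(\<Sum>e\<in>A - {e0}. \<kappa> e * L' e b') = (\<Sum>e\<in>A - {e0}. \<kappa> e * L e b') + s * L e0 b'"
        by (simp add: s_def L'_def right_diff_distrib sum_subtractf sum_distrib_right sum_divide_distrib mult.assoc)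
      ultimately show ?thesis by (simp add: split add.commute)
    qed
    moreover have "\<exists>e\<in>A. \<kappa>' e \<noteq> 0" using \<kappa>(1) by (auto simp: \<kappa>'_def)
    ultimately show ?thesis by blast
  qed
qed

section \<open>Primes and algebraic relations in the Rees algebra\<close>

definition prime_in :: "'a::comm_ring_1 set \<Rightarrow> 'a set \<Rightarrow> bool"
  where "prime_in S P \<longleftrightarrow> P \<subseteq> S \<and> 0 \<in> P \<and> (\<forall>a\<in>P. \<forall>b\<in>P. a + b \<in> P) \<and> (\<forall>a\<in>P. \<forall>s\<in>S. s * a \<in> P) \<and>
    1 \<notin> P \<and> (\<forall>a\<in>S. \<forall>b\<in>S. a * b \<in> P \<longrightarrow> a \<in> P \<or> b \<in> P)"

lemma prime_inD:
  assumes "prime_in S P"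
  shows "P \<subseteq> S" "0 \<in> P" "a \<in> P \<Longrightarrow> b \<in> P \<Longrightarrow> a + b \<in> P" "a \<in> P \<Longrightarrow> s \<in> S \<Longrightarrow> s * a \<in> P" "1 \<notin> P"
    "a \<in> S \<Longrightarrow> b \<in> S \<Longrightarrow> a * b \<in> P \<Longrightarrow> a \<in> P \<or> b \<in> P"
  using assms by (auto simp: prime_in_def)

definition const :: "'k \<Rightarrow> ('v::finite, 'k::field) mpoly poly"
  where "const c = Polynomial.monom (single 0 c) 0"

lemma const_mult: "const a * const b = const (a * b)"
  by (simp add: const_def mult_monom mult_single)

lemma const_1 [simp]: "const 1 = 1"
  by (simp add: const_def)

lemma const_0 [simp]: "const 0 = 0"
  by (simp add: const_def)

lemma const_mem_rees_ring: "const c \<in> rees_ring E"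
  by (auto simp: const_def rees_ring_def Polynomial.coeff_monom)

definition monomial_lists :: "nat \<Rightarrow> nat \<Rightarrow> nat list set"
  where "monomial_lists M n = {e. set e \<subseteq> {..<M} \<and> length e = n}"

fun monomial_value :: "'a::comm_ring_1 list \<Rightarrow> nat list \<Rightarrow> 'a" where
  "monomial_value [] e = 1"
| "monomial_value (x # xs) e = x ^ hd e * monomial_value xs (tl e)"

text \<open>A polynomial expression in \<open>xs\<close> over the field, with every exponent below
  \<open>M\<close>; \<kappa> lists its coefficients.\<close>

definition lin_comb :: "nat \<Rightarrow> ('v::finite, 'k::field) mpoly poly list \<Rightarrow> (nat list \<Rightarrow> 'k) \<Rightarrow>
    ('v, 'k) mpoly poly"
  where "lin_comb M xs \<kappa> = (\<Sum>e\<in>monomial_lists M (length xs). const (\<kappa> e) * monomial_value xs e)"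

lemma finite_monomial_lists: "finite (monomial_lists M n)"
  unfolding monomial_lists_def by (rule finite_lists_length_eq) simp

lemma card_monomial_lists: "card (monomial_lists M n) = M ^ n"
  using card_lists_length_eq[of "{..<M}" n] by (simp add: monomial_lists_def)

lemma lin_comb_Nil: "lin_comb M [] \<kappa> = const (\<kappa> [])"
proof -
  have "monomial_lists M 0 = {[]}" by (auto simp: monomial_lists_def)
  then show ?thesis by (simp add: lin_comb_def)
qed

lemma lin_comb_Cons: "lin_comb M (x # xs) \<kappa> = (\<Sum>j<M. x ^ j * lin_comb M xs (\<lambda>e. \<kappa> (j # e)))"
proof -
  have "bij_betw (\<lambda>(j, e). j # e) ({..<M} \<times> monomial_lists M (length xs)) (monomial_lists M (Suc (length xs)))"
    by (rule bij_betwI[where g = "\<lambda>e. (hd e, tl e)"])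
      (auto simp: monomial_lists_def length_Suc_conv)
  then have "lin_comb M (x # xs) \<kappa> = (\<Sum>(j, e)\<in>{..<M} \<times> monomial_lists M (length xs).
      const (\<kappa> (j # e)) * (x ^ j * monomial_value xs e))"
    unfolding lin_comb_def by (subst sum.reindex_bij_betw[symmetric]) (auto simp: case_prod_unfold)
  then show ?thesis
    by (simp add: lin_comb_def sum.cartesian_product[symmetric] sum_distrib_left mult_ac)
qed

lemma lin_comb_mem_rees_ring:
  assumes "up_closed E" "set xs \<subseteq> rees_ring E"
  shows "lin_comb M xs \<kappa> \<in> rees_ring E"
proof -
  note S = subring_set_rees_ring[OF assms(1)]
  have pow: "x ^ j \<in> rees_ring E" if "x \<in> rees_ring E" for x j
    using that by (induction j) (auto intro: subring_setD[OF S])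
  show ?thesis
    using assms(2)
  proof (induction xs arbitrary: \<kappa>)
    case Nil
    then show ?case by (simp add: lin_comb_Nil const_mem_rees_ring)
  next
    case (Cons x xs)
    then show ?case
      unfolding lin_comb_Cons by (intro subring_set_sum[OF S] subring_setD(4)[OF S] pow) auto
  qed
qed

text \<open>Factor out the lowest power of \<open>x\<^sub>0\<close> occurring in the relation: it is not in \<open>Q 0\<close>, so the
  cofactor is, and reducing the cofactor modulo \<open>x\<^sub>0 \<in> Q 1\<close> leaves a relation in the other elements.\<close>

lemma lin_comb_notin_prime:
  fixes xs :: "('v::finite, 'k::field) mpoly poly list"
  assumes E: "up_closed E" and Q: "\<And>i. i \<le> length xs \<Longrightarrow> prime_in (rees_ring E) (Q i)"
    and sub: "\<And>i. i < length xs \<Longrightarrow> Q i \<subseteq> Q (Suc i)"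
    and xs: "\<And>i. i < length xs \<Longrightarrow> xs ! i \<in> Q (Suc i) - Q i"
    and \<kappa>: "e \<in> monomial_lists M (length xs)" "\<kappa> e \<noteq> 0"
  shows "lin_comb M xs \<kappa> \<notin> Q 0"
  using Q sub xs \<kappa>
proof (induction xs arbitrary: Q \<kappa> e)
  case Nil
  then have "\<kappa> [] \<noteq> 0" by (simp add: monomial_lists_def)
  have P0: "prime_in (rees_ring E) (Q 0)" using Nil(1)[of 0] by simp
  show ?case
  proof
    assume "lin_comb M [] \<kappa> \<in> Q 0"
    then have "const (1 / \<kappa> []) * const (\<kappa> []) \<in> Q 0"
      unfolding lin_comb_Nil by (rule prime_inD(4)[OF P0 _ const_mem_rees_ring])
    then have "1 \<in> Q 0" using \<open>\<kappa> [] \<noteq> 0\<close> by (simp add: const_mult)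
    with prime_inD(5)[OF P0] show False by simp
  qed
next
  case (Cons x xs)
  note S = subring_set_rees_ring[OF E, where 'k = 'k]
  have P0: "prime_in (rees_ring E) (Q 0)" and P1: "prime_in (rees_ring E) (Q 1)" using Cons.prems(1) by auto
  have x: "x \<in> Q 1" "x \<notin> Q 0" using Cons.prems(3)[of 0] by auto
  have mem: "set (x # xs) \<subseteq> rees_ring E"
  proof
    fix y assume "y \<in> set (x # xs)"
    then obtain i where i: "i < length (x # xs)" "y = (x # xs) ! i" by (metis in_set_conv_nth)
    have "prime_in (rees_ring E) (Q (Suc i))" using Cons.prems(1)[of "Suc i"] i(1) by simp
    with Cons.prems(3)[OF i(1)] i(2) show "y \<in> rees_ring E" using prime_inD(1) by blast
  qed
  have xS: "x \<in> rees_ring E" using mem by simp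
  define V where "V j = lin_comb M xs (\<lambda>e. \<kappa> (j # e))" for j
  have VS: "V j \<in> rees_ring E" for j unfolding V_def using mem by (intro lin_comb_mem_rees_ring[OF E]) simp
  define nz where "nz j \<longleftrightarrow> (\<exists>e\<in>monomial_lists M (length xs). \<kappa> (j # e) \<noteq> 0)" for j
  obtain j e' where e': "e = j # e'" "j < M" "e' \<in> monomial_lists M (length xs)"
    using Cons.prems(4) by (auto simp: monomial_lists_def length_Suc_conv)
  then have "nz j" using Cons.prems(5) by (auto simp: nz_def)
  define j0 where "j0 = (LEAST j. nz j)"
  have j0: "nz j0" "j0 \<le> j" unfolding j0_def using \<open>nz j\<close> by (auto intro: LeastI Least_le)
  have V0: "V i = 0" if "i < j0" for i
  proof -
    have "\<not> nz i" using that not_less_Least unfolding j0_def by blast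
    then show ?thesis by (simp add: V_def lin_comb_def nz_def)
  qed
  obtain e'' where e'': "e'' \<in> monomial_lists M (length xs)" "\<kappa> (j0 # e'') \<noteq> 0" using j0(1) by (auto simp: nz_def)
  have "V j0 \<notin> Q 1"
    unfolding V_def using Cons.IH[of "\<lambda>i. Q (Suc i)" e'' "\<lambda>e. \<kappa> (j0 # e)"] Cons.prems(1,2,3)[of "Suc _"] e'' by simp
  have pow: "x ^ i \<in> rees_ring E" for i using xS by (induction i) (auto intro: subring_setD[OF S])
  define r where "r = (\<Sum>i\<in>{Suc j0..<M}. x ^ (i - Suc j0) * V i)"
  have rS: "r \<in> rees_ring E" unfolding r_def by (intro subring_set_sum[OF S] subring_setD(4)[OF S] pow VS)
  have j0M: "j0 < M" using j0(2) e'(2) by simp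
  have "lin_comb M (x # xs) \<kappa> = (\<Sum>i\<in>{j0..<M}. x ^ i * V i)"
    unfolding lin_comb_Cons V_def[symmetric]
    by (rule sum.mono_neutral_right) (auto simp: V0)
  also have "\<dots> = x ^ j0 * V j0 + (\<Sum>i\<in>{Suc j0..<M}. x ^ i * V i)"
    using j0M by (simp add: sum.atLeast_Suc_lessThan)
  also have "(\<Sum>i\<in>{Suc j0..<M}. x ^ i * V i) = (\<Sum>i\<in>{Suc j0..<M}. x ^ j0 * (x * (x ^ (i - Suc j0) * V i)))"
  proof (intro sum.cong refl)
    fix i assume "i \<in> {Suc j0..<M}"
    then have "i = j0 + Suc (i - Suc j0)" by simp
    then have "x ^ i = x ^ j0 * (x * x ^ (i - Suc j0))" by (metis power_add power_Suc)
    then show "x ^ i * V i = x ^ j0 * (x * (x ^ (i - Suc j0) * V i))" by (simp add: mult_ac)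
  qed
  also have "x ^ j0 * V j0 + \<dots> = x ^ j0 * (V j0 + x * r)"
    by (simp add: r_def sum_distrib_left distrib_left)
  finally have lc: "lin_comb M (x # xs) \<kappa> = x ^ j0 * (V j0 + x * r)" .
  show ?case
  proof
    assume "lin_comb M (x # xs) \<kappa> \<in> Q 0"
    then have "x ^ j0 * (V j0 + x * r) \<in> Q 0" by (simp add: lc)
    moreover have "x ^ i \<notin> Q 0" for i
      by (induction i) (use prime_inD(5,6)[OF P0] x(2) xS pow in auto)
    moreover have "V j0 + x * r \<in> rees_ring E" by (intro subring_setD(3,4)[OF S] VS xS rS)
    ultimately have "V j0 + x * r \<in> Q 0" using prime_inD(6)[OF P0] pow by blast
    then have "V j0 + x * r \<in> Q 1" using Cons.prems(2)[of 0] by auto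
    moreover have "x * (- r) \<in> Q 1"
      using prime_inD(4)[OF P1 x(1), of "- r"] rS subring_setD(5)[OF S] by (simp add: mult.commute)
    ultimately have "V j0 + x * r + x * (- r) \<in> Q 1" by (rule prime_inD(3)[OF P1])
    with \<open>V j0 \<notin> Q 1\<close> show False by simp
  qed
qed

definition exps_bounded :: "nat \<Rightarrow> ('v::finite, 'k::field) mpoly poly \<Rightarrow> bool"
  where "exps_bounded c q \<longleftrightarrow> (\<forall>m. \<forall>a\<in>keys (coeff q m). m \<le> c \<and> (\<forall>v. lookup a v \<le> c))"

lemma exps_bounded_ex: "\<exists>c. exps_bounded c q"
proof -
  let ?A = "SIGMA m:{..Polynomial.degree q}. keys (coeff q m)"
  define c where "c = Polynomial.degree q + (\<Sum>(m, a)\<in>?A. \<Sum>v\<in>UNIV. lookup a v)"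
  have "m \<le> c \<and> lookup a v \<le> c" if a: "a \<in> keys (coeff q m)" for m a v
  proof -
    have m: "m \<le> Polynomial.degree q"
      using a by (intro le_degree) auto
    have "lookup a v \<le> (\<Sum>v\<in>UNIV. lookup a v)" by (rule member_le_sum) auto
    also have "\<dots> \<le> (\<Sum>(m, a)\<in>?A. \<Sum>v\<in>UNIV. lookup a v)"
      using member_le_sum[of "(m, a)" ?A "\<lambda>(m, a). \<Sum>v\<in>UNIV. lookup a v"] m a by simp
    finally show ?thesis using m by (simp add: c_def)
  qed
  then show ?thesis unfolding exps_bounded_def by blast
qed

lemma exps_bounded_mono: "exps_bounded c q \<Longrightarrow> c \<le> d \<Longrightarrow> exps_bounded d q"
  unfolding exps_bounded_def by (meson order_trans)

lemma exps_bounded_mult: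
  assumes "exps_bounded c p" "exps_bounded d q"
  shows "exps_bounded (c + d) (p * q)"
  unfolding exps_bounded_def
proof (intro allI ballI)
  fix m a assume "a \<in> keys (coeff (p * q) m)"
  then have "(\<Sum>i\<le>m. lookup (coeff p i * coeff q (m - i)) a) \<noteq> 0"
    by (simp add: coeff_mult lookup_sum in_keys_iff)
  then obtain i where "i \<in> {..m}" "lookup (coeff p i * coeff q (m - i)) a \<noteq> 0"
    by (rule sum.not_neutral_contains_not_neutral)
  then have i: "i \<le> m" "a \<in> keys (coeff p i * coeff q (m - i))"
    by (simp_all add: in_keys_iff)
  from keys_mult_mem[OF i(2)] obtain b b'
    where b: "b \<in> keys (coeff p i)" "b' \<in> keys (coeff q (m - i))" "a = b + b'" by metis
  have "i \<le> c" "m - i \<le> d" "lookup b v \<le> c" "lookup b' v \<le> d" for v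
    using assms b(1,2) by (auto simp: exps_bounded_def)
  then show "m \<le> c + d \<and> (\<forall>v. lookup a v \<le> c + d)"
    using i(1) by (auto simp: b(3) lookup_add intro: add_mono)
qed

lemma exps_bounded_power: "exps_bounded c q \<Longrightarrow> exps_bounded (j * c) (q ^ j)"
proof (induction j)
  case 0
  show ?case by (simp add: exps_bounded_def Polynomial.coeff_1)
next
  case (Suc j)
  from exps_bounded_mult[OF Suc.prems Suc.IH[OF Suc.prems]] show ?case by simp
qed

lemma exps_bounded_monomial_value:
  assumes "\<And>x. x \<in> set xs \<Longrightarrow> exps_bounded c x" "e \<in> monomial_lists M (length xs)"
  shows "exps_bounded (length xs * (M * c)) (monomial_value xs e)"
  using assms
proof (induction xs arbitrary: e)
  case Nil
  show ?case by (simp add: exps_bounded_def Polynomial.coeff_1)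
next
  case (Cons x xs)
  then obtain j e' where e: "e = j # e'" "j < M" "e' \<in> monomial_lists M (length xs)"
    by (auto simp: monomial_lists_def length_Suc_conv)
  have "exps_bounded (M * c) (x ^ j)"
    using exps_bounded_mono[OF exps_bounded_power[of c x j], of "M * c"] Cons.prems(1) e(2) by simp
  from exps_bounded_mult[OF this Cons.IH[OF _ e(3)]] Cons.prems(1) e(1) show ?case by simp
qed

lemma lookup_coeff_const_mult:
  "lookup (coeff (const c * q) m) a = c * lookup (coeff q m) a"
  using lookup_single_mult[of 0 c "coeff q m" a] by (simp add: const_def coeff_monom_mult)

lemma card_exponent_box:
  "finite {a :: ('v::finite) exps. \<forall>v. lookup a v \<le> D}"
  "card {a :: ('v::finite) exps. \<forall>v. lookup a v \<le> D} \<le> (D + 1) ^ CARD('v)"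
proof -
  let ?A = "{a :: 'v exps. \<forall>v. lookup a v \<le> D}"
  have inj: "inj_on lookup ?A" by (rule inj_onI) (simp add: poly_mapping.lookup_inject)
  have sub: "lookup ` ?A \<subseteq> PiE UNIV (\<lambda>_. {..D})" by auto
  have fin: "finite (PiE (UNIV :: 'v set) (\<lambda>_. {..D}))" by (rule finite_PiE) auto
  show "finite ?A" by (rule finite_imageD[OF finite_subset[OF sub fin] inj])
  have "card ?A = card (lookup ` ?A)" using inj by (simp add: card_image)
  also have "\<dots> \<le> card (PiE (UNIV :: 'v set) (\<lambda>_. {..D}))" by (rule card_mono[OF fin sub])
  also have "\<dots> = (D + 1) ^ CARD('v)" by (simp add: card_PiE)
  finally show "card ?A \<le> (D + 1) ^ CARD('v)" .
qed

text \<open>Counting: the monomials of exponents below \<open>M\<close> in \<open>n\<close> elements lie in a space of dimension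
  \<open>O(M ^ (CARD('v) + 1))\<close>, so they are dependent for large \<open>M\<close> if \<open>n > CARD('v) + 1\<close>.\<close>

lemma prime_chain_length_le:
  fixes E :: "('v::finite) exps set" and Q :: "nat \<Rightarrow> ('v, 'k::field) mpoly poly set"
  assumes E: "up_closed E" and Q: "\<And>i. i \<le> n \<Longrightarrow> prime_in (rees_ring E) (Q i)"
    and sub: "\<And>i. i < n \<Longrightarrow> Q i \<subset> Q (Suc i)"
  shows "n \<le> CARD('v) + 1"
proof (rule ccontr)
  assume "\<not> ?thesis"
  let ?r = "CARD('v) + 1"
  define l where "l = ?r + 1"
  have ln: "l \<le> n" using \<open>\<not> n \<le> ?r\<close> by (simp add: l_def)
  have "\<forall>i<l. \<exists>x. x \<in> Q (Suc i) - Q i" using sub ln by (meson order_less_le_trans psubset_imp_ex_mem)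
  then obtain f where f: "\<And>i. i < l \<Longrightarrow> f i \<in> Q (Suc i) - Q i" by metis
  define xs where "xs = map f [0..<l]"
  have len: "length xs = l" by (simp add: xs_def)
  obtain g where g: "\<And>x. exps_bounded (g x) (x :: ('v, 'k) mpoly poly)"
    using exps_bounded_ex by metis
  define c where "c = sum_list (map g xs)"
  have c: "exps_bounded c x" if "x \<in> set xs" for x
    using exps_bounded_mono[OF g] member_le_sum_list[of "g x" "map g xs"] that by (simp add: c_def)
  \<comment> \<open>\<open>M\<close> exceeds \<open>(l * c + 1) ^ ?r\<close>, so that the
    \<open>(D + 1) ^ ?r\<close> bound on the equations stays below the number
    \<open>M ^ (?r + 1)\<close> of unknowns.\<close>
  define M where "M = (l * c + 1) ^ ?r + 1"
  define D where "D = l * (M * c)"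
  let ?B = "{..D} \<times> {a :: 'v exps. \<forall>v. lookup a v \<le> D}"
  have finB: "finite ?B" using card_exponent_box(1) by blast
  have "card ?B \<le> (D + 1) * (D + 1) ^ CARD('v)"
    unfolding card_cartesian_product using card_exponent_box(2)[where 'v = 'v and D = D]
    by (intro mult_mono) auto
  also have "\<dots> = (D + 1) ^ ?r" by simp
  also have "\<dots> \<le> ((l * c + 1) * M) ^ ?r"
    by (rule power_mono) (auto simp: D_def M_def algebra_simps)
  also have "\<dots> = (l * c + 1) ^ ?r * M ^ ?r" by (rule power_mult_distrib)
  also have "\<dots> < M * M ^ ?r" by (rule mult_strict_right_mono) (auto simp: M_def)
  also have "\<dots> = card (monomial_lists M l)" by (simp add: card_monomial_lists l_def)
  finally have "card ?B < card (monomial_lists M l)" .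
  from homogeneous_system_nontrivial[OF finB finite_monomial_lists this,
      of "\<lambda>e (m, a). lookup (coeff (monomial_value xs e) m) a"]
  obtain \<kappa> e where e: "e \<in> monomial_lists M l" "\<kappa> e \<noteq> 0"
    and zero: "\<And>m a. (m, a) \<in> ?B \<Longrightarrow>
      (\<Sum>e\<in>monomial_lists M l. \<kappa> e * lookup (coeff (monomial_value xs e) m) a) = 0"
    by fastforce
  have "lookup (coeff (lin_comb M xs \<kappa>) m) a = 0" for m a
  proof -
    have *: "lookup (coeff (lin_comb M xs \<kappa>) m) a =
      (\<Sum>e\<in>monomial_lists M l. \<kappa> e * lookup (coeff (monomial_value xs e) m) a)"
      by (simp add: lin_comb_def len Polynomial.coeff_sum lookup_sum lookup_coeff_const_mult)
    show ?thesis
    proof (cases "(m, a) \<in> ?B")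
      case True
      from zero[OF this] show ?thesis by (simp add: *)
    next
      case False
      have "lookup (coeff (monomial_value xs e) m) a = 0" if "e \<in> monomial_lists M l" for e
      proof (rule ccontr)
        assume "\<not> ?thesis"
        then have "a \<in> keys (coeff (monomial_value xs e) m)" by (simp add: in_keys_iff)
        moreover have "exps_bounded D (monomial_value xs e)"
          unfolding D_def len[symmetric] using c that by (intro exps_bounded_monomial_value) (auto simp: len)
        ultimately show False using False by (auto simp: exps_bounded_def)
      qed
      then show ?thesis by (simp add: *)
    qed
  qed
  then have "lin_comb M xs \<kappa> = 0" by (intro poly_eqI poly_mapping_eqI) simp
  moreover have "lin_comb M xs \<kappa> \<notin> Q 0"
  proof (rule lin_comb_notin_prime[OF E])
    show "e \<in> monomial_lists M (length xs)" "\<kappa> e \<noteq> 0" using e by (simp_all add: len)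
    show "prime_in (rees_ring E) (Q i)" if "i \<le> length xs" for i using that Q ln by (simp add: len)
    show "Q i \<subseteq> Q (Suc i)" if "i < length xs" for i using that sub[of i] ln by (auto simp: len)
    show "xs ! i \<in> Q (Suc i) - Q i" if "i < length xs" for i using that f[of i] by (simp add: xs_def)
  qed
  moreover have "0 \<in> Q 0" using prime_inD(2)[OF Q[of 0]] by simp
  ultimately show False by simp
qed

section \<open>The fiber ring of a monomial ideal\<close>

text \<open>The target is merely a record with operations; that it is a ring is deduced from \<pi>
  respecting the operations.\<close>

locale surjective_image =
  fixes S :: "'a::comm_ring_1 set" and B :: "('b, 'c) ring_scheme" (structure) and \<pi> :: "'a \<Rightarrow> 'b"
  assumes S: "subring_set S" and carr: "carrier B = \<pi> ` S"
    and image_add: "\<And>a b. a \<in> S \<Longrightarrow> b \<in> S \<Longrightarrow> \<pi> a \<oplus> \<pi> b = \<pi> (a + b)"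
    and image_mult: "\<And>a b. a \<in> S \<Longrightarrow> b \<in> S \<Longrightarrow> \<pi> a \<otimes> \<pi> b = \<pi> (a * b)"
    and image_one: "\<one> = \<pi> 1" and image_zero: "\<zero> = \<pi> 0"
begin

lemmas S_closed = subring_setD[OF S]

lemma image_cring: "cring B"
proof (rule cringI)
  show "abelian_group B"
  proof (rule abelian_groupI)
    fix x assume "x \<in> carrier B"
    then obtain a where a: "a \<in> S" "x = \<pi> a" by (auto simp: carr)
    then show "\<exists>y\<in>carrier B. y \<oplus> x = \<zero>"
      using S_closed(5)[of a] by (intro bexI[of _ "\<pi> (- a)"]) (auto simp: image_add image_zero carr)
  qed (auto simp: carr image_add image_zero S_closed add_ac)
  show "comm_monoid B"
    by (rule comm_monoidI) (auto simp: carr image_mult image_one S_closed mult_ac)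
qed (auto simp: carr image_add image_mult S_closed distrib_right)

text \<open>Saturation with respect to the fibres of \<pi> ensures that membership in the image can
  be tested on any preimage.\<close>

lemma primeideal_image:
  assumes P: "prime_in S P" and sat: "\<And>a b. a \<in> P \<Longrightarrow> b \<in> S \<Longrightarrow> \<pi> a = \<pi> b \<Longrightarrow> b \<in> P"
  shows "primeideal (\<pi> ` P) B"
proof -
  interpret B: cring B by (rule image_cring)
  have PS: "a \<in> S" if "a \<in> P" for a using prime_inD(1)[OF P] that by blast
  have neg: "- a \<in> P" if "a \<in> P" for a
    using prime_inD(4)[OF P that S_closed(5)[OF S_closed(1)]] by simp
  have "\<ominus> \<pi> a = \<pi> (- a)" if "a \<in> P" for a
    using PS[OF that] S_closed(5)[of a] by (intro B.minus_equality) (auto simp: carr image_add image_zero)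
  then have "subgroup (\<pi> ` P) (add_monoid B)"
    using PS neg prime_inD(2,3)[OF P] by (intro B.add.subgroupI) (auto simp: carr image_add)
  moreover have "x \<otimes> y \<in> \<pi> ` P" "y \<otimes> x \<in> \<pi> ` P" if xy: "x \<in> carrier B" "y \<in> \<pi> ` P" for x y
  proof -
    obtain a b where "a \<in> S" "x = \<pi> a" "b \<in> P" "y = \<pi> b" using xy by (auto simp: carr)
    then show "x \<otimes> y \<in> \<pi> ` P" "y \<otimes> x \<in> \<pi> ` P"
      using prime_inD(4)[OF P, of b a] PS by (auto simp: image_mult mult.commute)
  qed
  ultimately have id: "ideal (\<pi> ` P) B" by (intro idealI B.ring_axioms) auto
  have mem: "\<pi> a \<in> \<pi> ` P \<longleftrightarrow> a \<in> P" if "a \<in> S" for a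
    using sat[OF _ that] by force
  show ?thesis
  proof (rule primeidealI[OF id image_cring])
    show "carrier B \<noteq> \<pi> ` P"
      using mem[OF S_closed(1)] prime_inD(5)[OF P] S_closed(1) by (auto simp: carr)
    fix x y assume xy: "x \<in> carrier B" "y \<in> carrier B" "x \<otimes> y \<in> \<pi> ` P"
    then obtain a b where ab: "a \<in> S" "x = \<pi> a" "b \<in> S" "y = \<pi> b" by (auto simp: carr)
    with xy(3) have "a * b \<in> P" using mem[OF S_closed(4)[OF ab(1,3)]] by (simp add: image_mult)
    with prime_inD(6)[OF P ab(1,3)] ab show "x \<in> \<pi> ` P \<or> y \<in> \<pi> ` P" by blast
  qed
qed

lemma prime_in_preimage:
  assumes "primeideal Q B"
  shows "prime_in S {a\<in>S. \<pi> a \<in> Q}"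
proof -
  interpret primeideal Q B by fact
  have "\<pi> 1 \<notin> Q" using one_imp_carrier I_notcarr by (auto simp: image_one)
  moreover have "\<pi> 0 \<in> Q"
    unfolding image_zero[symmetric] by (rule additive_subgroup.zero_closed[OF is_additive_subgroup])
  moreover have "\<pi> (a + b) \<in> Q" if "a \<in> S" "b \<in> S" "\<pi> a \<in> Q" "\<pi> b \<in> Q" for a b
    using additive_subgroup.a_closed[OF is_additive_subgroup that(3,4)] image_add[OF that(1,2)] by simp
  moreover have "\<pi> (s * a) \<in> Q" if "a \<in> S" "s \<in> S" "\<pi> a \<in> Q" for a s
    using I_l_closed[OF that(3), of "\<pi> s"] image_mult[OF that(2,1)] that(2) by (simp add: carr)
  moreover have "\<pi> a \<in> Q \<or> \<pi> b \<in> Q" if "a \<in> S" "b \<in> S" "\<pi> (a * b) \<in> Q" for a b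
    using I_prime[of "\<pi> a" "\<pi> b"] image_mult[OF that(1,2)] that by (simp add: carr)
  ultimately show ?thesis unfolding prime_in_def using S_closed by auto
qed

lemma prime_chain_preimage:
  assumes "\<forall>i\<le>n. primeideal (P i) B" "\<forall>i<n. P i \<subset> P (Suc i)"
  shows "\<And>i. i \<le> n \<Longrightarrow> prime_in S {a\<in>S. \<pi> a \<in> P i}"
    "\<And>i. i < n \<Longrightarrow> {a\<in>S. \<pi> a \<in> P i} \<subset> {a\<in>S. \<pi> a \<in> P (Suc i)}"
proof -
  show "prime_in S {a\<in>S. \<pi> a \<in> P i}" if "i \<le> n" for i
    using assms(1) that by (intro prime_in_preimage) auto
  show "{a\<in>S. \<pi> a \<in> P i} \<subset> {a\<in>S. \<pi> a \<in> P (Suc i)}" if i: "i < n" for i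
  proof -
    interpret primeideal "P (Suc i)" B using assms(1) i by auto
    obtain x where x: "x \<in> P (Suc i)" "x \<notin> P i" using assms(2) i by blast
    then have "x \<in> carrier B" using Icarr by blast
    then obtain a where "a \<in> S" "x = \<pi> a" by (auto simp: carr)
    with x assms(2) i show ?thesis by blast
  qed
qed

end

definition irrelevant_sumset :: "'v exps set \<Rightarrow> nat \<Rightarrow> 'v exps set"
  where "irrelevant_sumset E n = {a + b |a b. a \<in> - {0} \<and> b \<in> sumset_pow E n}"

lemma up_closed_nonzero: "up_closed (- {0 :: 'v exps})"
  unfolding up_closed_def
proof safe
  fix a c :: "'v exps" assume "a \<noteq> 0" "a + c = 0"
  then have "lookup a v + lookup c v = 0" for v by (metis lookup_add lookup_zero)
  then have "a = 0" by (intro poly_mapping_eqI) simp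
  with \<open>a \<noteq> 0\<close> show False ..
qed

lemma up_closed_irrelevant_sumset: "up_closed (irrelevant_sumset E n)"
  unfolding irrelevant_sumset_def by (rule up_closed_sumset[OF up_closed_nonzero])

lemma irrelevant_ideal_prod:
  assumes "up_closed E"
  shows "ideal_prod type_ring irrelevant_ideal (ideal_pow type_ring (poly_supp E) n) =
    (poly_supp (irrelevant_sumset E n) :: ('v::finite, 'k::field) mpoly set)"
  unfolding irrelevant_ideal_eq ideal_pow_poly_supp[OF assms] irrelevant_sumset_def
  by (rule ideal_prod_poly_supp[OF up_closed_nonzero up_closed_sumset_pow[OF assms]])

lemma coset_add_type_ring:
  fixes J :: "'a::comm_ring_1 set"
  assumes "ideal J type_ring"
  shows "(J +>\<^bsub>type_ring\<^esub> x) \<oplus>\<^bsub>type_ring Quot J\<^esub> (J +>\<^bsub>type_ring\<^esub> y) = J +>\<^bsub>type_ring\<^esub> (x + y)"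
  using ring_hom_memE(3)[OF ideal.rcos_ring_hom[OF assms], of x y] by simp

lemma coset_finsum_type_ring:
  fixes J :: "'a::comm_ring_1 set"
  assumes J: "ideal J type_ring" and "finite A"
  shows "(\<Oplus>\<^bsub>type_ring Quot J\<^esub>i\<in>A. J +>\<^bsub>type_ring\<^esub> f i) = J +>\<^bsub>type_ring\<^esub> (sum f A)"
proof -
  interpret Q: cring "type_ring Quot J" by (rule ideal.quotient_is_cring[OF J cring_from_type_algebra])
  have carr: "J +>\<^bsub>type_ring\<^esub> x \<in> carrier (type_ring Quot J)" for x
    by (auto simp: FactRing_def A_RCOSETS_def')
  show ?thesis using assms(2)
  proof induction
    case empty
    show ?case unfolding Q.finsum_empty by (simp add: FactRing_def)
  next
    case (insert i A)
    then show ?case using carr by (simp add: coset_add_type_ring[OF J] Pi_def)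
  qed
qed

lemma coset_mult_type_ring:
  fixes J J1 J2 :: "'a::comm_ring_1 set"
  assumes J: "ideal J type_ring" and J1: "ideal J1 type_ring" and J2: "ideal J2 type_ring"
    and "\<And>x. x \<in> J1 \<Longrightarrow> x * b \<in> J" "\<And>y. y \<in> J2 \<Longrightarrow> a * y \<in> J" "\<And>x y. x \<in> J1 \<Longrightarrow> y \<in> J2 \<Longrightarrow> x * y \<in> J"
  shows "rcoset_mult type_ring J (J1 +>\<^bsub>type_ring\<^esub> a) (J2 +>\<^bsub>type_ring\<^esub> b) = J +>\<^bsub>type_ring\<^esub> (a * b)"
proof -
  have *: "J +>\<^bsub>type_ring\<^esub> (x * y) = J +>\<^bsub>type_ring\<^esub> (a * b)"
    if x: "x \<in> J1 +>\<^bsub>type_ring\<^esub> a" and y: "y \<in> J2 +>\<^bsub>type_ring\<^esub> b" for x y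
  proof -
    obtain j j' where j: "j \<in> J1" "x = j + a" "j' \<in> J2" "y = j' + b"
      using x y unfolding mem_coset_type_ring by blast
    have "x * y - a * b = j * b + a * j' + j * j'" by (simp add: j algebra_simps)
    also have "\<dots> \<in> J" using assms(4-6) j ideal_type_ringD(2)[OF J] by blast
    finally show ?thesis by (simp add: coset_eq_iff_type_ring[OF J])
  qed
  have "rcoset_mult type_ring J (J1 +>\<^bsub>type_ring\<^esub> a) (J2 +>\<^bsub>type_ring\<^esub> b) =
    (\<Union>x\<in>J1 +>\<^bsub>type_ring\<^esub> a. \<Union>y\<in>J2 +>\<^bsub>type_ring\<^esub> b. J +>\<^bsub>type_ring\<^esub> (a * b))"
    unfolding rcoset_mult_def type_ring_simps using * by (intro SUP_cong refl)
  moreover have "a \<in> J1 +>\<^bsub>type_ring\<^esub> a" "b \<in> J2 +>\<^bsub>type_ring\<^esub> b"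
    using ideal_type_ringD(1)[OF J1] ideal_type_ringD(1)[OF J2] unfolding mem_coset_type_ring
    by (auto intro: bexI[of _ 0])
  ultimately show ?thesis by blast
qed

text \<open>The residue map from the Rees algebra modulo the irrelevant ideal times it, which is how
  the fiber ring is accessed.\<close>

definition fiber_map :: "'v exps set \<Rightarrow> ('v::finite, 'k::field) mpoly poly \<Rightarrow>
    nat \<Rightarrow> ('v, 'k) mpoly set"
  where "fiber_map E q n = poly_supp (irrelevant_sumset E n) +>\<^bsub>type_ring\<^esub> coeff q n"

lemma fiber_map_eq_iff:
  "fiber_map E p = fiber_map E q \<longleftrightarrow>
    (\<forall>n. coeff p n - coeff q n \<in> poly_supp (irrelevant_sumset E n))"
  by (simp add: fun_eq_iff fiber_map_def coset_eq_iff_type_ring[OF ideal_poly_supp[OF up_closed_irrelevant_sumset]])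

lemma irrelevant_sumset_subset:
  assumes "up_closed E"
  shows "irrelevant_sumset E n \<subseteq> sumset_pow E n"
proof
  fix c assume "c \<in> irrelevant_sumset E n"
  then obtain a b where "b \<in> sumset_pow E n" "c = a + b" unfolding irrelevant_sumset_def by auto
  then have "b \<in> sumset_pow E n" "c = b + a" by (simp_all add: add.commute)
  then show "c \<in> sumset_pow E n" using up_closedD[OF up_closed_sumset_pow[OF assms]] by simp
qed

lemma irrelevant_sumset_mult:
  fixes p q :: "('v::finite, 'k::field) mpoly"
  assumes E: "up_closed E" and p: "p \<in> poly_supp (irrelevant_sumset E m)" and q: "q \<in> poly_supp (sumset_pow E n)"
  shows "p * q \<in> poly_supp (irrelevant_sumset E (m + n))"
  unfolding mem_poly_supp_iff
proof
  fix c assume "c \<in> keys (p * q)"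
  then obtain a b where ab: "a \<in> keys p" "b \<in> keys q" "c = a + b" using keys_mult_mem by metis
  have "a \<in> irrelevant_sumset E m" "b \<in> sumset_pow E n" using ab(1,2) p q by (auto simp: mem_poly_supp_iff)
  then obtain a1 a2 where "a1 \<noteq> 0" "a2 \<in> sumset_pow E m" "a = a1 + a2"
    unfolding irrelevant_sumset_def by auto
  then have "c = a1 + (a2 + b)" by (simp add: ab(3) add.assoc)
  moreover have "a2 + b \<in> sumset_pow E (m + n)"
    unfolding sumset_pow_add[OF E] using \<open>a2 \<in> sumset_pow E m\<close> \<open>b \<in> sumset_pow E n\<close> by blast
  ultimately show "c \<in> irrelevant_sumset E (m + n)"
    using \<open>a1 \<noteq> 0\<close> unfolding irrelevant_sumset_def by blast
qed

lemma surjective_image_fiber_map: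
  fixes E :: "('v::finite) exps set"
  assumes E: "up_closed E"
  shows "surjective_image (rees_ring E) (fiber_ring type_ring irrelevant_ideal (poly_supp E :: ('v, 'k::field) mpoly set)) (fiber_map E)"
    (is "surjective_image _ ?B _")
proof
  let ?J = "\<lambda>n. poly_supp (irrelevant_sumset E n) :: ('v, 'k) mpoly set"
  note J = ideal_poly_supp[OF up_closed_irrelevant_sumset[of E], where 'k = 'k]
  note S = subring_set_rees_ring[OF E, where 'k = 'k]
  note fr = fiber_ring_def Let_def irrelevant_ideal_prod[OF E]
    irrelevant_ideal_prod[OF E, unfolded ideal_pow_poly_supp[OF E]]
  show "subring_set (rees_ring E :: ('v, 'k) mpoly poly set)" by (rule S)
  show "carrier ?B = fiber_map E ` rees_ring E"
  proof (intro subset_antisym subsetI)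
    fix F assume "F \<in> carrier ?B"
    then have F: "\<forall>n. \<exists>a\<in>poly_supp (sumset_pow E n). F n = ?J n +>\<^bsub>type_ring\<^esub> a" "finite {n. F n \<noteq> ?J n}"
      by (auto simp: fr ideal_pow_poly_supp[OF E])
    then obtain a where a: "\<And>n. a n \<in> poly_supp (sumset_pow E n) \<and> F n = ?J n +>\<^bsub>type_ring\<^esub> a n" by metis
    \<comment> \<open>Representatives are used only on the finite support; elsewhere the coefficient
      0 represents the zero coset.\<close>
    define q where "q = (\<Sum>n\<in>{n. F n \<noteq> ?J n}. Polynomial.monom (a n) n)"
    have q: "coeff q n = (if F n \<noteq> ?J n then a n else 0)" for n
      using F(2) by (simp add: q_def Polynomial.coeff_sum Polynomial.coeff_monom sum.delta)
    then have "q \<in> rees_ring E" using a by (auto simp: rees_ring_def)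
    moreover have "F = fiber_map E q" using a by (auto simp: fun_eq_iff fiber_map_def q)
    ultimately show "F \<in> fiber_map E ` rees_ring E" by blast
  next
    fix F assume "F \<in> fiber_map E ` (rees_ring E :: ('v, 'k) mpoly poly set)"
    then obtain q :: "('v, 'k) mpoly poly" where q: "q \<in> rees_ring E" "F = fiber_map E q" by blast
    have "{n. F n \<noteq> ?J n} \<subseteq> {..Polynomial.degree q}"
    proof
      fix n assume "n \<in> {n. F n \<noteq> ?J n}"
      then have "coeff q n \<noteq> 0" by (auto simp: q(2) fiber_map_def)
      then show "n \<in> {..Polynomial.degree q}" by (simp add: le_degree)
    qed
    then have "finite {n. F n \<noteq> ?J n}" using finite_subset by blast
    moreover have "\<exists>a\<in>poly_supp (sumset_pow E n). F n = ?J n +>\<^bsub>type_ring\<^esub> a" for n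
      using q by (auto simp: rees_ring_def fiber_map_def)
    ultimately show "F \<in> carrier ?B" by (simp add: fr ideal_pow_poly_supp[OF E])
  qed
  fix p q :: "('v, 'k) mpoly poly" assume p: "p \<in> rees_ring E" and q: "q \<in> rees_ring E"
  show "fiber_map E p \<oplus>\<^bsub>?B\<^esub> fiber_map E q = fiber_map E (p + q)"
    by (simp add: fr fun_eq_iff fiber_map_def coset_add_type_ring[OF J])
  have *: "rcoset_mult type_ring (?J n) (fiber_map E p i) (fiber_map E q (n - i)) =
    ?J n +>\<^bsub>type_ring\<^esub> (coeff p i * coeff q (n - i))" if "i \<le> n" for i n
    unfolding fiber_map_def
  proof (rule coset_mult_type_ring[OF J J J])
    have pi: "coeff p i \<in> poly_supp (sumset_pow E i)"
      and qi: "coeff q (n - i) \<in> poly_supp (sumset_pow E (n - i))" using p q by (auto simp: rees_ring_def)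
    have i: "i + (n - i) = n" "n - i + i = n" using that by auto
    show "x * coeff q (n - i) \<in> ?J n" if "x \<in> ?J i" for x
      using irrelevant_sumset_mult[OF E that qi] by (simp add: i)
    show "coeff p i * y \<in> ?J n" if "y \<in> ?J (n - i)" for y
      using irrelevant_sumset_mult[OF E that pi] by (simp add: i mult.commute)
    show "x * y \<in> ?J n" if "x \<in> ?J i" "y \<in> ?J (n - i)" for x y
    proof -
      have "y \<in> poly_supp (sumset_pow E (n - i))"
        using that(2) irrelevant_sumset_subset[OF E] by (auto simp: mem_poly_supp_iff)
      from irrelevant_sumset_mult[OF E that(1) this] show ?thesis by (simp add: i)
    qed
  qed
  have "(\<Oplus>\<^bsub>type_ring Quot ?J n\<^esub>i\<in>{..n}. rcoset_mult type_ring (?J n) (fiber_map E p i) (fiber_map E q (n - i))) =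
    fiber_map E (p * q) n" for n
  proof -
    interpret Q: cring "type_ring Quot ?J n" by (rule ideal.quotient_is_cring[OF J cring_from_type_algebra])
    have "(\<Oplus>\<^bsub>type_ring Quot ?J n\<^esub>i\<in>{..n}. rcoset_mult type_ring (?J n) (fiber_map E p i) (fiber_map E q (n - i))) =
      (\<Oplus>\<^bsub>type_ring Quot ?J n\<^esub>i\<in>{..n}. ?J n +>\<^bsub>type_ring\<^esub> (coeff p i * coeff q (n - i)))"
      by (rule Q.finsum_cong') (auto simp: * FactRing_def A_RCOSETS_def')
    then show ?thesis by (simp add: coset_finsum_type_ring[OF J] fiber_map_def coeff_mult)
  qed
  then show "fiber_map E p \<otimes>\<^bsub>?B\<^esub> fiber_map E q = fiber_map E (p * q)"
    by (simp add: fr fun_eq_iff)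
next
  show "\<one>\<^bsub>?B\<^esub> = fiber_map E 1"
    by (simp add: fiber_ring_def Let_def irrelevant_ideal_prod[OF E] fun_eq_iff fiber_map_def Polynomial.coeff_1)
  show "\<zero>\<^bsub>?B\<^esub> = fiber_map E 0"
    by (simp add: fiber_ring_def Let_def irrelevant_ideal_prod[OF E] fun_eq_iff fiber_map_def)
qed

section \<open>Monomial primes from faces\<close>

definition in_semigroup :: "(rat ^ 'v option) set \<Rightarrow> ('v::finite) exps \<Rightarrow> nat \<Rightarrow> bool"
  where "in_semigroup \<Psi> a n \<longleftrightarrow> (\<exists>ns. set ns \<subseteq> \<Psi> \<and> sum_list ns = evec a n)"

text \<open>The kernel of the projection of the Rees algebra to the semigroup ring of the
  face.\<close>

definition face_ideal :: "'v exps set \<Rightarrow> (rat ^ 'v option) set \<Rightarrow> ('v::finite, 'k::field) mpoly poly set"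
  where "face_ideal E \<Psi> = {q\<in>rees_ring E. \<forall>n a. in_semigroup \<Psi> a n \<longrightarrow> lookup (coeff q n) a = 0}"

lemma in_semigroup_mono: "in_semigroup \<Psi> a n \<Longrightarrow> \<Psi> \<subseteq> \<Psi>' \<Longrightarrow> in_semigroup \<Psi>' a n"
  unfolding in_semigroup_def by blast

lemma in_semigroup_split:
  assumes face: "face G \<Psi>" and a: "a \<in> sumset_pow (up_hull G) i" and b: "b \<in> sumset_pow (up_hull G) j"
    and ab: "in_semigroup \<Psi> (a + b) (i + j)"
  shows "in_semigroup \<Psi> a i" "in_semigroup \<Psi> b j"
proof -
  obtain ms ms' ns where ms: "set ms \<subseteq> cone_gens G" "sum_list ms = evec a i"
    and ms': "set ms' \<subseteq> cone_gens G" "sum_list ms' = evec b j"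
    and ns: "set ns \<subseteq> \<Psi>" "sum_list ns = evec (a + b) (i + j)"
    using a b ab unfolding sumset_pow_iff_sum_list in_semigroup_def by blast
  have "set (ms @ ms') \<subseteq> \<Psi>"
    by (rule faceD(2)[OF face _ ns(1)]) (use ms ms' ns in \<open>auto simp: evec_add\<close>)
  with ms ms' show "in_semigroup \<Psi> a i" "in_semigroup \<Psi> b j" by (auto simp: in_semigroup_def)
qed

text \<open>An element of the irrelevant ideal times a power has a decomposition that uses a unit
  vector, which a compact face does not contain. Hence the primes of compact faces contain the
  kernel of \<open>fiber_map\<close>.\<close>

lemma in_semigroup_not_irrelevant:
  assumes face: "face G \<Psi>" and no: "\<And>v. evec (single v 1) 0 \<notin> \<Psi>" and a: "in_semigroup \<Psi> a n"
  shows "a \<notin> irrelevant_sumset (up_hull G) n"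
proof
  assume "a \<in> irrelevant_sumset (up_hull G) n"
  then obtain b c where bc: "a = b + c" "b \<noteq> 0" "c \<in> sumset_pow (up_hull G) n"
    by (auto simp: irrelevant_sumset_def)
  then obtain v where v: "lookup b v \<noteq> 0" by (metis lookup_zero poly_mapping_eqI)
  define b' where "b' = b - single v 1"
  have b: "b = single v 1 + b'" unfolding b'_def by (rule single_add_diff[OF v])
  have "b' + c \<in> sumset_pow (up_hull G) n"
    using up_closedD[OF up_closed_sumset_pow[OF up_closed_up_hull] bc(3), of b'] by (simp add: add.commute)
  then obtain ms where ms: "set ms \<subseteq> cone_gens G" "sum_list ms = evec (b' + c) n"
    unfolding sumset_pow_iff_sum_list by blast
  let ?e = "evec (single v 1) 0"
  obtain ns where ns: "set ns \<subseteq> \<Psi>" "sum_list ns = evec a n" using a by (auto simp: in_semigroup_def)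
  have "sum_list (?e # ms) = sum_list ns"
    using evec_add[of "single v 1" "b' + c" 0 n] by (simp add: ms ns bc(1) b add.assoc)
  moreover have "set (?e # ms) \<subseteq> cone_gens G" using ms(1) by (auto simp: cone_gens_def)
  ultimately have "set (?e # ms) \<subseteq> \<Psi>" using faceD(2)[OF face _ ns(1)] by blast
  with no[of v] show False by simp
qed

text \<open>A term on the face arises only from factors on the face, which makes the set an ideal.
  It is prime because two elements outside have, in their lowest degrees in \<open>t\<close> with
  terms on the face, a pair of such terms whose product cannot cancel.\<close>

lemma prime_in_face_ideal:
  fixes G :: "('v::finite) exps set"
  assumes face: "face G \<Psi>"
  shows "prime_in (rees_ring (up_hull G)) (face_ideal (up_hull G) \<Psi> :: ('v, 'k::field) mpoly poly set)"
proof -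
  let ?S = "rees_ring (up_hull G) :: ('v, 'k) mpoly poly set" and ?P = "face_ideal (up_hull G) \<Psi> :: ('v, 'k) mpoly poly set"
  note S = subring_setD[OF subring_set_rees_ring[OF up_closed_up_hull[of G], where 'k = 'k]]
  have keysS: "a \<in> sumset_pow (up_hull G) n" if "q \<in> ?S" "a \<in> keys (coeff q n)" for q a n
    using that by (auto simp: rees_ring_def mem_poly_supp_iff)
  have prod0: "lookup (coeff p i * coeff q j) a = 0"
    if p: "p \<in> ?S" and q: "q \<in> ?S" and a: "in_semigroup \<Psi> a (i + j)"
      and z: "(\<forall>b. in_semigroup \<Psi> b i \<longrightarrow> lookup (coeff p i) b = 0) \<or>
        (\<forall>b. in_semigroup \<Psi> b j \<longrightarrow> lookup (coeff q j) b = 0)" for p q :: "('v, 'k) mpoly poly" and i j a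
  proof (rule ccontr)
    assume "lookup (coeff p i * coeff q j) a \<noteq> 0"
    then have "a \<in> keys (coeff p i * coeff q j)" by (simp add: in_keys_iff)
    then obtain b c where bc: "b \<in> keys (coeff p i)" "c \<in> keys (coeff q j)" "a = b + c"
      using keys_mult_mem by metis
    have "in_semigroup \<Psi> b i" "in_semigroup \<Psi> c j"
      using in_semigroup_split[OF face keysS[OF p bc(1)] keysS[OF q bc(2)]] a by (auto simp: bc(3))
    with z bc(1,2) show False by (auto simp: in_keys_iff)
  qed
  have "1 \<notin> ?P"
  proof
    assume "1 \<in> ?P"
    moreover have "in_semigroup \<Psi> 0 0" unfolding in_semigroup_def by (intro exI[of _ "[]"]) simp
    ultimately have "lookup (coeff (1 :: ('v, 'k) mpoly poly) 0) 0 = 0"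
      unfolding face_ideal_def by blast
    then show False by (simp add: Polynomial.coeff_1)
  qed
  moreover have "s * p \<in> ?P" if p: "p \<in> ?P" and s: "s \<in> ?S" for p s
  proof -
    have pS: "p \<in> ?S" using p by (simp add: face_ideal_def)
    have "lookup (coeff (s * p) n) a = 0" if a: "in_semigroup \<Psi> a n" for n a
      unfolding coeff_mult lookup_sum
    proof (rule sum.neutral, rule ballI)
      fix i assume "i \<in> {..n}"
      then have "i + (n - i) = n" by simp
      then show "lookup (coeff s i * coeff p (n - i)) a = 0"
        using p a by (intro prod0[OF s pS]) (auto simp: face_ideal_def)
    qed
    with S(4)[OF s pS] show ?thesis by (simp add: face_ideal_def)
  qed
  moreover have "p \<in> ?P \<or> q \<in> ?P" if p: "p \<in> ?S" and q: "q \<in> ?S" and pq: "p * q \<in> ?P" for p q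
  proof (rule ccontr)
    assume np: "\<not> (p \<in> ?P \<or> q \<in> ?P)"
    define bad where "bad r n \<longleftrightarrow> (\<exists>a. in_semigroup \<Psi> a n \<and> lookup (coeff r n) a \<noteq> 0)"
      for r :: "('v, 'k) mpoly poly" and n
    have "\<exists>n. bad p n" "\<exists>n. bad q n" using np p q by (auto simp: face_ideal_def bad_def)
    define m where "m = (LEAST n. bad p n)"
    define l where "l = (LEAST n. bad q n)"
    have m: "bad p m" "\<And>n. n < m \<Longrightarrow> \<not> bad p n"
      unfolding m_def using \<open>\<exists>n. bad p n\<close> by (auto intro: LeastI_ex dest: not_less_Least)
    have l: "bad q l" "\<And>n. n < l \<Longrightarrow> \<not> bad q n"
      unfolding l_def using \<open>\<exists>n. bad q n\<close> by (auto intro: LeastI_ex dest: not_less_Least)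
    define A where "A = {a \<in> keys (coeff p m). in_semigroup \<Psi> a m}"
    define B where "B = {a \<in> keys (coeff q l). in_semigroup \<Psi> a l}"
    have "finite A" "finite B" by (simp_all add: A_def B_def)
    moreover have "A \<noteq> {}" "B \<noteq> {}" using m(1) l(1) by (auto simp: A_def B_def bad_def in_keys_iff)
    ultimately obtain \<alpha> \<beta> where ab: "\<alpha> \<in> A" "\<beta> \<in> B"
      "\<And>a b. a \<in> A \<Longrightarrow> b \<in> B \<Longrightarrow> a + b = \<alpha> + \<beta> \<Longrightarrow> a = \<alpha> \<and> b = \<beta>"
      using unique_sum_exponents[of A B] by blast
    have sab: "in_semigroup \<Psi> (\<alpha> + \<beta>) (m + l)"
    proof -
      obtain ns ns' where "set ns \<subseteq> \<Psi>" "sum_list ns = evec \<alpha> m" "set ns' \<subseteq> \<Psi>" "sum_list ns' = evec \<beta> l"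
        using ab(1,2) by (auto simp: A_def B_def in_semigroup_def)
      then show ?thesis unfolding in_semigroup_def by (intro exI[of _ "ns @ ns'"]) (simp add: evec_add)
    qed
    have "lookup (coeff p m * coeff q l) (\<alpha> + \<beta>) =
      lookup (coeff p m) \<alpha> * lookup (coeff q l) \<beta>"
    proof (rule lookup_mult_unique)
      fix a b assume a: "a \<in> keys (coeff p m)" and b: "b \<in> keys (coeff q l)" and eq: "a + b = \<alpha> + \<beta>"
      have "in_semigroup \<Psi> a m" "in_semigroup \<Psi> b l"
        using in_semigroup_split[OF face keysS[OF p a] keysS[OF q b]] sab eq by auto
      with a b eq show "a = \<alpha> \<and> b = \<beta>" by (intro ab) (auto simp: A_def B_def)
    qed
    also have "\<dots> \<noteq> 0" using ab by (auto simp: A_def B_def in_keys_iff)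
    finally have ne: "lookup (coeff p m * coeff q l) (\<alpha> + \<beta>) \<noteq> 0" .
    have "lookup (coeff (p * q) (m + l)) (\<alpha> + \<beta>) =
      (\<Sum>i\<le>m + l. if i = m then lookup (coeff p m * coeff q l) (\<alpha> + \<beta>) else 0)"
      unfolding coeff_mult lookup_sum
    proof (intro sum.cong refl)
      fix i assume i: "i \<in> {..m + l}"
      then have il: "i + (m + l - i) = m + l" by simp
      have "lookup (coeff p i * coeff q (m + l - i)) (\<alpha> + \<beta>) = 0" if "i \<noteq> m"
      proof (rule prod0[OF p q])
        show "in_semigroup \<Psi> (\<alpha> + \<beta>) (i + (m + l - i))" using sab by (simp add: il)
        have "i < m \<or> m + l - i < l" using i that by auto
        then show "(\<forall>b. in_semigroup \<Psi> b i \<longrightarrow> lookup (coeff p i) b = 0) \<or>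
          (\<forall>b. in_semigroup \<Psi> b (m + l - i) \<longrightarrow> lookup (coeff q (m + l - i)) b = 0)"
          using m(2)[of i] l(2)[of "m + l - i"] unfolding bad_def by blast
      qed
      then show "lookup (coeff p i * coeff q (m + l - i)) (\<alpha> + \<beta>) =
        (if i = m then lookup (coeff p m * coeff q l) (\<alpha> + \<beta>) else 0)" by simp
    qed
    then have "lookup (coeff (p * q) (m + l)) (\<alpha> + \<beta>) \<noteq> 0" using ne by simp
    with pq sab show False by (simp add: face_ideal_def)
  qed
  moreover have "p + q \<in> ?P" if "p \<in> ?P" "q \<in> ?P" for p q
    using that S(3) by (auto simp: face_ideal_def lookup_add)
  moreover have "?P \<subseteq> ?S" "0 \<in> ?P" using S(2) by (auto simp: face_ideal_def)
  ultimately show ?thesis unfolding prime_in_def by blast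
qed

section \<open>The analytic spread\<close>

text \<open>Chains of primes are pulled back to the Rees algebra. That they contain the kernel is
  recorded for the zero ideal, where the bound has to be sharp.\<close>

lemma krull_dim_fiber_ring_le:
  fixes E :: "('v::finite) exps set"
  assumes "up_closed E"
    and "\<And>n Q. (\<And>i. i \<le> n \<Longrightarrow> prime_in (rees_ring E :: ('v, 'k::field) mpoly poly set) (Q i)) \<Longrightarrow>
      (\<And>i. i < n \<Longrightarrow> Q i \<subset> Q (Suc i)) \<Longrightarrow>
      (\<And>i. i \<le> n \<Longrightarrow> {q\<in>rees_ring E. fiber_map E q = fiber_map E 0} \<subseteq> Q i) \<Longrightarrow> n \<le> m"
  shows "krull_dim (fiber_ring type_ring irrelevant_ideal (poly_supp E :: ('v, 'k) mpoly set)) \<le> enat m"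
    (is "krull_dim ?B \<le> _")
proof -
  interpret fm: surjective_image "rees_ring E :: ('v, 'k) mpoly poly set" ?B "fiber_map E"
    by (rule surjective_image_fiber_map) fact
  have "n \<le> m" if P: "\<forall>i\<le>n. primeideal (P i) ?B" "\<forall>i<n. P i \<subset> P (Suc i)" for n P
  proof (rule assms(2)[of n "\<lambda>i. {a\<in>rees_ring E. fiber_map E a \<in> P i}"])
    fix i assume "i \<le> n"
    then interpret primeideal "P i" ?B using P(1) by blast
    have "\<zero>\<^bsub>?B\<^esub> \<in> P i" by (rule additive_subgroup.zero_closed[OF is_additive_subgroup])
    then have "fiber_map E 0 \<in> P i" unfolding fm.image_zero .
    then show "{q\<in>rees_ring E. fiber_map E q = fiber_map E 0} \<subseteq> {a\<in>rees_ring E. fiber_map E a \<in> P i}" by auto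
  qed (use fm.prime_chain_preimage[OF P] in auto)
  then show ?thesis unfolding krull_dim_def by (intro Sup_least) auto
qed

text \<open>The crude bound \<open>CARD('v) + 1\<close> on chains in the Rees algebra makes the
  Krull dimension finite, so \<open>the_enat\<close> is harmless.\<close>

lemma analytic_spread_eq:
  fixes E :: "('v::finite) exps set"
  assumes "up_closed E"
  shows "krull_dim (fiber_ring type_ring irrelevant_ideal (poly_supp E :: ('v, 'k::field) mpoly set)) =
    enat (analytic_spread (poly_supp E :: ('v, 'k) mpoly set))"
proof -
  have "krull_dim (fiber_ring type_ring irrelevant_ideal (poly_supp E :: ('v, 'k) mpoly set)) \<le> enat (CARD('v) + 1)"
    using assms prime_chain_length_le[OF assms] by (intro krull_dim_fiber_ring_le) blast+
  then obtain d where "krull_dim (fiber_ring type_ring irrelevant_ideal (poly_supp E :: ('v, 'k) mpoly set)) = enat d"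
    by (cases "krull_dim (fiber_ring type_ring irrelevant_ideal (poly_supp E :: ('v, 'k) mpoly set))") auto
  then show ?thesis by (simp add: analytic_spread_def)
qed

text \<open>The fiber ring is the base field in this case. The lemma settles \<open>n0\<close> for
  the zero ideal, where \<open>max_gen_degree\<close> has no meaning.\<close>

lemma analytic_spread_zero_ideal:
  "analytic_spread (poly_supp {} :: ('v::finite, 'k::field) mpoly set) = 0"
proof -
  let ?E = "{} :: 'v exps set"
  have E: "up_closed ?E" by (simp add: up_closed_def)
  note S = subring_set_rees_ring[OF E, where 'k = 'k]
  have "n \<le> 0" if Q: "\<And>i. i \<le> n \<Longrightarrow> prime_in (rees_ring ?E :: ('v, 'k) mpoly poly set) (Q i)"
      "\<And>i. i < n \<Longrightarrow> Q i \<subset> Q (Suc i)"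
      "\<And>i. i \<le> n \<Longrightarrow> {q\<in>rees_ring ?E. fiber_map ?E q = fiber_map ?E 0} \<subseteq> Q i" for n Q
  proof (rule ccontr)
    assume "\<not> n \<le> 0"
    then have n: "0 < n" by simp
    have P0: "prime_in (rees_ring ?E) (Q 0)" and P1: "prime_in (rees_ring ?E) (Q 1)" using Q(1) n by auto
    obtain x where x: "x \<in> Q 1" "x \<notin> Q 0" using Q(2)[OF n] by auto
    have xS: "x \<in> rees_ring ?E" using prime_inD(1)[OF P1] x(1) by blast
    \<comment> \<open>Modulo the kernel every element is its constant term, so an element of
      \<open>Q 1\<close> outside \<open>Q 0\<close> would be a unit.\<close>
    define c where "c = lookup (coeff x 0) 0"
    define y where "y = x - const c"
    have yS: "y \<in> rees_ring ?E"
      unfolding y_def using subring_setD(3)[OF S xS subring_setD(5)[OF S const_mem_rees_ring]] by simp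
    have "coeff y m \<in> poly_supp (irrelevant_sumset ?E m)" for m
    proof (cases m)
      case 0
      have y0: "lookup (coeff y 0) 0 = 0" by (simp add: y_def c_def const_def lookup_minus)
      have "keys (coeff y 0) \<subseteq> irrelevant_sumset ?E 0"
      proof
        fix a assume "a \<in> keys (coeff y 0)"
        then have "a \<noteq> 0" using y0 by (auto simp: in_keys_iff)
        then show "a \<in> irrelevant_sumset ?E 0"
          unfolding irrelevant_sumset_def by (intro CollectI exI[of _ a] exI[of _ 0]) simp
      qed
      with 0 show ?thesis by (simp add: mem_poly_supp_iff)
    next
      case (Suc l)
      then have "coeff y m \<in> poly_supp {}" using yS by (auto simp: rees_ring_def dest: spec[of _ m])
      then show ?thesis by (simp add: mem_poly_supp_iff)
    qed
    then have "fiber_map ?E y = fiber_map ?E 0" by (simp add: fiber_map_eq_iff)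
    with yS have yQ: "y \<in> Q i" if "i \<le> n" for i using Q(3)[OF that] by blast
    have xy: "x = y + const c" by (simp add: y_def)
    have "c \<noteq> 0" using x(2) yQ[of 0] by (auto simp: xy)
    have "- 1 * y \<in> Q 1" using prime_inD(4)[OF P1 yQ[of 1], of "- 1"] n subring_setD(1,5)[OF S] by auto
    then have "x + - 1 * y \<in> Q 1" using prime_inD(3)[OF P1 x(1)] by blast
    then have "const c \<in> Q 1" by (simp add: xy)
    then have "const (1 / c) * const c \<in> Q 1" by (rule prime_inD(4)[OF P1 _ const_mem_rees_ring])
    then show False using prime_inD(5)[OF P1] \<open>c \<noteq> 0\<close> by (simp add: const_mult)
  qed
  then have "krull_dim (fiber_ring type_ring irrelevant_ideal (poly_supp ?E :: ('v, 'k) mpoly set)) \<le> enat 0"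
    using E by (intro krull_dim_fiber_ring_le) blast+
  then show ?thesis unfolding analytic_spread_eq[OF E] by simp
qed

text \<open>A descending chain of compact faces gives an ascending chain of primes of the fiber
  ring, one step for each element of \<open>F\<close>.\<close>

lemma corner_card_le_analytic_spread:
  fixes G :: "('v::finite) exps set"
  assumes G: "finite G" "G \<noteq> {}" and corner: "corner (power_saturation (up_hull G) n) F \<beta>"
  shows "card F \<le> analytic_spread (poly_supp (up_hull G) :: ('v, 'k::field) mpoly set)"
proof -
  let ?E = "up_hull G" and ?S = "rees_ring (up_hull G) :: ('v, 'k) mpoly poly set"
  let ?B = "fiber_ring type_ring irrelevant_ideal (poly_supp ?E :: ('v, 'k) mpoly set)"
  interpret fm: surjective_image ?S ?B "fiber_map ?E"
    by (rule surjective_image_fiber_map[OF up_closed_up_hull])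
  obtain ch where ch: "\<And>i. i \<le> card F \<Longrightarrow> face G (ch i)"
    "\<And>i v. i \<le> card F \<Longrightarrow> evec (single v 1) 0 \<notin> ch i"
    "\<And>i. i < card F \<Longrightarrow> ch (Suc i) \<subset> ch i"
    using corner_imp_face_chain[OF G corner] by metis
  let ?P = "\<lambda>\<Psi>. face_ideal ?E \<Psi> :: ('v, 'k) mpoly poly set"
  have sat: "b \<in> ?P (ch i)" if i: "i \<le> card F" and ab: "a \<in> ?P (ch i)" "b \<in> ?S" "fiber_map ?E a = fiber_map ?E b" for a b i
  proof -
    have "lookup (coeff b m) x = 0" if x: "in_semigroup (ch i) x m" for m x
    proof -
      have "coeff a m - coeff b m \<in> poly_supp (irrelevant_sumset ?E m)"
        using ab(3) by (simp add: fiber_map_eq_iff)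
      moreover have "x \<notin> irrelevant_sumset ?E m"
        by (rule in_semigroup_not_irrelevant[OF ch(1)[OF i] ch(2)[OF i] x])
      ultimately have "lookup (coeff a m - coeff b m) x = 0"
        by (auto simp: mem_poly_supp_iff in_keys_iff)
      moreover have "lookup (coeff a m) x = 0" using ab(1) x by (simp add: face_ideal_def)
      ultimately show ?thesis by (simp add: lookup_minus)
    qed
    with ab(2) show ?thesis by (simp add: face_ideal_def)
  qed
  define P where "P i = fiber_map ?E ` ?P (ch i)" for i
  have "primeideal (P i) ?B" if "i \<le> card F" for i
    unfolding P_def
  proof (rule fm.primeideal_image)
    show "prime_in ?S (?P (ch i))" by (rule prime_in_face_ideal[OF ch(1)]) fact
    show "b \<in> ?P (ch i)"
      if "a \<in> ?P (ch i)" "b \<in> ?S" "fiber_map ?E a = fiber_map ?E b" for a b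
      by (rule sat[OF _ that]) fact
  qed
  moreover have "P j \<subset> P (Suc j)" if j: "j < card F" for j
  proof -
    have sub: "ch (Suc j) \<subset> ch j" by (rule ch(3)[OF j])
    obtain x where x: "x \<in> ch j" "x \<notin> ch (Suc j)" using sub by blast
    have "x \<in> cone_gens G" using faceD(1)[OF ch(1)[of j]] x(1) j by auto
    \<comment> \<open>A generator lost in the step is of height 1, because the faces contain no unit
      vector; its monomial separates the two primes.\<close>
    then obtain g where g: "g \<in> G" "x = evec g 1"
      using ch(2)[of j] x(1) j by (auto simp: cone_gens_def)
    define q where "q = (Polynomial.monom (single g 1) 1 :: ('v, 'k) mpoly poly)"
    have "g \<in> sumset_pow ?E 1" using up_hull_superset[OF g(1)] by simp (metis add.left_neutral)
    then have qS: "q \<in> ?S"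
      by (auto simp: q_def rees_ring_def Polynomial.coeff_monom simp del: sumset_pow.simps One_nat_def)
    have "\<not> in_semigroup (ch (Suc j)) g 1"
    proof
      assume "in_semigroup (ch (Suc j)) g 1"
      then obtain ns where ns: "set ns \<subseteq> ch (Suc j)" "sum_list ns = x" by (auto simp: in_semigroup_def g(2))
      have "set [x] \<subseteq> ch (Suc j)"
        by (rule faceD(2)[OF ch(1) _ ns(1)]) (use j ns(2) \<open>x \<in> cone_gens G\<close> in auto)
      with x(2) show False by simp
    qed
    then have qin: "q \<in> ?P (ch (Suc j))"
      using qS by (auto simp: face_ideal_def q_def Polynomial.coeff_monom lookup_single when_def)
    have "in_semigroup (ch j) g 1"
      unfolding in_semigroup_def by (intro exI[of _ "[x]"]) (use x(1) g(2) in simp)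
    have "q \<notin> ?P (ch j)"
    proof
      assume "q \<in> ?P (ch j)"
      then have "lookup (coeff q 1) g = 0"
        using \<open>in_semigroup (ch j) g 1\<close> unfolding face_ideal_def by blast
      then show False by (simp add: q_def)
    qed
    have "fiber_map ?E q \<notin> fiber_map ?E ` ?P (ch j)"
    proof
      assume "fiber_map ?E q \<in> fiber_map ?E ` ?P (ch j)"
      then obtain a where a: "fiber_map ?E q = fiber_map ?E a" "a \<in> ?P (ch j)" by (rule imageE)
      from sat[OF _ a(2) qS a(1)[symmetric]] j \<open>q \<notin> ?P (ch j)\<close> show False by simp
    qed
    moreover have "?P (ch j) \<subseteq> ?P (ch (Suc j))"
      using sub by (auto simp: face_ideal_def dest: in_semigroup_mono)
    ultimately show ?thesis using qin unfolding P_def by blast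
  qed
  ultimately have "(\<forall>i\<le>card F. primeideal (P i) ?B) \<and> (\<forall>i<card F. P i \<subset> P (Suc i))" by blast
  then have "enat (card F) \<le> krull_dim ?B"
    unfolding krull_dim_def by (intro Sup_upper CollectI exI[of _ "card F"] conjI refl exI[of _ P]) auto
  then show ?thesis unfolding analytic_spread_eq[OF up_closed_up_hull] by simp
qed

lemma corner_persists:
  fixes G :: "('v::finite) exps set"
  assumes G: "finite G" "\<And>g. g \<in> G \<Longrightarrow> (\<Sum>v\<in>UNIV. lookup g v) \<le> d"
    and corner: "corner (power_saturation (up_hull G) n) F \<beta>" and n: "n \<ge> 1" "n' \<ge> 1"
    and n': "card F \<ge> 3 \<Longrightarrow> n' \<ge> card F * (card F - 1) * d ^ (card F - 2)"
  shows "\<exists>\<beta>. corner (power_saturation (up_hull G) n') F \<beta>"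
proof (cases "card F \<le> 2")
  case True
  then show ?thesis by (intro corner_low[OF corner] n)
next
  case False
  have "G \<noteq> {}"
  proof
    assume "G = {}"
    then have "power_saturation (up_hull G) n = {}" using power_saturation_empty[OF n(1)] by (simp add: up_hull_def)
    moreover obtain v where "v \<in> F" using False by fastforce
    ultimately show False using corner by (auto simp: corner_def)
  qed
  then obtain a b h where facet: "facet G F a b h" using corner_imp_facet[OF G(1) _ corner] by blast
  \<comment> \<open>Uses \<open>2 \<le> card F - 1\<close>, which is why three variables are
    required here.\<close>
  have "2 * card F * d ^ (card F - 2) \<le> card F * (card F - 1) * d ^ (card F - 2)"
    using False by (intro mult_right_mono) auto
  also have "\<dots> \<le> n'" using n' False by simp
  finally show ?thesis using False by (intro facet_imp_corner[OF G facet]) auto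
qed

theorem theorem1p7:
  fixes I :: "(('v::finite \<Rightarrow>\<^sub>0 nat) \<Rightarrow>\<^sub>0 'k::field) set"
  assumes "monomial_ideal I" and "I \<noteq> carrier mpoly_ring"
  shows "\<forall>n \<ge> n0 I.
    associated_primes mpoly_ring
      (quotient_module mpoly_ring (integral_closure mpoly_ring (ideal_pow mpoly_ring I n))) =
    associated_primes mpoly_ring
      (quotient_module mpoly_ring (integral_closure mpoly_ring (ideal_pow mpoly_ring I (n0 I))))"
proof -
  obtain E where E: "up_closed E" "I = poly_supp E" using monomial_ideal_eq_poly_supp[OF assms(1)] by blast
  define G where "G = min_exps E"
  have G: "finite G" "up_hull G = E" using finite_min_exps up_hull_min_exps[OF E(1)] by (auto simp: G_def)
  let ?d = "max_gen_degree I" and ?l = "analytic_spread I"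
  have deg: "(\<Sum>v\<in>UNIV. lookup g v) \<le> ?d" if "g \<in> G" for g
    using degree_le_max_gen_degree[OF E(1), of g] that by (simp add: G_def E(2))
  have zero: "0 \<notin> E"
  proof
    assume "0 \<in> E"
    then have "x \<in> E" for x using up_closedD[OF E(1), of 0 x] by simp
    then have "E = UNIV" by blast
    then show False using assms(2) by (simp add: E(2) poly_supp_def)
  qed
  have d1: "?d \<ge> 1" if ne: "G \<noteq> {}"
  proof -
    obtain g where g: "g \<in> G" using ne by blast
    then have "g \<noteq> 0" using zero by (auto simp: G_def min_exps_def)
    then obtain v where "lookup g v \<noteq> 0" by (metis lookup_zero poly_mapping_eqI)
    then have "1 \<le> (\<Sum>v\<in>UNIV. lookup g v)" using member_le_sum[of v UNIV "lookup g"] by simp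
    with deg[OF g] show ?thesis by simp
  qed
  \<comment> \<open>Power 0 must be excluded: its closure is the whole ring, which has no
    corners.\<close>
  have n0: "n0 I \<ge> 1"
  proof (cases "G = {}")
    case True
    then have "E = {}" using G(2) by (simp add: up_hull_def)
    then show ?thesis by (simp add: n0_def E(2) analytic_spread_zero_ideal)
  next
    case False
    then show ?thesis using d1 by (auto simp: n0_def Suc_le_eq)
  qed
  \<comment> \<open>The bound grows with the number of variables, since \<open>?d \<ge> 1\<close>,
    so it may be evaluated at the analytic spread instead of \<open>card F\<close>.\<close>
  have bound: "card F * (card F - 1) * ?d ^ (card F - 2) \<le> n0 I"
    if corner: "corner (power_saturation E n) F \<beta>" and F: "card F \<ge> 3" and n: "n \<ge> 1" for n F \<beta>
  proof -
    have "G \<noteq> {}"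
    proof
      assume "G = {}"
      then have "E = {}" using G(2) by (simp add: up_hull_def)
      then have "power_saturation E n = {}" using power_saturation_empty[OF n] by simp
      moreover obtain v where "v \<in> F" using F by fastforce
      ultimately show False using corner by (auto simp: corner_def)
    qed
    then have l: "card F \<le> ?l"
      using corner_card_le_analytic_spread[OF G(1), where 'k = 'k] corner unfolding G(2) E(2) by blast
    have "card F * (card F - 1) * ?d ^ (card F - 2) \<le> ?l * (?l - 1) * ?d ^ (?l - 2)"
      using l d1[OF \<open>G \<noteq> {}\<close>] by (intro mult_mono power_increasing) auto
    also have "\<dots> = n0 I" using l F by (simp add: n0_def)
    finally show ?thesis .
  qed
  define C where "C = power_saturation E"
  have upC: "up_closed (C n)" for n unfolding C_def by (rule up_closed_power_saturation[OF E(1)])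
  have ic: "integral_closure mpoly_ring (ideal_pow mpoly_ring I n) = poly_supp (C n)" for n
    using integral_closure_ideal_pow[OF G(1), where 'k = 'k] unfolding G(2) E(2) C_def .
  have ass: "associated_primes mpoly_ring (quotient_module mpoly_ring (integral_closure mpoly_ring (ideal_pow mpoly_ring I n))) =
    {P. primeideal P type_ring \<and> (\<exists>f. P = {a. a * f \<in> poly_supp (C n)})}" for n
    unfolding ic by (rule associated_primes_type_ring[OF ideal_poly_supp[OF upC]])
  \<comment> \<open>Symmetric in \<open>n\<close> and \<open>n'\<close>, so it gives both inclusions
    at the end.\<close>
  have sub: "\<exists>f. P = {a. a * f \<in> poly_supp (C n')}"
    if P: "primeideal P type_ring" "\<exists>f. P = {a. a * f \<in> poly_supp (C n)}" and n: "n \<ge> n0 I" "n' \<ge> n0 I"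
    for n n' and P :: "('v, 'k) mpoly set"
  proof -
    obtain F \<beta> where F: "corner (C n) F \<beta>" "P = var_ideal F"
      using associated_prime_monomial[OF upC P] by blast
    have n1: "n \<ge> 1" "n' \<ge> 1" using n n0 by auto
    have "card F * (card F - 1) * ?d ^ (card F - 2) \<le> n'" if "card F \<ge> 3"
      using bound[OF F(1)[unfolded C_def] that n1(1)] n(2) by simp
    then obtain \<beta>' where "corner (C n') F \<beta>'"
      using corner_persists[OF G(1) deg, of n F \<beta> n'] F(1) n1 unfolding G(2) C_def by blast
    from annihilator_of_corner[OF upC this, where 'k = 'k] F(2) show ?thesis by blast
  qed
  show ?thesis
  proof (intro allI impI)
    fix n assume "n0 I \<le> n"
    then show "associated_primes mpoly_ring
      (quotient_module mpoly_ring (integral_closure mpoly_ring (ideal_pow mpoly_ring I n))) =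
    associated_primes mpoly_ring
      (quotient_module mpoly_ring (integral_closure mpoly_ring (ideal_pow mpoly_ring I (n0 I))))"
      unfolding ass using sub[of _ n "n0 I"] sub[of _ "n0 I" n] by blast
  qed
qed

end
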